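(* Suppose that $1<p<3$, $\lambda\in\mathbb{R}$, $a,b>0$, and let $u\in H(T_{\max})$ be a solution of the Kirchhoff problem (K) of the context with $u_0\in H^2(\Omega)\cap H_0^1(\Omega)$, $u_1\in H_0^1(\Omega)$, where $T_{\max}$ is the maximal existence time. Then there exists a constant $K_1>0$ such that $$\|u_t(t)\|_2+\|\nabla u(t)\|_2\le K_1\qquad\text{for all } t\in[0,T_{\max}).$$ Moreover, if $a>0$ is sufficiently small (that is, $0<a<a_0$ for some $a_0>0$ depending only on $\Omega,p,b,\lambda$), $\lambda<b\lambda_1$, $E(0)\le0$ and $\|\nabla u_0\|_2>0$, then $$\|\nabla u(t)\|_2\ge\left(\frac{p+1}2\,b_0\,S_{p+1}^{(p+1)/2}\right)^{1/(p-1)}\qquad\text{for all } t\in[0,T_{\max}).$$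
   Context: $\Omega\subset\mathbb{R}^3$ is a bounded open set with smooth boundary. $\|\cdot\|_q$ is the $L^q(\Omega)$ norm. Problem (K): $$u_{tt}-\Big(a\int_\Omega|\nabla u|^2dx+b\Big)\Delta u=\lambda u+|u|^{p-1}u\ (t>0,\ x\in\Omega),\quad u(0,x)=u_0(x),\ u_t(0,x)=u_1(x)\ (x\in\Omega),\quad u=0\ (t\ge0,\ x\in\partial\Omega).$$ $H(T)=C([0,T);H_0^1(\Omega)\cap H^2(\Omega))\cap C^1([0,T);H_0^1(\Omega))\cap C^2([0,T);L^2(\Omega))$. For $u_0\in H^2(\Omega)\cap H_0^1(\Omega)$, $u_1\in H_0^1(\Omega)$, problem (K) has a unique solution in $H(T)$ for some $T>0$ (known local existence result); $T_{\max}\in(0,\infty]$ is its maximal existence time. $u(t)$ denotes $u(t,\cdot)$. $\lambda_1>0$ is the principal Dirichlet eigenvalue of $-\Delta$ on $\Omega$. $S_q=\inf_{u\in H_0^1(\Omega)\setminus\{0\}}\|\nabla u\|_2^2/\|u\|_q^2$ for $1<q\le6$. $b_0=b-\lambda/\lambda_1$ if $\lambda\ge0$, $b_0=b$ if $\lambda<0$. $$E(0)=\frac12\|u_1\|_2^2+J(u_0),\qquad J(u)=\frac a4\|\nabla u\|_2^4+\frac b2\|\nabla u\|_2^2-\frac\lambda2\|u\|_2^2-\frac1{p+1}\|u\|_{p+1}^{p+1}.$$ *)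

theory Defs
  imports "HOL-Analysis.Analysis"
begin

section \<open>Smooth functions and smooth boundaries\<close>

text \<open>Meant for open sets, where \<open>frechet_derivative f (at x)\<close> depends on \<open>f\<close> near \<open>x\<close> only.\<close>

primrec Ck_on :: "nat \<Rightarrow> 'a::euclidean_space set \<Rightarrow> ('a \<Rightarrow> real) \<Rightarrow> bool" where
  "Ck_on 0 S f \<longleftrightarrow> continuous_on S f"
| "Ck_on (Suc k) S f \<longleftrightarrow>
     (\<forall>x\<in>S. f differentiable (at x)) \<and> (\<forall>v. Ck_on k S (\<lambda>x. frechet_derivative f (at x) v))"

definition smooth_on :: "'a::euclidean_space set \<Rightarrow> ('a \<Rightarrow> real) \<Rightarrow> bool" where
  "smooth_on S f \<longleftrightarrow> (\<forall>k. Ck_on k S f)"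

text \<open>Near each boundary point, \<open>\<Omega>\<close> is the negative side of a smooth function without critical
  points; in particular \<open>\<Omega>\<close> lies locally on one side of its boundary.\<close>

definition smooth_boundary :: "(real^3) set \<Rightarrow> bool" where
  "smooth_boundary \<Omega> \<longleftrightarrow>
     (\<forall>x\<in>frontier \<Omega>. \<exists>U \<rho>. open U \<and> x \<in> U \<and> smooth_on U \<rho> \<and>
        (\<forall>y\<in>U. frechet_derivative \<rho> (at y) \<noteq> (\<lambda>_. 0)) \<and>
        \<Omega> \<inter> U = {y\<in>U. \<rho> y < 0})"

section \<open>Lebesgue and Sobolev spaces\<close>

text \<open>Elements of the spaces are represented by functions on the whole space whose values outside
  \<open>\<Omega>\<close> are irrelevant; functions that agree almost everywhere in \<open>\<Omega>\<close> are not identified.\<close>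

definition Lp :: "real \<Rightarrow> (real^3) set \<Rightarrow> (real^3 \<Rightarrow> 'b::euclidean_space) set" where
  "Lp q \<Omega> = {f. f \<in> borel_measurable (lebesgue_on \<Omega>) \<and>
                 integrable (lebesgue_on \<Omega>) (\<lambda>x. norm (f x) powr q)}"

definition Lp_norm :: "real \<Rightarrow> (real^3) set \<Rightarrow> (real^3 \<Rightarrow> 'b::euclidean_space) \<Rightarrow> real" where
  "Lp_norm q \<Omega> f = (\<integral>x. norm (f x) powr q \<partial>lebesgue_on \<Omega>) powr (1 / q)"

definition test_functions :: "(real^3) set \<Rightarrow> (real^3 \<Rightarrow> real) set" where
  "test_functions \<Omega> = {\<phi>. smooth_on UNIV \<phi> \<and>
      compact (closure {x. \<phi> x \<noteq> 0}) \<and> closure {x. \<phi> x \<noteq> 0} \<subseteq> \<Omega>}"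

definition locally_integrable :: "(real^3) set \<Rightarrow> (real^3 \<Rightarrow> real) \<Rightarrow> bool" where
  "locally_integrable \<Omega> f \<longleftrightarrow> (\<forall>K. compact K \<and> K \<subseteq> \<Omega> \<longrightarrow> f absolutely_integrable_on K)"

definition is_weak_partial ::
  "(real^3) set \<Rightarrow> 3 \<Rightarrow> (real^3 \<Rightarrow> real) \<Rightarrow> (real^3 \<Rightarrow> real) \<Rightarrow> bool" where
  "is_weak_partial \<Omega> i f g \<longleftrightarrow> locally_integrable \<Omega> f \<and> locally_integrable \<Omega> g \<and>
     (\<forall>\<phi>\<in>test_functions \<Omega>.
        (\<integral>x. f x * frechet_derivative \<phi> (at x) (axis i 1) \<partial>lebesgue_on \<Omega>)
          = - (\<integral>x. g x * \<phi> x \<partial>lebesgue_on \<Omega>))"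

text \<open>Weak derivatives are unique only up to null sets, hence the choice; all notions below are
  insensitive to it.\<close>

definition weak_partial :: "(real^3) set \<Rightarrow> 3 \<Rightarrow> (real^3 \<Rightarrow> real) \<Rightarrow> real^3 \<Rightarrow> real" where
  "weak_partial \<Omega> i f = (SOME g. is_weak_partial \<Omega> i f g)"

definition weak_grad :: "(real^3) set \<Rightarrow> (real^3 \<Rightarrow> real) \<Rightarrow> real^3 \<Rightarrow> real^3" where
  "weak_grad \<Omega> f x = (\<chi> i. weak_partial \<Omega> i f x)"

definition weak_laplacian :: "(real^3) set \<Rightarrow> (real^3 \<Rightarrow> real) \<Rightarrow> real^3 \<Rightarrow> real" where
  "weak_laplacian \<Omega> f x = (\<Sum>i\<in>UNIV. weak_partial \<Omega> i (weak_partial \<Omega> i f) x)"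

definition H1 :: "(real^3) set \<Rightarrow> (real^3 \<Rightarrow> real) set" where
  "H1 \<Omega> = {f \<in> Lp 2 \<Omega>. \<forall>i. \<exists>g\<in>Lp 2 \<Omega>. is_weak_partial \<Omega> i f g}"

definition H2 :: "(real^3) set \<Rightarrow> (real^3 \<Rightarrow> real) set" where
  "H2 \<Omega> = {f \<in> Lp 2 \<Omega>. \<forall>i. \<exists>g\<in>H1 \<Omega>. is_weak_partial \<Omega> i f g}"

definition H1_norm :: "(real^3) set \<Rightarrow> (real^3 \<Rightarrow> real) \<Rightarrow> real" where
  "H1_norm \<Omega> f = sqrt ((Lp_norm 2 \<Omega> f)\<^sup>2 + (Lp_norm 2 \<Omega> (weak_grad \<Omega> f))\<^sup>2)"

definition H2_norm :: "(real^3) set \<Rightarrow> (real^3 \<Rightarrow> real) \<Rightarrow> real" where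
  "H2_norm \<Omega> f = sqrt ((H1_norm \<Omega> f)\<^sup>2 +
     (\<Sum>i\<in>UNIV. \<Sum>j\<in>UNIV. (Lp_norm 2 \<Omega> (weak_partial \<Omega> j (weak_partial \<Omega> i f)))\<^sup>2))"

definition H10 :: "(real^3) set \<Rightarrow> (real^3 \<Rightarrow> real) set" where
  "H10 \<Omega> = {f \<in> H1 \<Omega>. \<forall>\<epsilon>>0. \<exists>\<phi>\<in>test_functions \<Omega>. H1_norm \<Omega> (\<lambda>x. f x - \<phi> x) < \<epsilon>}"

section \<open>Principal eigenvalue and Sobolev constants\<close>

definition dirichlet_eigenvalue :: "(real^3) set \<Rightarrow> real \<Rightarrow> bool" where
  "dirichlet_eigenvalue \<Omega> \<mu> \<longleftrightarrow>
     (\<exists>u\<in>H10 \<Omega>. \<not> (AE x in lebesgue_on \<Omega>. u x = 0) \<and>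
        (\<forall>v\<in>H10 \<Omega>. (\<integral>x. weak_grad \<Omega> u x \<bullet> weak_grad \<Omega> v x \<partial>lebesgue_on \<Omega>)
                     = \<mu> * (\<integral>x. u x * v x \<partial>lebesgue_on \<Omega>)))"

definition principal_eigenvalue :: "(real^3) set \<Rightarrow> real" where
  "principal_eigenvalue \<Omega> = (LEAST \<mu>. dirichlet_eigenvalue \<Omega> \<mu>)"

definition sobolev_const :: "real \<Rightarrow> (real^3) set \<Rightarrow> real" where
  "sobolev_const q \<Omega> = Inf {(Lp_norm 2 \<Omega> (weak_grad \<Omega> u))\<^sup>2 / (Lp_norm q \<Omega> u)\<^sup>2 | u.
      u \<in> H10 \<Omega> \<and> \<not> (AE x in lebesgue_on \<Omega>. u x = 0)}"

definition b_zero :: "(real^3) set \<Rightarrow> real \<Rightarrow> real \<Rightarrow> real" where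
  "b_zero \<Omega> b lam = (if lam \<ge> 0 then b - lam / principal_eigenvalue \<Omega> else b)"

section \<open>Curves in function spaces\<close>

text \<open>A function space is given by its carrier \<open>X\<close> and its norm \<open>N\<close>. At the left end point of the
  time interval \<open>I\<close> continuity and derivatives are one-sided.\<close>

definition cont_curve ::
  "('a \<Rightarrow> real) set \<Rightarrow> (('a \<Rightarrow> real) \<Rightarrow> real) \<Rightarrow> real set \<Rightarrow> (real \<Rightarrow> 'a \<Rightarrow> real) \<Rightarrow> bool" where
  "cont_curve X N I u \<longleftrightarrow>
     (\<forall>t\<in>I. u t \<in> X \<and> ((\<lambda>s. N (\<lambda>x. u s x - u t x)) \<longlongrightarrow> 0) (at t within I))"

definition has_curve_deriv ::
  "('a \<Rightarrow> real) set \<Rightarrow> (('a \<Rightarrow> real) \<Rightarrow> real) \<Rightarrow> real set \<Rightarrow> (real \<Rightarrow> 'a \<Rightarrow> real) \<Rightarrow> real \<Rightarrow>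
   ('a \<Rightarrow> real) \<Rightarrow> bool" where
  "has_curve_deriv X N I u t v \<longleftrightarrow>
     v \<in> X \<and> ((\<lambda>s. N (\<lambda>x. (u s x - u t x) / (s - t) - v x)) \<longlongrightarrow> 0) (at t within I)"

primrec Ck_curve ::
  "nat \<Rightarrow> ('a \<Rightarrow> real) set \<Rightarrow> (('a \<Rightarrow> real) \<Rightarrow> real) \<Rightarrow> real set \<Rightarrow> (real \<Rightarrow> 'a \<Rightarrow> real) \<Rightarrow> bool" where
  "Ck_curve 0 X N I u \<longleftrightarrow> cont_curve X N I u"
| "Ck_curve (Suc k) X N I u \<longleftrightarrow> cont_curve X N I u \<and>
     (\<exists>v. (\<forall>t\<in>I. has_curve_deriv X N I u t (v t)) \<and> Ck_curve k X N I v)"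

definition time_interval :: "ereal \<Rightarrow> real set" where
  "time_interval T = {t. 0 \<le> t \<and> ereal t < T}"

text \<open>Convergence in \<open>H\<^sub>0\<^sup>1\<close> implies convergence in \<open>L\<^sup>2\<close>, so the derivative in \<open>L\<^sup>2\<close> also represents
  the derivative in \<open>H\<^sub>0\<^sup>1\<close> whenever the latter exists.\<close>

definition time_deriv ::
  "(real^3) set \<Rightarrow> ereal \<Rightarrow> (real \<Rightarrow> real^3 \<Rightarrow> real) \<Rightarrow> real \<Rightarrow> real^3 \<Rightarrow> real" where
  "time_deriv \<Omega> T u t =
     (SOME v. has_curve_deriv (Lp 2 \<Omega>) (Lp_norm 2 \<Omega>) (time_interval T) u t v)"

definition solution_space :: "(real^3) set \<Rightarrow> ereal \<Rightarrow> (real \<Rightarrow> real^3 \<Rightarrow> real) set" where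
  "solution_space \<Omega> T = {u.
     Ck_curve 0 (H10 \<Omega> \<inter> H2 \<Omega>) (H2_norm \<Omega>) (time_interval T) u \<and>
     Ck_curve 1 (H10 \<Omega>) (H1_norm \<Omega>) (time_interval T) u \<and>
     Ck_curve 2 (Lp 2 \<Omega>) (Lp_norm 2 \<Omega>) (time_interval T) u}"

section \<open>The Kirchhoff problem\<close>

text \<open>The boundary condition is contained in the membership of \<open>u t\<close> in \<open>H\<^sub>0\<^sup>1\<close>.\<close>

definition kirchhoff_solution ::
  "(real^3) set \<Rightarrow> real \<Rightarrow> real \<Rightarrow> real \<Rightarrow> real \<Rightarrow> (real^3 \<Rightarrow> real) \<Rightarrow> (real^3 \<Rightarrow> real) \<Rightarrow> ereal \<Rightarrow>
   (real \<Rightarrow> real^3 \<Rightarrow> real) \<Rightarrow> bool" where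
  "kirchhoff_solution \<Omega> a b lam p u0 u1 T u \<longleftrightarrow> 0 < T \<and> u \<in> solution_space \<Omega> T \<and>
     (\<forall>t\<in>time_interval T. 0 < t \<longrightarrow>
        (AE x in lebesgue_on \<Omega>.
           time_deriv \<Omega> T (time_deriv \<Omega> T u) t x
             - (a * (\<integral>y. (norm (weak_grad \<Omega> (u t) y))\<^sup>2 \<partial>lebesgue_on \<Omega>) + b)
                 * weak_laplacian \<Omega> (u t) x
           = lam * u t x + \<bar>u t x\<bar> powr (p - 1) * u t x)) \<and>
     (AE x in lebesgue_on \<Omega>. u 0 x = u0 x) \<and>
     (AE x in lebesgue_on \<Omega>. time_deriv \<Omega> T u 0 x = u1 x)"

definition max_existence_time ::
  "(real^3) set \<Rightarrow> real \<Rightarrow> real \<Rightarrow> real \<Rightarrow> real \<Rightarrow> (real^3 \<Rightarrow> real) \<Rightarrow> (real^3 \<Rightarrow> real) \<Rightarrow> ereal" where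
  "max_existence_time \<Omega> a b lam p u0 u1 = Sup {T. \<exists>u. kirchhoff_solution \<Omega> a b lam p u0 u1 T u}"

definition potential_energy ::
  "(real^3) set \<Rightarrow> real \<Rightarrow> real \<Rightarrow> real \<Rightarrow> real \<Rightarrow> (real^3 \<Rightarrow> real) \<Rightarrow> real" where
  "potential_energy \<Omega> a b lam p u =
     a / 4 * (Lp_norm 2 \<Omega> (weak_grad \<Omega> u)) ^ 4 + b / 2 * (Lp_norm 2 \<Omega> (weak_grad \<Omega> u))\<^sup>2
     - lam / 2 * (Lp_norm 2 \<Omega> u)\<^sup>2 - 1 / (p + 1) * Lp_norm (p + 1) \<Omega> u powr (p + 1)"

definition initial_energy ::
  "(real^3) set \<Rightarrow> real \<Rightarrow> real \<Rightarrow> real \<Rightarrow> real \<Rightarrow> (real^3 \<Rightarrow> real) \<Rightarrow> (real^3 \<Rightarrow> real) \<Rightarrow> real" where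
  "initial_energy \<Omega> a b lam p u0 u1 =
     1 / 2 * (Lp_norm 2 \<Omega> u1)\<^sup>2 + potential_energy \<Omega> a b lam p u0"

end

theory Submission
  imports Defs "HOL-Complex_Analysis.Great_Picard" "HOL-Library.Diagonal_Subsequence"
begin

text \<open>The energy \<open>\<parallel>u\<^sub>t\<parallel>\<^sup>2/2 + J(u)\<close> is conserved: the nonlinear part of \<open>J\<close> is differentiable along the
  curve because its Taylor remainder is bounded by \<open>\<parallel>\<nabla>(u(s) - u(t))\<parallel>\<^sup>2\<close>, and the derivative vanishes
  by testing the equation with \<open>u\<^sub>t\<close>. Since \<open>p + 1 < 4\<close>, the quartic term of the energy dominates
  \<open>\<parallel>u\<parallel>\<^sub>2\<^sup>2\<close> and the \<open>L\<^sup>p\<^sup>+\<^sup>1\<close> term by the Sobolev inequality, which bounds the solution. If the energy is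
  nonpositive, the variational characterization of the principal eigenvalue and the definition of
  the Sobolev constant show that \<open>\<parallel>\<nabla>u(t)\<parallel>\<close> is either zero or above the threshold; as it is
  continuous in \<open>t\<close> and initially positive, it stays above.

  The Sobolev inequality is reduced to the Loomis--Whitney inequality. The eigenvalue defined as a
  least element exists because, by Rellich compactness, the Rayleigh quotient has a minimizer.\<close>

section \<open>Semi-inner products on function spaces\<close>

text \<open>Functions are not identified almost everywhere, and \<open>weak_partial\<close> and
  \<open>time_deriv\<close> are arbitrary choices, so the natural structure is a set of functions
  with a semidefinite form; the L2, Dirichlet and H1 forms are three instances. The choices become
  harmless once two weak derivatives, or two L2 derivatives of a curve, are known to agree almost
  everywhere. Since \<open>H10\<close> is a closure of test functions, inequalities are obtained for
  test functions by classical calculus and carried over by density.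

  The delicate point of energy conservation is that the velocity has two roles. Testing the equation
  requires an element of \<open>H10\<close>, for Green's formula; differentiating the kinetic energy
  requires a curve in L2 that is differentiable again. The solution space supplies both, as
  derivatives in different norms, and the argument rests on their agreement almost everywhere at
  each time. The bound p < 3 also keeps |u|^p in L2, the Sobolev exponent 6 being twice 3.\<close>

locale semi_inner =
  fixes V :: "('a \<Rightarrow> real) set" and B :: "('a \<Rightarrow> real) \<Rightarrow> ('a \<Rightarrow> real) \<Rightarrow> real"
  assumes zero_mem: "(\<lambda>x. 0) \<in> V"
    and add_mem: "\<And>f g. f \<in> V \<Longrightarrow> g \<in> V \<Longrightarrow> (\<lambda>x. f x + g x) \<in> V"
    and scale_mem: "\<And>c f. f \<in> V \<Longrightarrow> (\<lambda>x. c * f x) \<in> V"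
    and B_add: "\<And>f g h. f \<in> V \<Longrightarrow> g \<in> V \<Longrightarrow> h \<in> V \<Longrightarrow> B (\<lambda>x. f x + g x) h = B f h + B g h"
    and B_scale: "\<And>c f h. f \<in> V \<Longrightarrow> h \<in> V \<Longrightarrow> B (\<lambda>x. c * f x) h = c * B f h"
    and B_sym: "\<And>f g. f \<in> V \<Longrightarrow> g \<in> V \<Longrightarrow> B f g = B g f"
    and B_pos: "\<And>f. f \<in> V \<Longrightarrow> 0 \<le> B f f"
begin

definition N :: "('a \<Rightarrow> real) \<Rightarrow> real" where "N f = sqrt (B f f)"

lemma N_sq: "f \<in> V \<Longrightarrow> (N f)\<^sup>2 = B f f"
  by (simp add: N_def B_pos)

lemma N_nonneg: "f \<in> V \<Longrightarrow> 0 \<le> N f"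
  by (simp add: N_def B_pos)

lemma diff_mem: "f \<in> V \<Longrightarrow> g \<in> V \<Longrightarrow> (\<lambda>x. f x - g x) \<in> V"
  using add_mem[of f "\<lambda>x. (-1) * g x"] scale_mem[of g "-1"] by simp

lemma B_diff: "f \<in> V \<Longrightarrow> g \<in> V \<Longrightarrow> h \<in> V \<Longrightarrow> B (\<lambda>x. f x - g x) h = B f h - B g h"
  using B_add[of f "\<lambda>x. (-1) * g x" h] scale_mem[of g "-1"] B_scale[of g h "-1"] by simp

lemma B_add_right: "f \<in> V \<Longrightarrow> g \<in> V \<Longrightarrow> h \<in> V \<Longrightarrow> B h (\<lambda>x. f x + g x) = B h f + B h g"
  by (simp add: B_add B_sym[of h] add_mem)

lemma B_diff_right: "f \<in> V \<Longrightarrow> g \<in> V \<Longrightarrow> h \<in> V \<Longrightarrow> B h (\<lambda>x. f x - g x) = B h f - B h g"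
  by (simp add: B_diff B_sym[of h] diff_mem)

lemma B_scale_right: "f \<in> V \<Longrightarrow> h \<in> V \<Longrightarrow> B h (\<lambda>x. c * f x) = c * B h f"
  by (simp add: B_scale B_sym[of h] scale_mem)

lemma N_scale: "f \<in> V \<Longrightarrow> N (\<lambda>x. c * f x) = \<bar>c\<bar> * N f"
  by (simp add: N_def B_scale B_scale_right scale_mem real_sqrt_mult mult.assoc[symmetric]
      flip: power2_eq_square)

lemma B_expand:
  "f \<in> V \<Longrightarrow> g \<in> V \<Longrightarrow> B (\<lambda>x. f x + c * g x) (\<lambda>x. f x + c * g x) = B f f + 2 * c * B f g + c\<^sup>2 * B g g"
  by (simp add: B_add B_add_right add_mem scale_mem B_scale B_scale_right B_sym[of g f]
      power2_eq_square algebra_simps)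

text \<open>A semidefinite form may have \<open>B g g = 0\<close>, where the usual minimizing
  \<open>c\<close> does not exist. The quadratic in \<open>c\<close> is then affine, and its
  nonnegativity for all \<open>c\<close> forces \<open>B f g = 0\<close>.\<close>

lemma Cauchy_Schwarz:
  assumes "f \<in> V" "g \<in> V"
  shows "\<bar>B f g\<bar> \<le> N f * N g"
proof -
  have Q: "0 \<le> B f f + 2 * c * B f g + c\<^sup>2 * B g g" for c
    using B_pos[of "\<lambda>x. f x + c * g x"] B_expand[OF assms] add_mem scale_mem assms by auto
  have "(B f g)\<^sup>2 \<le> B f f * B g g"
  proof (cases "B g g = 0")
    case True
    have "B f g = 0"
    proof (rule ccontr)
      assume *: "B f g \<noteq> 0"
      \<comment> \<open>This \<open>c\<close> gives the affine function the value -1.\<close>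
      show False
        using Q[of "- (B f f + 1) / (2 * B f g)"] * True by (simp add: field_simps)
    qed
    then show ?thesis using True by simp
  next
    case False
    then have gp: "0 < B g g" using B_pos[OF assms(2)] by simp
    have "0 \<le> B f f - (B f g)\<^sup>2 / B g g"
      using Q[of "- B f g / B g g"] gp by (simp add: field_simps power2_eq_square)
    then show ?thesis using gp by (simp add: field_simps)
  qed
  then have "sqrt ((B f g)\<^sup>2) \<le> sqrt (B f f * B g g)"
    by (rule real_sqrt_le_mono)
  then show ?thesis by (simp add: N_def real_sqrt_mult)
qed

lemma N_triangle:
  assumes "f \<in> V" "g \<in> V"
  shows "N (\<lambda>x. f x + g x) \<le> N f + N g"
proof (rule power2_le_imp_le)
  have "(N (\<lambda>x. f x + g x))\<^sup>2 = (N f)\<^sup>2 + 2 * B f g + (N g)\<^sup>2"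
    using B_expand[OF assms, of 1] assms by (simp add: N_sq add_mem)
  also have "\<dots> \<le> (N f + N g)\<^sup>2"
    using Cauchy_Schwarz[OF assms] by (simp add: power2_sum)
  finally show "(N (\<lambda>x. f x + g x))\<^sup>2 \<le> (N f + N g)\<^sup>2" .
qed (use assms N_nonneg in auto)

lemma N_minus: "f \<in> V \<Longrightarrow> g \<in> V \<Longrightarrow> N (\<lambda>x. f x - g x) = N (\<lambda>x. g x - f x)"
  using N_scale[of "\<lambda>x. g x - f x" "-1"] diff_mem[of g f] by simp

lemma N_triangle_diff:
  assumes "f \<in> V" "g \<in> V"
  shows "N f \<le> N g + N (\<lambda>x. f x - g x)"
  using N_triangle[of g "\<lambda>x. f x - g x"] diff_mem[OF assms] assms by simp

lemma N_triangle_rev: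
  assumes "f \<in> V" "g \<in> V"
  shows "\<bar>N f - N g\<bar> \<le> N (\<lambda>x. f x - g x)"
  using N_triangle_diff[OF assms] N_triangle_diff[OF assms(2,1)] N_minus[OF assms] by linarith

lemma parallelogram:
  assumes "f \<in> V" "g \<in> V"
  shows "(N (\<lambda>x. f x - g x))\<^sup>2 = 2 * (N f)\<^sup>2 + 2 * (N g)\<^sup>2 - (N (\<lambda>x. f x + g x))\<^sup>2"
  using B_expand[OF assms, of 1] B_expand[OF assms, of "-1"] assms
  by (simp add: N_sq add_mem diff_mem)

lemma tendsto_N:
  assumes "\<forall>\<^sub>F s in F. u s \<in> V" "f \<in> V" "((\<lambda>s. N (\<lambda>x. u s x - f x)) \<longlongrightarrow> 0) F"
  shows "((\<lambda>s. N (u s)) \<longlongrightarrow> N f) F"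
proof (rule LIM_zero_cancel, rule Lim_null_comparison[OF _ assms(3)])
  show "\<forall>\<^sub>F s in F. norm (N (u s) - N f) \<le> N (\<lambda>x. u s x - f x)"
    using assms(1) by eventually_elim (use N_triangle_rev assms(2) in auto)
qed

lemma tendsto_B:
  assumes "\<forall>\<^sub>F s in F. u s \<in> V" "f \<in> V" "((\<lambda>s. N (\<lambda>x. u s x - f x)) \<longlongrightarrow> 0) F" "g \<in> V"
  shows "((\<lambda>s. B g (u s)) \<longlongrightarrow> B g f) F"
proof (rule LIM_zero_cancel, rule Lim_null_comparison)
  show "\<forall>\<^sub>F s in F. norm (B g (u s) - B g f) \<le> N g * N (\<lambda>x. u s x - f x)"
    using assms(1)
  proof eventually_elim
    case (elim s)
    then show ?case using Cauchy_Schwarz[of g "\<lambda>x. u s x - f x"] assms diff_mem[of "u s" f]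
      by (simp add: B_diff_right)
  qed
  show "((\<lambda>s. N g * N (\<lambda>x. u s x - f x)) \<longlongrightarrow> 0) F"
    using tendsto_mult_right_zero[OF assms(3)] by simp
qed

lemma quotient_mem:
  "f \<in> V \<Longrightarrow> g \<in> V \<Longrightarrow> (\<lambda>x. (f x - g x) / (c::real)) \<in> V"
  using scale_mem[OF diff_mem, of f g "1 / c"] by (simp add: divide_inverse mult.commute)

text \<open>With \<open>d s\<close> the difference quotient of the curve, the quotient of the
  squares equals \<open>2 * B (u t) (d s)\<close> plus \<open>s - t\<close> times the square of
  \<open>N (d s)\<close>, exactly. Convergence of \<open>d s\<close> in the seminorm therefore
  suffices.\<close>

lemma has_derivative_square:
  assumes uV: "\<And>s. s \<in> I \<Longrightarrow> u s \<in> V" and "v \<in> V" "t \<in> I"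
    and lim: "((\<lambda>s. N (\<lambda>x. (u s x - u t x) / (s - t) - v x)) \<longlongrightarrow> 0) (at t within I)"
  shows "((\<lambda>s. B (u s) (u s)) has_real_derivative 2 * B (u t) v) (at t within I)"
proof -
  define d where "d s = (\<lambda>x. (u s x - u t x) / (s - t))" for s
  have utV: "u t \<in> V" using assms by auto
  have I: "\<forall>\<^sub>F s in at t within I. s \<in> I \<and> s \<noteq> t"
    by (auto simp: eventually_at_filter)
  have dV: "\<forall>\<^sub>F s in at t within I. d s \<in> V"
    using I by eventually_elim (auto simp: d_def intro!: quotient_mem uV utV)
  have limd: "((\<lambda>s. N (\<lambda>x. d s x - v x)) \<longlongrightarrow> 0) (at t within I)"
    using lim by (simp add: d_def)
  have 1: "((\<lambda>s. B (u t) (d s)) \<longlongrightarrow> B (u t) v) (at t within I)"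
    by (rule tendsto_B[OF dV \<open>v \<in> V\<close> limd utV])
  have 2: "((\<lambda>s. N (d s)) \<longlongrightarrow> N v) (at t within I)"
    by (rule tendsto_N[OF dV \<open>v \<in> V\<close> limd])
  have "((\<lambda>s. 2 * B (u t) (d s) + (s - t) * (N (d s))\<^sup>2) \<longlongrightarrow> 2 * B (u t) v + (t - t) * (N v)\<^sup>2)
      (at t within I)"
    by (intro tendsto_intros 1 2)
  then have "((\<lambda>s. 2 * B (u t) (d s) + (s - t) * (N (d s))\<^sup>2) \<longlongrightarrow> 2 * B (u t) v) (at t within I)"
    by simp
  moreover have "\<forall>\<^sub>F s in at t within I. 2 * B (u t) (d s) + (s - t) * (N (d s))\<^sup>2
      = (B (u s) (u s) - B (u t) (u t)) / (s - t)"
    using I dV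
  proof eventually_elim
    case (elim s)
    have "u s = (\<lambda>x. u t x + (s - t) * d s x)" using elim by (auto simp: d_def)
    then have "B (u s) (u s) = B (u t) (u t) + 2 * (s - t) * B (u t) (d s) + (s - t)\<^sup>2 * B (d s) (d s)"
      using B_expand[OF utV, of "d s" "s - t"] elim by simp
    moreover have "(N (d s))\<^sup>2 = B (d s) (d s)" using elim by (simp add: N_sq)
    ultimately show ?case using elim by (simp add: field_simps power2_eq_square)
  qed
  ultimately show ?thesis
    unfolding has_field_derivative_iff by (rule Lim_transform_eventually)
qed

end

text \<open>The first-order condition at a minimum; it turns the minimizer of the Rayleigh quotient
  into a weak eigenfunction.\<close>

lemma quadratic_nonneg_imp_linear_zero:
  fixes b c :: real
  assumes "\<And>t. 0 \<le> 2 * t * b + t\<^sup>2 * c"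
  shows "b = 0"
proof (rule ccontr)
  assume "b \<noteq> 0"
  have c: "0 \<le> c" using assms[of 1] assms[of "-1"] by simp
  \<comment> \<open>Dividing by \<open>c + 1\<close> instead of \<open>c\<close> covers the
    degenerate case \<open>c = 0\<close> too.\<close>
  have "0 \<le> 2 * (- b / (c + 1)) * b + (- b / (c + 1))\<^sup>2 * c" by (rule assms)
  also have "\<dots> = b\<^sup>2 * (- 2 * (c + 1) + c) / (c + 1)\<^sup>2"
    using c by (simp add: divide_simps) (simp add: algebra_simps power2_eq_square)
  also have "\<dots> < 0" using c \<open>b \<noteq> 0\<close> by (intro divide_neg_pos mult_pos_neg) auto
  finally show False by simp
qed

section \<open>Square integrable functions\<close>

definition L2 :: "'a measure \<Rightarrow> ('a \<Rightarrow> real) set" where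
  "L2 M = {f \<in> borel_measurable M. integrable M (\<lambda>x. (f x)\<^sup>2)}"

definition ip :: "'a measure \<Rightarrow> ('a \<Rightarrow> real) \<Rightarrow> ('a \<Rightarrow> real) \<Rightarrow> real" where
  "ip M f g = (\<integral>x. f x * g x \<partial>M)"

lemma L2_measurable: "f \<in> L2 M \<Longrightarrow> f \<in> borel_measurable M"
  and L2_integrable_sq: "f \<in> L2 M \<Longrightarrow> integrable M (\<lambda>x. (f x)\<^sup>2)"
  by (auto simp: L2_def)

lemma L2_bound:
  assumes "f \<in> borel_measurable M" "integrable M g" "AE x in M. (f x)\<^sup>2 \<le> g x"
  shows "f \<in> L2 M"
  unfolding L2_def
proof safe
  have [measurable]: "f \<in> borel_measurable M" by fact
  show "integrable M (\<lambda>x. (f x)\<^sup>2)"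
    by (rule Bochner_Integration.integrable_bound[OF assms(2)])
      (use assms(3) in \<open>auto elim!: eventually_mono\<close>)
qed fact

lemma L2_integrable_mult:
  assumes "f \<in> L2 M" "g \<in> L2 M"
  shows "integrable M (\<lambda>x. f x * g x)"
proof (rule Bochner_Integration.integrable_bound)
  note [measurable] = L2_measurable[OF assms(1)] L2_measurable[OF assms(2)]
  show "integrable M (\<lambda>x. (f x)\<^sup>2 + (g x)\<^sup>2)" using assms by (auto simp: L2_def)
  show "(\<lambda>x. f x * g x) \<in> borel_measurable M" by measurable
  have "\<bar>a * b\<bar> \<le> a\<^sup>2 + b\<^sup>2" for a b :: real
  proof -
    have "2 * (\<bar>a\<bar> * \<bar>b\<bar>) \<le> a\<^sup>2 + b\<^sup>2" using sum_squares_bound[of "\<bar>a\<bar>" "\<bar>b\<bar>"] by simp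
    moreover have "0 \<le> \<bar>a\<bar> * \<bar>b\<bar>" by simp
    ultimately show ?thesis unfolding abs_mult by linarith
  qed
  then show "AE x in M. norm (f x * g x) \<le> norm ((f x)\<^sup>2 + (g x)\<^sup>2)"
    by simp
qed

lemma L2_zero: "(\<lambda>x. 0) \<in> L2 M" by (simp add: L2_def)

lemma L2_scale: "f \<in> L2 M \<Longrightarrow> (\<lambda>x. c * f x) \<in> L2 M"
  by (auto simp: L2_def power_mult_distrib)

lemma L2_add:
  assumes "f \<in> L2 M" "g \<in> L2 M"
  shows "(\<lambda>x. f x + g x) \<in> L2 M"
proof -
  have "integrable M (\<lambda>x. (f x)\<^sup>2 + (g x)\<^sup>2 + 2 * (f x * g x))"
    using assms L2_integrable_mult[OF assms] by (auto simp: L2_def)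
  moreover have "(\<lambda>x. (f x + g x)\<^sup>2) = (\<lambda>x. (f x)\<^sup>2 + (g x)\<^sup>2 + 2 * (f x * g x))"
    by (simp add: power2_sum mult.assoc)
  ultimately show ?thesis using assms by (simp add: L2_def borel_measurable_add)
qed

interpretation L2: semi_inner "L2 M" "ip M" for M :: "'a measure"
proof
  fix f g h :: "'a \<Rightarrow> real" and c :: real
  assume "f \<in> L2 M" "g \<in> L2 M" "h \<in> L2 M"
  then show "ip M (\<lambda>x. f x + g x) h = ip M f h + ip M g h"
    by (simp add: ip_def distrib_right L2_integrable_mult)
qed (auto simp: L2_zero L2_scale L2_add ip_def mult.assoc mult.commute[of _ "_ :: real"] simp flip: integral_mult_right_zero
    intro!: Bochner_Integration.integral_cong)

lemma L2_AE_cong: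
  assumes "f \<in> L2 M" "g \<in> borel_measurable M" "AE x in M. f x = g x"
  shows "g \<in> L2 M"
  by (rule L2_bound[OF assms(2) L2_integrable_sq[OF assms(1)]]) (use assms(3) in auto)

lemma ip_AE_cong:
  assumes "f \<in> borel_measurable M" "f' \<in> borel_measurable M"
    "g \<in> borel_measurable M" "g' \<in> borel_measurable M"
    "AE x in M. f x = f' x" "AE x in M. g x = g' x"
  shows "ip M f g = ip M f' g'"
  unfolding ip_def
proof (rule integral_cong_AE)
  show "AE x in M. f x * g x = f' x * g' x" using assms(5,6) by eventually_elim simp
qed (use assms in measurable)

lemma N_AE_cong:
  assumes "f \<in> borel_measurable M" "g \<in> borel_measurable M" "AE x in M. f x = g x"
  shows "L2.N M f = L2.N M g"
  by (simp add: L2.N_def ip_AE_cong[OF assms(1,2) assms(1,2) assms(3,3)])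

lemma N_zero_AE:
  assumes "f \<in> L2 M" "L2.N M f = 0"
  shows "AE x in M. f x = 0"
proof -
  have "(\<integral>x. (f x)\<^sup>2 \<partial>M) = 0"
    using assms by (simp add: L2.N_def ip_def power2_eq_square)
  then have "AE x in M. (f x)\<^sup>2 = 0"
    using integral_nonneg_eq_0_iff_AE[of M "\<lambda>x. (f x)\<^sup>2"] L2_integrable_sq[OF assms(1)] by simp
  then show ?thesis by simp
qed

text \<open>Cauchy--Schwarz against the constant 1, which is square integrable because the measure
  is finite.\<close>

lemma integral_abs_le_N:
  assumes "finite_measure M" "f \<in> L2 M"
  shows "integrable M f" "(\<integral>x. \<bar>f x\<bar> \<partial>M) \<le> L2.N M f * sqrt (measure M (space M))"
proof -
  interpret finite_measure M by fact
  have 1: "(\<lambda>x. 1) \<in> L2 M" by (simp add: L2_def)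
  show "integrable M f" using L2_integrable_mult[OF assms(2) 1] by simp
  have f: "(\<lambda>x. \<bar>f x\<bar>) \<in> L2 M" using assms(2) by (auto simp: L2_def)
  show "(\<integral>x. \<bar>f x\<bar> \<partial>M) \<le> L2.N M f * sqrt (measure M (space M))"
    using L2.Cauchy_Schwarz[OF f 1] by (simp add: L2.N_def ip_def)
qed

text \<open>Fatou's lemma for the squares. This lower semicontinuity serves twice: in the
  completeness of L2 and in the passage of the Sobolev inequality from test functions to
  \<open>H10\<close>.\<close>

lemma Fatou_N:
  assumes u: "\<And>n::nat. u n \<in> L2 M" and f: "f \<in> borel_measurable M"
    and conv: "AE x in M. (\<lambda>n. u n x) \<longlonglongrightarrow> f x" and bd: "\<forall>\<^sub>F n in sequentially. L2.N M (u n) \<le> C"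
  shows "f \<in> L2 M" "L2.N M f \<le> C"
proof -
  note [measurable] = f L2_measurable[OF u]
  obtain n0 where n0: "\<And>n. n \<ge> n0 \<Longrightarrow> L2.N M (u n) \<le> C"
    using bd by (auto simp: eventually_sequentially)
  have C: "0 \<le> C" using n0[OF order_refl] L2.N_nonneg[OF u[of n0]] by linarith
  have *: "(\<integral>\<^sup>+x. ennreal ((f x)\<^sup>2) \<partial>M) \<le> ennreal (C\<^sup>2)"
  proof -
    have "(\<integral>\<^sup>+x. ennreal ((f x)\<^sup>2) \<partial>M) = (\<integral>\<^sup>+x. liminf (\<lambda>n. ennreal ((u n x)\<^sup>2)) \<partial>M)"
    proof (rule nn_integral_cong_AE)
      show "AE x in M. ennreal ((f x)\<^sup>2) = liminf (\<lambda>n. ennreal ((u n x)\<^sup>2))"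
        using conv
      proof eventually_elim
        case (elim x)
        have "(\<lambda>n. ennreal ((u n x)\<^sup>2)) \<longlonglongrightarrow> ennreal ((f x)\<^sup>2)"
          by (intro tendsto_ennrealI tendsto_intros elim)
        then show ?case using lim_imp_Liminf[OF sequentially_bot] by metis
      qed
    qed
    also have "\<dots> \<le> liminf (\<lambda>n. \<integral>\<^sup>+x. ennreal ((u n x)\<^sup>2) \<partial>M)"
      by (rule nn_integral_liminf) measurable
    also have "\<dots> \<le> liminf (\<lambda>n. ennreal (C\<^sup>2))"
    proof (rule Liminf_mono, unfold eventually_sequentially, intro exI allI impI)
      fix n assume "n0 \<le> n"
      have "(\<integral>\<^sup>+x. ennreal ((u n x)\<^sup>2) \<partial>M) = ennreal ((L2.N M (u n))\<^sup>2)"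
        by (subst nn_integral_eq_integral)
          (simp_all add: L2_integrable_sq[OF u] L2.N_sq[OF u] ip_def flip: power2_eq_square)
      also have "\<dots> \<le> ennreal (C\<^sup>2)"
        using n0[OF \<open>n0 \<le> n\<close>] L2.N_nonneg[OF u] by (intro ennreal_leI power_mono) auto
      finally show "(\<integral>\<^sup>+x. ennreal ((u n x)\<^sup>2) \<partial>M) \<le> ennreal (C\<^sup>2)" .
    qed
    also have "\<dots> = ennreal (C\<^sup>2)" by (simp add: Liminf_const)
    finally show ?thesis .
  qed
  have int: "integrable M (\<lambda>x. (f x)\<^sup>2)"
    by (rule integrableI_bounded) (use * in \<open>auto simp: less_top[symmetric] top_unique\<close>)
  then show fL: "f \<in> L2 M" by (simp add: L2_def f)
  have "ennreal ((L2.N M f)\<^sup>2) \<le> ennreal (C\<^sup>2)"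
    using * by (subst (asm) nn_integral_eq_integral) (simp_all add: int L2.N_sq[OF fL] ip_def flip: power2_eq_square)
  then have "(L2.N M f)\<^sup>2 \<le> C\<^sup>2" by (subst (asm) ennreal_le_iff) auto
  then show "L2.N M f \<le> C" using C power2_le_imp_le by blast
qed

lemma L2_tendsto_AE_subseq:
  assumes "finite_measure M" "\<And>n::nat. u n \<in> L2 M" "f \<in> L2 M"
    and "(\<lambda>n. L2.N M (\<lambda>x. u n x - f x)) \<longlonglongrightarrow> 0"
  shows "\<exists>r::nat\<Rightarrow>nat. strict_mono r \<and> (AE x in M. (\<lambda>n. u (r n) x) \<longlonglongrightarrow> f x)"
proof -
  have d: "(\<lambda>x. u n x - f x) \<in> L2 M" for n using assms L2.diff_mem by blast
  have "(\<lambda>n. \<integral>x. norm (u n x - f x) \<partial>M) \<longlonglongrightarrow> 0"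
  proof (rule tendsto_sandwich[OF _ _ tendsto_const])
    show "(\<lambda>n. L2.N M (\<lambda>x. u n x - f x) * sqrt (measure M (space M))) \<longlonglongrightarrow> 0"
      using tendsto_mult_left_zero[OF assms(4)] by simp
  qed (use integral_abs_le_N(2)[OF assms(1) d] in auto)
  then obtain r :: "nat \<Rightarrow> nat" where "strict_mono r" "AE x in M. (\<lambda>n. u (r n) x - f x) \<longlonglongrightarrow> 0"
    using tendsto_L1_AE_subseq[of M "\<lambda>n x. u n x - f x"] integral_abs_le_N(1)[OF assms(1) d] by blast
  then show ?thesis by (intro exI[of _ r]) (auto simp: LIM_zero_iff)
qed

text \<open>Riesz--Fischer. Along a subsequence whose increments are below \<open>(1/2)^k\<close>
  the sum of the absolute increments has a finite integral, so the subsequence converges almost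
  everywhere.\<close>

lemma L2_complete:
  assumes fin: "finite_measure M" and u: "\<And>n::nat. u n \<in> L2 M"
    and cau: "\<And>e. 0 < e \<Longrightarrow> \<exists>K. \<forall>m\<ge>K. \<forall>n\<ge>K. L2.N M (\<lambda>x. u m x - u n x) < e"
  shows "\<exists>f\<in>L2 M. (\<lambda>n. L2.N M (\<lambda>x. u n x - f x)) \<longlonglongrightarrow> 0"
proof -
  note [measurable] = L2_measurable[OF u]
  have d: "(\<lambda>x. u m x - u n x) \<in> L2 M" for m n using u L2.diff_mem by blast
  obtain K where K: "\<And>k m n. m \<ge> K k \<Longrightarrow> n \<ge> K k \<Longrightarrow> L2.N M (\<lambda>x. u m x - u n x) < (1/2)^k"
    using cau[of "(1/2)^k" for k] by (metis zero_less_divide_1_iff zero_less_numeral zero_less_power)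
  \<comment> \<open>The maximum secures both \<open>r k \<ge> K k\<close> and strict growth.\<close>
  define r where "r = rec_nat (K 0) (\<lambda>k rk. max (K (Suc k)) (Suc rk))"
  have r: "r k \<ge> K k" "r (Suc k) \<ge> Suc (r k)" for k
    by (induction k) (auto simp: r_def)
  have sm: "strict_mono r" using r(2) by (simp add: strict_mono_Suc_iff Suc_le_eq)
  have step: "L2.N M (\<lambda>x. u (r (Suc k)) x - u (r k) x) < (1/2)^k" for k
    using r[of k] by (intro K) linarith+
  define c where "c = sqrt (measure M (space M))"
  have c: "0 \<le> c" by (simp add: c_def)
  have "(\<integral>\<^sup>+x. (\<Sum>k. ennreal \<bar>u (r (Suc k)) x - u (r k) x\<bar>) \<partial>M)
      = (\<Sum>k. \<integral>\<^sup>+x. ennreal \<bar>u (r (Suc k)) x - u (r k) x\<bar> \<partial>M)"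
    by (rule nn_integral_suminf) measurable
  also have "\<dots> \<le> (\<Sum>k. ennreal ((1/2)^k * c))"
  proof (intro suminf_le allI)
    fix k
    have "(\<integral>\<^sup>+x. ennreal \<bar>u (r (Suc k)) x - u (r k) x\<bar> \<partial>M)
        = ennreal (\<integral>x. \<bar>u (r (Suc k)) x - u (r k) x\<bar> \<partial>M)"
      using integral_abs_le_N(1)[OF fin d] by (intro nn_integral_eq_integral) auto
    also have "\<dots> \<le> ennreal ((1/2)^k * c)"
      using integral_abs_le_N(2)[OF fin d[of "r (Suc k)" "r k"]] step[of k] c
        mult_right_mono[of "L2.N M (\<lambda>x. u (r (Suc k)) x - u (r k) x)" "(1/2)^k" c]
      by (intro ennreal_leI) (simp add: c_def)
    finally show "(\<integral>\<^sup>+x. ennreal \<bar>u (r (Suc k)) x - u (r k) x\<bar> \<partial>M) \<le> ennreal ((1/2)^k * c)" .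
  qed auto
  also have "\<dots> < \<infinity>"
    using summable_mult2[OF summable_geometric[of "1/2::real"], of c] c
    by (subst suminf_ennreal2) auto
  finally have "(\<integral>\<^sup>+x. (\<Sum>k. ennreal \<bar>u (r (Suc k)) x - u (r k) x\<bar>) \<partial>M) \<noteq> \<infinity>" by simp
  then have "AE x in M. (\<Sum>k. ennreal \<bar>u (r (Suc k)) x - u (r k) x\<bar>) \<noteq> \<infinity>"
    by (intro nn_integral_PInf_AE) measurable
  then have conv: "AE x in M. convergent (\<lambda>n. u (r n) x)"
  proof eventually_elim
    case (elim x)
    then have "summable (\<lambda>k. \<bar>u (r (Suc k)) x - u (r k) x\<bar>)"
      by (intro summable_suminf_not_top) auto
    then have "summable (\<lambda>k. u (r (Suc k)) x - u (r k) x)" by (rule summable_rabs_cancel)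
    then have "convergent (\<lambda>n. \<Sum>k<n. u (r (Suc k)) x - u (r k) x)"
      by (simp add: summable_iff_convergent)
    moreover have "(\<Sum>k<n. u (r (Suc k)) x - u (r k) x) = u (r n) x - u (r 0) x" for n
      by (rule sum_lessThan_telescope)
    ultimately have "convergent (\<lambda>n. u (r n) x - u (r 0) x)" by simp
    then show ?case
      using convergent_add[OF _ convergent_const[of "u (r 0) x"]] by fastforce
  qed
  define f where "f x = lim (\<lambda>n. u (r n) x)" for x
  have [measurable]: "f \<in> borel_measurable M" unfolding f_def by measurable
  have limf: "AE x in M. (\<lambda>n. u (r n) x) \<longlonglongrightarrow> f x"
    using conv by eventually_elim (simp add: f_def convergent_LIMSEQ_iff)
  \<comment> \<open>With \<open>m\<close> frozen and the subsequence running, Fatou's lemma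
    transfers the Cauchy estimate to the limit. As \<open>m\<close> is any late index, the whole
    sequence converges and not only the subsequence.\<close>
  have key: "(\<lambda>x. u m x - f x) \<in> L2 M \<and> L2.N M (\<lambda>x. u m x - f x) \<le> (1/2)^k" if "m \<ge> K k" for m k
  proof -
    have "\<forall>\<^sub>F n in sequentially. L2.N M (\<lambda>x. u m x - u (r n) x) \<le> (1/2)^k"
      unfolding eventually_sequentially
    proof (intro exI allI impI)
      fix n assume "K k \<le> n"
      then have "K k \<le> r n" using seq_suble[OF sm, of n] by linarith
      then show "L2.N M (\<lambda>x. u m x - u (r n) x) \<le> (1/2)^k" using K[OF that] by (simp add: less_imp_le)
    qed
    moreover have "AE x in M. (\<lambda>n. u m x - u (r n) x) \<longlonglongrightarrow> u m x - f x"
      using limf by eventually_elim (intro tendsto_intros)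
    ultimately show ?thesis
      using Fatou_N[of "\<lambda>n x. u m x - u (r n) x" M "\<lambda>x. u m x - f x" "(1/2)^k"] d by auto
  qed
  have f: "f \<in> L2 M"
    using L2.diff_mem[OF u[of "K 0"] conjunct1[OF key[of 0 "K 0"]]] by simp
  have "(\<lambda>n. L2.N M (\<lambda>x. u n x - f x)) \<longlonglongrightarrow> 0"
  proof (rule LIMSEQ_I)
    fix e :: real assume "0 < e"
    then obtain k where k: "(1/2)^k < e" using real_arch_pow_inv[of e "1/2"] by auto
    show "\<exists>no. \<forall>n\<ge>no. norm (L2.N M (\<lambda>x. u n x - f x) - 0) < e"
    proof (intro exI allI impI)
      fix n assume "K k \<le> n"
      then have "0 \<le> L2.N M (\<lambda>x. u n x - f x)" "L2.N M (\<lambda>x. u n x - f x) < e"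
        using key[of k n] k L2.N_nonneg[of "\<lambda>x. u n x - f x" M] by linarith+
      then show "norm (L2.N M (\<lambda>x. u n x - f x) - 0) < e" by simp
    qed
  qed
  then show ?thesis using f by blast
qed

section \<open>Bump functions\<close>

lemma Ck_on_UNIV_lin:
  assumes "Ck_on k UNIV f" "Ck_on k UNIV g"
  shows "Ck_on k UNIV (\<lambda>x. a * f x + b * g x)"
  using assms
proof (induction k arbitrary: f g)
  case 0
  then show ?case by (auto intro!: continuous_intros)
next
  case (Suc k)
  have "frechet_derivative (\<lambda>x. a * f x + b * g x) (at x) =
      (\<lambda>v. a * frechet_derivative f (at x) v + b * frechet_derivative g (at x) v)" for x
    by (rule sym, rule frechet_derivative_at)
      (use Suc.prems in \<open>auto intro!: derivative_eq_intros simp flip: frechet_derivative_works\<close>)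
  moreover have "(\<lambda>x. a * f x + b * g x) differentiable (at x)" for x
    using Suc.prems by (auto intro!: derivative_intros)
  ultimately show ?case using Suc by auto
qed

lemma Ck_on_UNIV_Suc:
  assumes "Ck_on (Suc k) UNIV f"
  shows "Ck_on k UNIV f"
  using assms
proof (induction k arbitrary: f)
  case 0
  then show ?case
    by (auto simp: continuous_on_eq_continuous_within differentiable_imp_continuous_within)
next
  case (Suc k)
  then show ?case by (metis Ck_on.simps(2))
qed

lemma Ck_on_UNIV_mult:
  assumes "Ck_on k UNIV f" "Ck_on k UNIV g"
  shows "Ck_on k UNIV (\<lambda>x. f x * g x)"
  using assms
proof (induction k arbitrary: f g)
  case 0
  then show ?case by (auto intro!: continuous_intros)
next
  case (Suc k)
  have "frechet_derivative (\<lambda>x. f x * g x) (at x) =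
      (\<lambda>v. f x * frechet_derivative g (at x) v + frechet_derivative f (at x) v * g x)" for x
    by (rule sym, rule frechet_derivative_at, rule has_derivative_mult)
      (use Suc.prems in \<open>auto simp flip: frechet_derivative_works\<close>)
  moreover have "(\<lambda>x. f x * g x) differentiable (at x)" for x
    using Suc.prems by (auto intro!: derivative_intros)
  \<comment> \<open>The product rule leaves one factor undifferentiated, so the assumptions of order
    \<open>Suc k\<close> are needed at order \<open>k\<close> as well.\<close>
  moreover have "Ck_on k UNIV (\<lambda>x. f x * frechet_derivative g (at x) v + frechet_derivative f (at x) v * g x)" for v
    using Ck_on_UNIV_lin[of k "\<lambda>x. f x * frechet_derivative g (at x) v" "\<lambda>x. frechet_derivative f (at x) v * g x" 1 1]
      Suc.IH[of f "\<lambda>x. frechet_derivative g (at x) v"] Suc.IH[of "\<lambda>x. frechet_derivative f (at x) v" g]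
      Suc.prems Ck_on_UNIV_Suc[OF Suc.prems(1)] Ck_on_UNIV_Suc[OF Suc.prems(2)] by simp
  ultimately show ?case by auto
qed

lemma Ck_on_UNIV_const: "Ck_on k UNIV (\<lambda>x. c)"
  by (induction k arbitrary: c) auto

lemma smooth_on_UNIV_prod:
  assumes "finite A" "\<And>i. i \<in> A \<Longrightarrow> smooth_on UNIV (f i)"
  shows "smooth_on UNIV (\<lambda>x. \<Prod>i\<in>A. f i x)"
  using assms
  by (induction A) (auto simp: smooth_on_def Ck_on_UNIV_const intro!: Ck_on_UNIV_mult)

text \<open>The powers of \<open>s\<close> make the family closed under differentiation up to linear combinations.\<close>

definition flat :: "nat \<Rightarrow> real \<Rightarrow> real" where
  "flat n s = (if 0 < s then exp (- 1 / s) / s ^ n else 0)"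

text \<open>From \<open>(1 + x / k) ^ k \<le> exp x\<close> with \<open>x = 1 / s\<close> and
  \<open>k = n + 2\<close>: two more powers than the denominator has leave a factor of order two in
  \<open>s\<close>, enough for a vanishing derivative at 0.\<close>

lemma flat_bound: "\<bar>flat n s\<bar> \<le> (real (n + 2)) ^ (n + 2) * s\<^sup>2"
proof (cases "0 < s")
  case True
  define k where "k = n + 2"
  have "(1 + (1 / s) / real k) ^ k \<le> exp (1 / s)"
    using True by (intro exp_ge_one_plus_x_over_n_power_n) (auto simp: k_def intro: order_trans[of _ 0])
  moreover have "((1 / s) / real k) ^ k \<le> (1 + (1 / s) / real k) ^ k"
    using True by (intro power_mono) auto
  ultimately have "1 / (s * real k) ^ k \<le> exp (1 / s)"
    by (simp add: power_divide power_mult_distrib)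
  then have "exp (- 1 / s) \<le> (s * real k) ^ k"
    using True le_imp_inverse_le[of "1 / (s * real k) ^ k" "exp (1 / s)"]
    by (simp add: k_def flip: exp_minus)
  then have "exp (- 1 / s) / s ^ n \<le> (s * real k) ^ k / s ^ n"
    using True by (intro divide_right_mono) auto
  also have "\<dots> = real k ^ k * s\<^sup>2"
    using True by (simp add: k_def power_mult_distrib power_add power2_eq_square)
  finally show ?thesis using True by (simp add: flat_def k_def)
qed (simp add: flat_def)

lemma flat_has_derivative:
  "(flat n has_real_derivative (flat (n + 2) s - real n * flat (n + 1) s)) (at s)"
proof -
  consider "s < 0" | "s = 0" | "0 < s" by linarith
  then show ?thesis
  proof cases
    case 1
    have "((\<lambda>s. 0) has_real_derivative 0) (at s)" by simp
    then have "(flat n has_real_derivative 0) (at s)"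
      by (rule has_field_derivative_transform_within_open[where S = "{..<0}"]) (use 1 in \<open>auto simp: flat_def\<close>)
    then show ?thesis using 1 by (simp add: flat_def)
  next
    case 2
    have "((\<lambda>h. flat n h / h) \<longlongrightarrow> 0) (at 0)"
    proof (rule Lim_null_comparison)
      show "\<forall>\<^sub>F h in at 0. norm (flat n h / h) \<le> (real (n + 2)) ^ (n + 2) * \<bar>h\<bar>"
        unfolding eventually_at_filter
      proof (intro always_eventually allI impI)
        fix h :: real assume "h \<noteq> 0"
        then show "norm (flat n h / h) \<le> (real (n + 2)) ^ (n + 2) * \<bar>h\<bar>"
          using flat_bound[of n h] by (simp add: divide_simps power2_eq_square abs_mult mult.assoc)
      qed
      show "((\<lambda>h. (real (n + 2)) ^ (n + 2) * \<bar>h\<bar>) \<longlongrightarrow> 0) (at 0)"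
        by (auto intro!: tendsto_eq_intros)
    qed
    then show ?thesis using 2 by (simp add: has_field_derivative_iff flat_def)
  next
    case 3
    have "((\<lambda>s. exp (- 1 / s) / s ^ n) has_real_derivative (flat (n + 2) s - real n * flat (n + 1) s)) (at s)"
      using 3
      by (auto intro!: derivative_eq_intros simp: flat_def)
        (cases n; simp add: field_simps power2_eq_square)
    then show ?thesis
      by (rule has_field_derivative_transform_within_open[where S = "{0<..}"]) (use 3 in \<open>auto simp: flat_def\<close>)
  qed
qed

text \<open>The induction runs over all \<open>n\<close> at once, because each derivative combines
  the members with indices \<open>n + 1\<close> and \<open>n + 2\<close>.\<close>

lemma smooth_on_flat_affine:
  fixes w :: "'a::euclidean_space"
  shows "smooth_on UNIV (\<lambda>x. flat n (x \<bullet> w + c))"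
  unfolding smooth_on_def
proof
  fix k
  show "Ck_on k UNIV (\<lambda>x. flat n (x \<bullet> w + c))"
  proof (induction k arbitrary: n)
    case 0
    have "continuous_on UNIV (flat n)"
      by (auto simp: continuous_on_eq_continuous_within intro!: has_field_derivative_imp_has_derivative
          DERIV_isCont[OF flat_has_derivative])
    then show ?case
      by (auto intro!: continuous_on_compose2[of UNIV "flat n"] continuous_intros)
  next
    case (Suc k)
    have D: "((\<lambda>x. flat n (x \<bullet> w + c)) has_derivative
        (\<lambda>v. (v \<bullet> w) * (flat (n + 2) (x \<bullet> w + c) - real n * flat (n + 1) (x \<bullet> w + c)))) (at x)" for x
      by (rule DERIV_compose_FDERIV[OF flat_has_derivative]) (auto intro!: derivative_eq_intros)
    have "Ck_on k UNIV (\<lambda>x. (v \<bullet> w) * flat (n + 2) (x \<bullet> w + c) + (- (v \<bullet> w) * real n) * flat (n + 1) (x \<bullet> w + c))" for v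
      by (intro Ck_on_UNIV_lin Suc)
    moreover have "frechet_derivative (\<lambda>x. flat n (x \<bullet> w + c)) (at x) v
        = (v \<bullet> w) * flat (n + 2) (x \<bullet> w + c) + (- (v \<bullet> w) * real n) * flat (n + 1) (x \<bullet> w + c)" for x v
      by (subst frechet_derivative_at[OF D, symmetric]) (simp add: algebra_simps)
    moreover have "(\<lambda>x. flat n (x \<bullet> w + c)) differentiable (at x)" for x
      using D unfolding differentiable_def by blast
    ultimately show ?case by simp
  qed
qed

text \<open>Smooth approximations of the indicator of \<open>box c d\<close>; a larger
  \<open>n\<close> makes the flanks steeper. For \<open>n = 0\<close> the function vanishes
  identically, hence the shift to \<open>Suc n\<close> in its use.\<close>

definition box_bump :: "nat \<Rightarrow> real^3 \<Rightarrow> real^3 \<Rightarrow> real^3 \<Rightarrow> real" where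
  "box_bump n c d x =
     (\<Prod>i\<in>UNIV. flat 0 (real n * (x $ i - c $ i)) * flat 0 (real n * (d $ i - x $ i)))"

lemma flat_0_range: "0 \<le> flat 0 s" "flat 0 s \<le> 1"
  by (auto simp: flat_def)

lemma flat_0_tendsto: "(\<lambda>n. flat 0 (real n * s)) \<longlonglongrightarrow> (if 0 < s then 1 else 0)"
proof (cases "0 < s")
  case True
  have "(\<lambda>n. exp (- (1 / s) * inverse (real n))) \<longlonglongrightarrow> exp (- (1 / s) * 0)"
    by (intro tendsto_intros lim_inverse_n)
  moreover have "\<forall>\<^sub>F n in sequentially. exp (- (1 / s) * inverse (real n)) = flat 0 (real n * s)"
    using eventually_gt_at_top[of "0::nat"]
    by eventually_elim (use True in \<open>auto simp: flat_def field_simps\<close>)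
  ultimately show ?thesis using True by (auto intro: Lim_transform_eventually)
next
  case False
  have "flat 0 (real n * s) = 0" for n
    using False by (auto simp: flat_def zero_less_mult_iff)
  then show ?thesis using False by simp
qed

lemma box_bump_range: "0 \<le> box_bump n c d x" "box_bump n c d x \<le> 1"
  unfolding box_bump_def
  by (intro prod_nonneg ballI mult_nonneg_nonneg flat_0_range)
    (intro prod_le_1 conjI mult_nonneg_nonneg mult_le_one flat_0_range)

lemma mem_box_real3: "x \<in> box c d \<longleftrightarrow> (\<forall>i. c $ i < x $ i \<and> x $ i < d $ i)" for x c d :: "real^3"
  by (auto simp: mem_box_cart)

lemma box_bump_eq_0_iff: "0 < n \<Longrightarrow> box_bump n c d x = 0 \<longleftrightarrow> x \<notin> box c d"
  by (auto simp: box_bump_def mem_box_real3 flat_def zero_less_mult_iff not_less not_le)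
    (meson not_le)+

lemma box_bump_tendsto: "(\<lambda>n. box_bump n c d x) \<longlonglongrightarrow> indicator (box c d) x"
proof -
  have "(\<lambda>n. box_bump n c d x) \<longlonglongrightarrow>
      (\<Prod>i\<in>UNIV. (if 0 < x $ i - c $ i then 1 else 0) * (if 0 < d $ i - x $ i then 1 else 0))"
    unfolding box_bump_def by (intro tendsto_prod tendsto_mult flat_0_tendsto)
  also have "(\<Prod>i\<in>UNIV. (if 0 < x $ i - c $ i then 1 else 0) * (if 0 < d $ i - x $ i then 1 else (0::real)))
      = indicator (box c d) x"
    by (cases "x \<in> box c d") (auto simp: mem_box_real3)
  finally show ?thesis .
qed

lemma test_functionsI:
  assumes "smooth_on UNIV \<phi>" "compact K" "K \<subseteq> \<Omega>" "\<And>x. x \<notin> K \<Longrightarrow> \<phi> x = 0"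
  shows "\<phi> \<in> test_functions \<Omega>"
proof -
  have sub: "closure {x. \<phi> x \<noteq> 0} \<subseteq> K"
    using assms(2,4) compact_imp_closed by (intro closure_minimal) blast+
  then have "bounded (closure {x. \<phi> x \<noteq> 0})"
    using assms(2) bounded_subset compact_imp_bounded by blast
  then have "compact (closure {x. \<phi> x \<noteq> 0})"
    using compact_eq_bounded_closed by blast
  then show ?thesis using sub assms(1,3) unfolding test_functions_def by blast
qed

lemma box_bump_test:
  assumes "cbox c d \<subseteq> \<Omega>" "0 < n"
  shows "box_bump n c d \<in> test_functions \<Omega>"
proof -
  have z: "box_bump n c d x = 0" if "x \<notin> cbox c d" for x
    using box_bump_eq_0_iff[OF assms(2)] box_subset_cbox[of c d] that by blast
  have "smooth_on UNIV (box_bump n c d)"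
  proof -
    have "smooth_on UNIV (\<lambda>x. flat 0 (real n * (x $ i - c $ i)) * flat 0 (real n * (d $ i - x $ i)))" for i
    proof -
      have "flat 0 (real n * (x $ i - c $ i)) = flat 0 (x \<bullet> (real n *\<^sub>R axis i 1) + (- real n * c $ i))"
        "flat 0 (real n * (d $ i - x $ i)) = flat 0 (x \<bullet> (- real n *\<^sub>R axis i 1) + real n * d $ i)"
        for x :: "real^3"
        by (simp_all add: inner_axis algebra_simps)
      then show ?thesis
        using smooth_on_flat_affine[of 0 "real n *\<^sub>R axis i 1" "- real n * c $ i"]
          smooth_on_flat_affine[of 0 "- real n *\<^sub>R axis i 1" "real n * d $ i"]
        by (simp only: smooth_on_def) (intro allI Ck_on_UNIV_mult; blast)
    qed
    then have "smooth_on UNIV (\<lambda>x. \<Prod>i\<in>UNIV. flat 0 (real n * (x $ i - c $ i)) * flat 0 (real n * (d $ i - x $ i)))"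
      by (intro smooth_on_UNIV_prod) auto
    then show ?thesis by (simp add: box_bump_def[abs_def])
  qed
  then show ?thesis using assms(1) z by (rule test_functionsI[OF _ compact_cbox])
qed

section \<open>Test functions\<close>

lemma test_function_differentiable:
  "\<phi> \<in> test_functions \<Omega> \<Longrightarrow> (\<phi> has_derivative frechet_derivative \<phi> (at x)) (at x)"
proof -
  assume "\<phi> \<in> test_functions \<Omega>"
  then have "Ck_on (Suc 0) UNIV \<phi>" unfolding test_functions_def smooth_on_def by blast
  then show ?thesis by (simp add: frechet_derivative_works)
qed

lemma test_function_continuous: "\<phi> \<in> test_functions \<Omega> \<Longrightarrow> continuous_on UNIV \<phi>"
  using has_derivative_continuous_on[of UNIV \<phi> "\<lambda>x. frechet_derivative \<phi> (at x)"]
    test_function_differentiable[of \<phi> \<Omega>] by auto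

lemma test_function_support:
  assumes "\<phi> \<in> test_functions \<Omega>"
  obtains K where "compact K" "K \<subseteq> \<Omega>" "\<And>x. x \<notin> K \<Longrightarrow> \<phi> x = 0"
    "\<And>x v. x \<notin> K \<Longrightarrow> frechet_derivative \<phi> (at x) v = 0"
proof
  let ?K = "closure {x. \<phi> x \<noteq> 0}"
  show "compact ?K" "?K \<subseteq> \<Omega>" using assms by (auto simp: test_functions_def)
  show *: "\<phi> x = 0" if "x \<notin> ?K" for x using that closure_subset by force
  show "frechet_derivative \<phi> (at x) v = 0" if "x \<notin> ?K" for x v
  proof -
    have "((\<lambda>x. 0) has_derivative (\<lambda>v. 0)) (at x)" by simp
    moreover have "open (- ?K)" "x \<in> - ?K" using that by auto
    ultimately have "(\<phi> has_derivative (\<lambda>v. 0)) (at x)"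
      by (rule has_derivative_transform_within_open) (metis * ComplD)
    then have "frechet_derivative \<phi> (at x) = (\<lambda>v. 0)" by (rule frechet_derivative_at[symmetric])
    then show ?thesis by simp
  qed
qed

lemma test_function_deriv:
  assumes "\<phi> \<in> test_functions \<Omega>"
  shows "(\<lambda>x. frechet_derivative \<phi> (at x) v) \<in> test_functions \<Omega>"
proof -
  obtain K where K: "compact K" "K \<subseteq> \<Omega>" "\<And>x v. x \<notin> K \<Longrightarrow> frechet_derivative \<phi> (at x) v = 0"
    using test_function_support[OF assms] by metis
  have "smooth_on UNIV (\<lambda>x. frechet_derivative \<phi> (at x) v)"
    using assms unfolding test_functions_def smooth_on_def by (metis (mono_tags) Ck_on.simps(2) mem_Collect_eq)
  then show ?thesis using K by (rule test_functionsI)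
qed

lemma test_function_lin:
  assumes "\<phi> \<in> test_functions \<Omega>" "\<psi> \<in> test_functions \<Omega>"
  shows "(\<lambda>x. a * \<phi> x + b * \<psi> x) \<in> test_functions \<Omega>"
proof -
  obtain K where K: "compact K" "K \<subseteq> \<Omega>" "\<And>x. x \<notin> K \<Longrightarrow> \<phi> x = 0"
    using test_function_support[OF assms(1)] by metis
  obtain L where L: "compact L" "L \<subseteq> \<Omega>" "\<And>x. x \<notin> L \<Longrightarrow> \<psi> x = 0"
    using test_function_support[OF assms(2)] by metis
  have "smooth_on UNIV (\<lambda>x. a * \<phi> x + b * \<psi> x)"
    using assms unfolding test_functions_def smooth_on_def by (intro allI Ck_on_UNIV_lin) auto
  then show ?thesis
    by (rule test_functionsI[of _ "K \<union> L"]) (use K L in auto)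
qed

lemma test_function_bounded:
  assumes "\<phi> \<in> test_functions \<Omega>"
  obtains B where "\<And>x. \<bar>\<phi> x\<bar> \<le> B"
proof -
  obtain K where K: "compact K" "\<And>x. x \<notin> K \<Longrightarrow> \<phi> x = 0" using test_function_support[OF assms] by metis
  have "bounded (\<phi> ` K)"
    using K(1) compact_continuous_image compact_imp_bounded continuous_on_subset
      test_function_continuous[OF assms] subset_UNIV by metis
  then obtain B where "\<And>x. x \<in> K \<Longrightarrow> \<bar>\<phi> x\<bar> \<le> B" by (auto simp: bounded_iff)
  then have "\<bar>\<phi> x\<bar> \<le> max B 0" for x using K(2)[of x] by (cases "x \<in> K") (auto simp: le_max_iff_disj)
  then show thesis using that by blast
qed

section \<open>Weak derivatives\<close>

lemma integrable_lebesgue_on_iff: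
  fixes f :: "'a::euclidean_space \<Rightarrow> real"
  assumes "S \<in> sets lebesgue"
  shows "integrable (lebesgue_on S) f \<longleftrightarrow> f absolutely_integrable_on S"
  using assms by (simp add: integrable_restrict_space set_integrable_def)

lemma AE_lebesgue_on_iff:
  assumes "S \<in> sets lebesgue"
  shows "(AE x in lebesgue_on S. P x) \<longleftrightarrow> negligible {x \<in> S. \<not> P x}"
proof -
  have "(AE x in lebesgue_on S. P x) \<longleftrightarrow> (AE x in lebesgue. x \<in> S \<longrightarrow> P x)"
    using assms by (intro AE_restrict_space_iff) auto
  also have "\<dots> \<longleftrightarrow> {x \<in> S. \<not> P x} \<in> null_sets lebesgue"
  proof
    assume "AE x in lebesgue. x \<in> S \<longrightarrow> P x"
    then obtain Z where Z: "Z \<in> null_sets lebesgue" "{x \<in> space lebesgue. \<not> (x \<in> S \<longrightarrow> P x)} \<subseteq> Z"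
      by (auto elim!: AE_E2 simp: eventually_ae_filter)
    then have "negligible Z" by (simp add: negligible_iff_null_sets)
    then have "negligible {x \<in> S. \<not> P x}" by (rule negligible_subset) (use Z(2) in auto)
    then show "{x \<in> S. \<not> P x} \<in> null_sets lebesgue" by (simp add: negligible_iff_null_sets)
  next
    assume "{x \<in> S. \<not> P x} \<in> null_sets lebesgue"
    from AE_not_in[OF this] show "AE x in lebesgue. x \<in> S \<longrightarrow> P x" by eventually_elim auto
  qed
  finally show ?thesis by (simp add: negligible_iff_null_sets)
qed

text \<open>Rests on the completeness of Lebesgue measure. The chosen weak derivatives are known
  only almost everywhere, so their measurability comes from here.\<close>

lemma borel_measurable_lebesgue_on_AE:
  fixes f g :: "'a::euclidean_space \<Rightarrow> real"
  assumes S: "S \<in> sets lebesgue" and f: "f \<in> borel_measurable (lebesgue_on S)"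
    and eq: "AE x in lebesgue_on S. f x = g x"
  shows "g \<in> borel_measurable (lebesgue_on S)"
proof -
  have "(\<lambda>x. if x \<in> S then f x else 0) \<in> borel_measurable lebesgue"
    using f S by (simp add: borel_measurable_if)
  moreover have "AE x in lebesgue. (if x \<in> S then f x else 0) = (if x \<in> S then g x else 0)"
    using eq AE_restrict_space_iff[of S lebesgue "\<lambda>x. f x = g x"] S by auto
  ultimately have "(\<lambda>x. if x \<in> S then g x else 0) \<in> borel_measurable lebesgue"
    by (rule borel_measurable_AE)
  then show ?thesis using S by (simp add: borel_measurable_if)
qed

lemma integral_lebesgue_on_indicator:
  fixes f :: "'a::euclidean_space \<Rightarrow> real"
  assumes "S \<in> sets lebesgue" "T \<in> sets lebesgue" "T \<subseteq> S"
  shows "(\<integral>x. f x * indicator T x \<partial>lebesgue_on S) = (\<integral>x. f x \<partial>lebesgue_on T)"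
  using assms
  by (simp add: integral_restrict_space) (intro Bochner_Integration.integral_cong; auto simp: indicator_def)

lemma open_lebesgue: "open S \<Longrightarrow> S \<in> sets lebesgue"
  by auto

lemma integrable_test:
  assumes "open \<Omega>" "locally_integrable \<Omega> g" "\<phi> \<in> test_functions \<Omega>"
  shows "integrable (lebesgue_on \<Omega>) (\<lambda>x. g x * \<phi> x)"
proof -
  obtain K where K: "compact K" "K \<subseteq> \<Omega>" "\<And>x. x \<notin> K \<Longrightarrow> \<phi> x = 0"
    using test_function_support[OF assms(3)] by metis
  obtain B where B: "\<And>x. \<bar>\<phi> x\<bar> \<le> B" using test_function_bounded[OF assms(3)] by metis
  have g: "g absolutely_integrable_on K" using assms(2) K by (auto simp: locally_integrable_def)
  have Kl: "K \<in> sets lebesgue" using K(1) by (auto simp: compact_imp_closed)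
  have "(\<lambda>x. \<phi> x * g x) absolutely_integrable_on K"
  proof (rule absolutely_integrable_bounded_measurable_product[OF bilinear_times])
    show "\<phi> \<in> borel_measurable (lebesgue_on K)"
      using test_function_continuous[OF assms(3)] continuous_on_subset Kl
      by (intro continuous_imp_measurable_on_sets_lebesgue) auto
    show "bounded (\<phi> ` K)" using B by (auto simp: bounded_iff)
  qed (use Kl g in auto)
  then have "(\<lambda>x. if x \<in> K then g x * \<phi> x else 0) absolutely_integrable_on UNIV"
    by (simp add: absolutely_integrable_restrict_UNIV mult.commute)
  moreover have "(\<lambda>x. if x \<in> K then g x * \<phi> x else 0) = (\<lambda>x. g x * \<phi> x)"
    using K(3) by auto
  ultimately have "(\<lambda>x. g x * \<phi> x) absolutely_integrable_on \<Omega>"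
    using assms(1) by (auto intro: set_integrable_subset)
  then show ?thesis using integrable_lebesgue_on_iff[OF open_lebesgue[OF assms(1)]] by blast
qed

text \<open>The bumps show that \<open>g\<close> integrates to zero over every closed box inside the
  domain. Lebesgue differentiation along small cubes then gives \<open>g = 0\<close> almost
  everywhere on each box, and countably many boxes cover the domain.\<close>

lemma du_Bois_Reymond:
  assumes op: "open \<Omega>" and g: "locally_integrable \<Omega> g"
    and zero: "\<And>\<phi>. \<phi> \<in> test_functions \<Omega> \<Longrightarrow> (\<integral>x. g x * \<phi> x \<partial>lebesgue_on \<Omega>) = 0"
  shows "AE x in lebesgue_on \<Omega>. g x = 0"
proof -
  have Ol: "\<Omega> \<in> sets lebesgue" using op by auto
  have box: "integral (cbox c d) g = 0" if sub: "cbox c d \<subseteq> \<Omega>" for c d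
  proof -
    have gi: "g absolutely_integrable_on cbox c d"
      using g sub by (auto simp: locally_integrable_def)
    have gb: "integrable (lebesgue_on (box c d)) g"
      using set_integrable_subset[OF gi, of "box c d"] box_subset_cbox[of c d]
      by (simp add: integrable_lebesgue_on_iff)
    have w: "integrable (lebesgue_on \<Omega>) (\<lambda>x. g x * indicator (cbox c d) x)"
    proof -
      have "(\<lambda>x. indicator (cbox c d) x * g x) absolutely_integrable_on UNIV"
        using gi by (simp add: set_integrable_def)
      then have "(\<lambda>x. indicator (cbox c d) x * g x) absolutely_integrable_on \<Omega>"
        using Ol by (auto intro: set_integrable_subset)
      then show ?thesis by (simp add: integrable_lebesgue_on_iff[OF Ol] mult.commute)
    qed
    \<comment> \<open>Dominated convergence; the majorant lives on the closed box, a compact set on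
      which \<open>g\<close> is integrable.\<close>
    have "(\<lambda>n. \<integral>x. g x * box_bump (Suc n) c d x \<partial>lebesgue_on \<Omega>)
        \<longlonglongrightarrow> (\<integral>x. g x * indicator (box c d) x \<partial>lebesgue_on \<Omega>)"
    proof (rule integral_dominated_convergence[where w = "\<lambda>x. norm (g x * indicator (cbox c d) x)"])
      show m: "(\<lambda>x. g x * box_bump (Suc n) c d x) \<in> borel_measurable (lebesgue_on \<Omega>)" for n
        using integrable_test[OF op g box_bump_test[OF sub]] by auto
      have lim: "(\<lambda>n. g x * box_bump (Suc n) c d x) \<longlonglongrightarrow> g x * indicator (box c d) x" for x
        by (intro tendsto_intros LIMSEQ_Suc box_bump_tendsto)
      show "(\<lambda>x. g x * indicator (box c d) x) \<in> borel_measurable (lebesgue_on \<Omega>)"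
        using lim m by (rule borel_measurable_LIMSEQ_real)
      show "AE x in lebesgue_on \<Omega>. (\<lambda>n. g x * box_bump (Suc n) c d x) \<longlonglongrightarrow> g x * indicator (box c d) x"
        using lim by auto
      show "AE x in lebesgue_on \<Omega>. norm (g x * box_bump (Suc n) c d x) \<le> norm (g x * indicator (cbox c d) x)" for n
      proof (rule AE_I2)
        fix x
        show "norm (g x * box_bump (Suc n) c d x) \<le> norm (g x * indicator (cbox c d) x)"
        proof (cases "x \<in> cbox c d")
          case True
          then show ?thesis
            using box_bump_range[of "Suc n" c d x] by (simp add: abs_mult mult_left_le)
        next
          case False
          then have "box_bump (Suc n) c d x = 0"
            using box_bump_eq_0_iff[of "Suc n"] box_subset_cbox[of c d] by auto
          then show ?thesis by simp
        qed
      qed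
    qed (use w in auto)
    moreover have "(\<integral>x. g x * box_bump (Suc n) c d x \<partial>lebesgue_on \<Omega>) = 0" for n
      by (rule zero[OF box_bump_test[OF sub]]) simp
    ultimately have "(\<integral>x. g x * indicator (box c d) x \<partial>lebesgue_on \<Omega>) = 0"
      using LIMSEQ_unique tendsto_const by (metis (no_types, lifting) ext)
    then have "(\<integral>x. g x \<partial>lebesgue_on (box c d)) = 0"
      using sub box_subset_cbox[of c d] Ol by (subst (asm) integral_lebesgue_on_indicator) auto
    then have "integral (box c d) g = 0"
      using lebesgue_integral_eq_integral[OF gb] by simp
    then show ?thesis by (simp add: integral_open_interval)
  qed
  have neg: "negligible {x \<in> cbox c d. g x \<noteq> 0}" if sub: "cbox c d \<subseteq> \<Omega>" for c d
  proof -
    \<comment> \<open>Extension by zero makes the function integrable over every box, as the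
      differentiation theorem requires.\<close>
    define h where "h x = (if x \<in> cbox c d then g x else 0)" for x
    have gi: "g absolutely_integrable_on cbox c d"
      using g sub by (auto simp: locally_integrable_def)
    then have "h absolutely_integrable_on UNIV"
      by (simp add: h_def[abs_def] absolutely_integrable_restrict_UNIV)
    then have "h integrable_on cbox a b" for a b
      using set_integrable_subset[of lebesgue UNIV h "cbox a b"] set_lebesgue_integral_eq_integral(1) by auto
    then obtain Z where Z: "negligible Z"
      "\<And>x e. \<lbrakk>x \<notin> Z; 0 < e\<rbrakk> \<Longrightarrow> \<exists>r>0. \<forall>t. 0 < t \<and> t < r \<longrightarrow>
          norm (integral (cbox x (x + t *\<^sub>R One)) h /\<^sub>R t ^ DIM(real^3) - h x) < e"
      using integrable_ccontinuous_explicit[of h] by metis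
    have hz: "h x = 0" if x: "x \<in> box c d" "x \<notin> Z" for x
    proof (rule ccontr)
      assume "h x \<noteq> 0"
      then obtain r where r: "r > 0" "\<And>t. 0 < t \<Longrightarrow> t < r \<Longrightarrow>
          norm (integral (cbox x (x + t *\<^sub>R One)) h /\<^sub>R t ^ DIM(real^3) - h x) < norm (h x)"
        using Z(2)[OF x(2), of "norm (h x)"] by auto
      obtain e where e: "e > 0" "ball x e \<subseteq> box c d"
        using x(1) open_box open_contains_ball by metis
      \<comment> \<open>Small enough for the error estimate (\<open>t < r\<close>) and for the cube
        of side \<open>t\<close> at \<open>x\<close>, whose diagonal is \<open>t * norm One\<close>,
        to stay inside the ball of radius \<open>e\<close>. The cube average is then 0, yet it
        should differ from \<open>h x\<close> by less than \<open>norm (h x)\<close>.\<close>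
      define t where "t = min (r / 2) (e / (2 * (1 + norm (One::real^3))))"
      have nO: "0 \<le> norm (One::real^3)" by simp
      have t: "0 < t" "t < r" using r(1) e(1) nO
        by (auto simp: t_def min_less_iff_disj intro!: divide_pos_pos mult_pos_pos add_pos_nonneg)
      have sub2: "cbox x (x + t *\<^sub>R One) \<subseteq> cbox c d"
      proof
        fix y assume "y \<in> cbox x (x + t *\<^sub>R One)"
        then have "dist x y \<le> dist x (x + t *\<^sub>R One)"
          unfolding dist_norm using t(1)
          by (intro norm_le_componentwise) (auto simp: mem_box inner_simps)
        also have "\<dots> = t * norm (One::real^3)" using t(1) by (simp add: dist_norm)
        also have "\<dots> \<le> (e / (2 * (1 + norm (One::real^3)))) * norm (One::real^3)"
          using nO by (intro mult_right_mono) (auto simp: t_def)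
        also have "\<dots> < e" using e(1) nO
          by (simp add: divide_simps add_pos_nonneg)
        finally have "y \<in> ball x e" by simp
        then show "y \<in> cbox c d" using e(2) box_subset_cbox by blast
      qed
      have "integral (cbox x (x + t *\<^sub>R One)) h = integral (cbox x (x + t *\<^sub>R One)) g"
        by (rule integral_cong) (use sub2 in \<open>auto simp: h_def\<close>)
      then have "integral (cbox x (x + t *\<^sub>R One)) h = 0" using box[of x "x + t *\<^sub>R One"] sub sub2 by auto
      then show False using r(2)[OF t] by simp
    qed
    have "{x \<in> cbox c d. g x \<noteq> 0} \<subseteq> Z \<union> (cbox c d - box c d)"
    proof
      fix x assume x: "x \<in> {x \<in> cbox c d. g x \<noteq> 0}"
      then have "h x \<noteq> 0" by (simp add: h_def)
      then show "x \<in> Z \<union> (cbox c d - box c d)" using hz[of x] x by blast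
    qed
    moreover have "negligible (cbox c d - box c d)"
      by (rule negligible_frontier_interval)
    ultimately show ?thesis by (meson Z(1) negligible_Un negligible_subset)
  qed
  obtain D where D: "countable D" "D \<subseteq> Pow \<Omega>" "\<And>X. X \<in> D \<Longrightarrow> \<exists>a b. X = cbox a b" "\<Union>D = \<Omega>"
    using open_countable_Union_open_cbox[OF op] by metis
  have "negligible (\<Union>X\<in>D. {x \<in> X. g x \<noteq> 0})"
  proof (rule negligible_countable_Union)
    show "countable ((\<lambda>X. {x \<in> X. g x \<noteq> 0}) ` D)" using D(1) by simp
    fix N assume "N \<in> (\<lambda>X. {x \<in> X. g x \<noteq> 0}) ` D"
    then obtain X where "X \<in> D" "N = {x \<in> X. g x \<noteq> 0}" by blast
    then show "negligible N" using D(2) D(3)[of X] neg by blast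
  qed
  moreover have "{x \<in> \<Omega>. g x \<noteq> 0} \<subseteq> (\<Union>X\<in>D. {x \<in> X. g x \<noteq> 0})" using D(4) by auto
  ultimately have "negligible {x \<in> \<Omega>. g x \<noteq> 0}" by (rule negligible_subset)
  then show ?thesis by (simp add: AE_lebesgue_on_iff[OF Ol])
qed

lemma locally_integrable_lin:
  assumes "locally_integrable \<Omega> f" "locally_integrable \<Omega> g"
  shows "locally_integrable \<Omega> (\<lambda>x. a * f x + b * g x)"
  using assms unfolding locally_integrable_def by (auto intro!: set_integral_add set_integrable_mult_right)

lemma is_weak_partial_lin:
  assumes "open \<Omega>" "is_weak_partial \<Omega> i f f'" "is_weak_partial \<Omega> i g g'"
  shows "is_weak_partial \<Omega> i (\<lambda>x. a * f x + b * g x) (\<lambda>x. a * f' x + b * g' x)"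
proof -
  note W = assms(2,3)[unfolded is_weak_partial_def]
  have "(\<integral>x. (a * f x + b * g x) * frechet_derivative \<phi> (at x) (axis i 1) \<partial>lebesgue_on \<Omega>)
      = - (\<integral>x. (a * f' x + b * g' x) * \<phi> x \<partial>lebesgue_on \<Omega>)" if \<phi>: "\<phi> \<in> test_functions \<Omega>" for \<phi>
  proof -
    note I = integrable_test[OF assms(1) _ test_function_deriv[OF \<phi>, of "axis i 1"]]
    note J = integrable_test[OF assms(1) _ \<phi>]
    show ?thesis
      using W \<phi> I[of f] I[of g] J[of f'] J[of g'] by (simp add: distrib_right mult.assoc)
  qed
  then show ?thesis
    using W locally_integrable_lin unfolding is_weak_partial_def by blast
qed

lemma is_weak_partial_unique:
  assumes "open \<Omega>" "is_weak_partial \<Omega> i f g" "is_weak_partial \<Omega> i f h"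
  shows "AE x in lebesgue_on \<Omega>. g x = h x"
proof -
  have "AE x in lebesgue_on \<Omega>. 1 * g x + (-1) * h x = 0"
  proof (rule du_Bois_Reymond[OF assms(1)])
    show "locally_integrable \<Omega> (\<lambda>x. 1 * g x + (-1) * h x)"
      using assms by (intro locally_integrable_lin) (auto simp: is_weak_partial_def)
    show "(\<integral>x. (1 * g x + (-1) * h x) * \<phi> x \<partial>lebesgue_on \<Omega>) = 0" if "\<phi> \<in> test_functions \<Omega>" for \<phi>
      using is_weak_partial_lin[OF assms, of 1 "-1"] that by (simp add: is_weak_partial_def)
  qed
  then show ?thesis by auto
qed

lemma locally_integrable_AE_cong:
  assumes "open \<Omega>" "locally_integrable \<Omega> f" "AE x in lebesgue_on \<Omega>. f x = g x"
  shows "locally_integrable \<Omega> g"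
  unfolding locally_integrable_def
proof safe
  fix K assume K: "compact K" "K \<subseteq> \<Omega>"
  have "negligible {x \<in> \<Omega>. f x \<noteq> g x}"
    using assms(1,3) by (subst (asm) AE_lebesgue_on_iff) auto
  then show "g absolutely_integrable_on K"
    by (rule absolutely_integrable_spike[where f = f, rotated])
      (use K assms(2) in \<open>auto simp: locally_integrable_def\<close>)
qed

lemma is_weak_partial_AE_cong:
  assumes "open \<Omega>" "is_weak_partial \<Omega> i f f'"
    and eq: "AE x in lebesgue_on \<Omega>. f x = g x" "AE x in lebesgue_on \<Omega>. f' x = g' x"
  shows "is_weak_partial \<Omega> i g g'"
proof -
  have l: "locally_integrable \<Omega> f" "locally_integrable \<Omega> f'"
    using assms(2) by (auto simp: is_weak_partial_def)
  have l': "locally_integrable \<Omega> g" "locally_integrable \<Omega> g'"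
    using locally_integrable_AE_cong[OF assms(1)] l eq by blast+
  have c: "(\<integral>x. u x * \<phi> x \<partial>lebesgue_on \<Omega>) = (\<integral>x. w x * \<phi> x \<partial>lebesgue_on \<Omega>)"
    if "locally_integrable \<Omega> u" "locally_integrable \<Omega> w" "AE x in lebesgue_on \<Omega>. u x = w x"
      "\<phi> \<in> test_functions \<Omega>" for u w \<phi>
  proof (rule integral_cong_AE)
    show "AE x in lebesgue_on \<Omega>. u x * \<phi> x = w x * \<phi> x" using that(3) by eventually_elim simp
  qed (use integrable_test[OF assms(1) _ that(4)] that(1,2) in auto)
  show ?thesis
    unfolding is_weak_partial_def
  proof (intro conjI ballI l')
    fix \<phi> assume \<phi>: "\<phi> \<in> test_functions \<Omega>"
    have "(\<integral>x. f x * frechet_derivative \<phi> (at x) (axis i 1) \<partial>lebesgue_on \<Omega>)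
        = - (\<integral>x. f' x * \<phi> x \<partial>lebesgue_on \<Omega>)"
      using assms(2) \<phi> by (simp add: is_weak_partial_def)
    then show "(\<integral>x. g x * frechet_derivative \<phi> (at x) (axis i 1) \<partial>lebesgue_on \<Omega>)
        = - (\<integral>x. g' x * \<phi> x \<partial>lebesgue_on \<Omega>)"
      using c[OF l(1) l'(1) eq(1) test_function_deriv[OF \<phi>, of "axis i 1"]] c[OF l(2) l'(2) eq(2) \<phi>] by simp
  qed
qed

lemma is_weak_partial_weak_partial:
  "is_weak_partial \<Omega> i f g \<Longrightarrow> is_weak_partial \<Omega> i f (weak_partial \<Omega> i f)"
  unfolding weak_partial_def by (rule someI[of "is_weak_partial \<Omega> i f"])

lemma weak_partial_AE:
  "open \<Omega> \<Longrightarrow> is_weak_partial \<Omega> i f g \<Longrightarrow> AE x in lebesgue_on \<Omega>. weak_partial \<Omega> i f x = g x"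
  by (rule is_weak_partial_unique[OF _ is_weak_partial_weak_partial])

section \<open>The spaces H1 and H10\<close>

text \<open>The Dirichlet form, written through the scalar partial derivatives so that the
  real-valued L2 theory applies to each of them.\<close>

definition dip :: "(real^3) set \<Rightarrow> (real^3 \<Rightarrow> real) \<Rightarrow> (real^3 \<Rightarrow> real) \<Rightarrow> real" where
  "dip \<Omega> f g = (\<Sum>i\<in>UNIV. ip (lebesgue_on \<Omega>) (weak_partial \<Omega> i f) (weak_partial \<Omega> i g))"

definition hip :: "(real^3) set \<Rightarrow> (real^3 \<Rightarrow> real) \<Rightarrow> (real^3 \<Rightarrow> real) \<Rightarrow> real" where
  "hip \<Omega> f g = ip (lebesgue_on \<Omega>) f g + dip \<Omega> f g"

lemma Lp_2: "Lp 2 \<Omega> = L2 (lebesgue_on \<Omega>)"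
  by (auto simp: Lp_def L2_def)

lemma Lp_norm_2: "Lp_norm 2 \<Omega> f = L2.N (lebesgue_on \<Omega>) f"
proof -
  have "(\<integral>x. norm (f x) powr 2 \<partial>lebesgue_on \<Omega>) = ip (lebesgue_on \<Omega>) f f"
    by (auto simp: ip_def power2_eq_square intro!: Bochner_Integration.integral_cong)
  moreover have "0 \<le> ip (lebesgue_on \<Omega>) f f" by (simp add: ip_def)
  ultimately show ?thesis by (simp add: Lp_norm_def L2.N_def powr_half_sqrt)
qed

locale bounded_open =
  fixes \<Omega> :: "(real^3) set"
  assumes open_dom: "open \<Omega>" and bounded_dom: "bounded \<Omega>"
begin

abbreviation "M \<equiv> lebesgue_on \<Omega>"

lemma dom_lebesgue [simp]: "\<Omega> \<in> sets lebesgue"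
  using open_dom by auto

lemma finite_measure_M: "finite_measure M"
  using open_dom bounded_dom by (intro finite_measure_lebesgue_on lmeasurable_open)

lemma L2_integrable: "f \<in> L2 M \<Longrightarrow> integrable M f"
  using integral_abs_le_N(1)[OF finite_measure_M] .

lemma L2_locally_integrable: "f \<in> L2 M \<Longrightarrow> locally_integrable \<Omega> f"
  unfolding locally_integrable_def
proof safe
  fix K assume f: "f \<in> L2 M" and K: "compact K" "K \<subseteq> \<Omega>"
  then have "f absolutely_integrable_on \<Omega>"
    using L2_integrable integrable_lebesgue_on_iff[OF dom_lebesgue] by blast
  then show "f absolutely_integrable_on K"
    by (rule set_integrable_subset) (use K in \<open>auto simp: compact_imp_closed\<close>)
qed

lemma measurable_AE: "f \<in> borel_measurable M \<Longrightarrow> AE x in M. f x = g x \<Longrightarrow> g \<in> borel_measurable M"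
  for f g :: "real^3 \<Rightarrow> real"
  by (rule borel_measurable_lebesgue_on_AE[OF dom_lebesgue])

lemma L2_AE: "f \<in> L2 M \<Longrightarrow> AE x in M. f x = g x \<Longrightarrow> g \<in> L2 M"
  using L2_AE_cong[of f M g] measurable_AE[of f g] L2_measurable[of f M] by blast

lemma H1I:
  assumes "f \<in> L2 M" "\<And>i. g i \<in> L2 M" "\<And>i. is_weak_partial \<Omega> i f (g i)"
  shows "f \<in> H1 \<Omega>" "AE x in M. weak_partial \<Omega> i f x = g i x"
  using assms weak_partial_AE[OF open_dom, of i f "g i"] unfolding H1_def Lp_2 by blast+

lemma H1_L2: "f \<in> H1 \<Omega> \<Longrightarrow> f \<in> L2 M"
  by (simp add: H1_def Lp_2)

lemma H1_partial:
  assumes "f \<in> H1 \<Omega>"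
  shows "is_weak_partial \<Omega> i f (weak_partial \<Omega> i f)" "weak_partial \<Omega> i f \<in> L2 M"
proof -
  obtain g where g: "g \<in> L2 M" "is_weak_partial \<Omega> i f g"
    using assms by (auto simp: H1_def Lp_2)
  show "is_weak_partial \<Omega> i f (weak_partial \<Omega> i f)"
    using is_weak_partial_weak_partial[OF g(2)] .
  show "weak_partial \<Omega> i f \<in> L2 M"
    using weak_partial_AE[OF open_dom g(2)] L2_AE[OF g(1)] by (simp add: eq_commute)
qed

lemma H1_lin:
  assumes "f \<in> H1 \<Omega>" "g \<in> H1 \<Omega>"
  shows "(\<lambda>x. a * f x + b * g x) \<in> H1 \<Omega>"
    "AE x in M. weak_partial \<Omega> i (\<lambda>x. a * f x + b * g x) x = a * weak_partial \<Omega> i f x + b * weak_partial \<Omega> i g x"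
proof -
  let ?g = "\<lambda>i x. a * weak_partial \<Omega> i f x + b * weak_partial \<Omega> i g x"
  have 1: "(\<lambda>x. a * f x + b * g x) \<in> L2 M" "?g i \<in> L2 M" for i
    using assms H1_L2 H1_partial(2) by (auto intro!: L2_add L2_scale)
  have 2: "is_weak_partial \<Omega> i (\<lambda>x. a * f x + b * g x) (?g i)" for i
    using is_weak_partial_lin[OF open_dom] assms H1_partial(1) by blast
  show "(\<lambda>x. a * f x + b * g x) \<in> H1 \<Omega>"
    "AE x in M. weak_partial \<Omega> i (\<lambda>x. a * f x + b * g x) x = a * weak_partial \<Omega> i f x + b * weak_partial \<Omega> i g x"
    using H1I[where f = "\<lambda>x. a * f x + b * g x" and g = ?g, OF 1 2] by blast+
qed

lemma H1_AE:
  assumes "f \<in> H1 \<Omega>" "AE x in M. f x = g x"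
  shows "g \<in> H1 \<Omega>" "AE x in M. weak_partial \<Omega> i g x = weak_partial \<Omega> i f x"
proof -
  have "is_weak_partial \<Omega> i g (weak_partial \<Omega> i f)" for i
    by (rule is_weak_partial_AE_cong[OF open_dom H1_partial(1)[OF assms(1)] assms(2)]) auto
  from H1I[OF L2_AE[OF H1_L2[OF assms(1)] assms(2)] H1_partial(2)[OF assms(1)] this]
  show "g \<in> H1 \<Omega>" "AE x in M. weak_partial \<Omega> i g x = weak_partial \<Omega> i f x"
    by blast+
qed

lemma partial_measurable: "f \<in> H1 \<Omega> \<Longrightarrow> weak_partial \<Omega> i f \<in> borel_measurable M"
  using H1_partial(2) L2_measurable by blast

lemma dip_AE:
  assumes "f \<in> H1 \<Omega>" "AE x in M. f x = f' x" "g \<in> H1 \<Omega>" "AE x in M. g x = g' x"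
  shows "dip \<Omega> f' g' = dip \<Omega> f g"
  unfolding dip_def
proof (intro sum.cong refl ip_AE_cong)
  fix i
  show "weak_partial \<Omega> i f' \<in> borel_measurable M" "weak_partial \<Omega> i f \<in> borel_measurable M"
    "weak_partial \<Omega> i g' \<in> borel_measurable M" "weak_partial \<Omega> i g \<in> borel_measurable M"
    using partial_measurable H1_AE(1)[OF assms(1,2)] H1_AE(1)[OF assms(3,4)] assms by blast+
  show "AE x in M. weak_partial \<Omega> i f' x = weak_partial \<Omega> i f x"
    "AE x in M. weak_partial \<Omega> i g' x = weak_partial \<Omega> i g x"
    using H1_AE(2) assms by blast+
qed

lemma dip_lin:
  assumes "f \<in> H1 \<Omega>" "g \<in> H1 \<Omega>" "h \<in> H1 \<Omega>"
  shows "dip \<Omega> (\<lambda>x. a * f x + b * g x) h = a * dip \<Omega> f h + b * dip \<Omega> g h"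
proof -
  have "ip M (weak_partial \<Omega> i (\<lambda>x. a * f x + b * g x)) (weak_partial \<Omega> i h)
      = a * ip M (weak_partial \<Omega> i f) (weak_partial \<Omega> i h) + b * ip M (weak_partial \<Omega> i g) (weak_partial \<Omega> i h)" for i
  proof -
    have P: "weak_partial \<Omega> i f \<in> L2 M" "weak_partial \<Omega> i g \<in> L2 M" "weak_partial \<Omega> i h \<in> L2 M"
      using assms H1_partial(2) by auto
    have "ip M (weak_partial \<Omega> i (\<lambda>x. a * f x + b * g x)) (weak_partial \<Omega> i h)
      = ip M (\<lambda>x. a * weak_partial \<Omega> i f x + b * weak_partial \<Omega> i g x) (weak_partial \<Omega> i h)"
      using P assms by (intro ip_AE_cong H1_lin partial_measurable) (auto intro!: L2_measurable L2_add L2_scale)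
    also have "\<dots> = a * ip M (weak_partial \<Omega> i f) (weak_partial \<Omega> i h) + b * ip M (weak_partial \<Omega> i g) (weak_partial \<Omega> i h)"
      using P by (simp add: L2.B_add L2.B_scale L2_scale)
    finally show ?thesis .
  qed
  then show ?thesis by (simp add: dip_def sum.distrib sum_distrib_left)
qed

lemma ip_sym: "ip N f g = ip N g f"
  by (simp add: ip_def mult.commute)

lemma ip_pos: "0 \<le> ip N f f"
  by (simp add: ip_def)

lemma dip_sym: "dip \<Omega> f g = dip \<Omega> g f"
  by (simp add: dip_def ip_sym)

lemma dip_pos: "0 \<le> dip \<Omega> f f"
  by (simp add: dip_def sum_nonneg ip_pos)

lemma H1_zero: "(\<lambda>x. 0) \<in> H1 \<Omega>"
proof -
  have "is_weak_partial \<Omega> i (\<lambda>x. 0) (\<lambda>x. 0)" for i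
    by (simp add: is_weak_partial_def locally_integrable_def)
  then show ?thesis using H1I(1)[of "\<lambda>x. 0" "\<lambda>i x. 0"] L2_zero by blast
qed

text \<open>The Dirichlet form gets its own seminorm because all estimates for the solution are in
  terms of it; on \<open>H10\<close> the Poincare inequality lets it control the L2
  seminorm.\<close>

sublocale D: semi_inner "H1 \<Omega>" "dip \<Omega>"
proof
  fix f g h :: "real^3 \<Rightarrow> real" and c :: real
  assume f: "f \<in> H1 \<Omega>"
  show "(\<lambda>x. c * f x) \<in> H1 \<Omega>" using H1_lin(1)[OF f f, of c 0] by simp
  assume g: "g \<in> H1 \<Omega>"
  show "(\<lambda>x. f x + g x) \<in> H1 \<Omega>" using H1_lin(1)[OF f g, of 1 1] by simp
  show "dip \<Omega> (\<lambda>x. c * f x) g = c * dip \<Omega> f g" using dip_lin[OF f f g, of c 0] by simp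
  show "dip \<Omega> f g = dip \<Omega> g f" by (rule dip_sym)
  assume h: "h \<in> H1 \<Omega>"
  show "dip \<Omega> (\<lambda>x. f x + g x) h = dip \<Omega> f h + dip \<Omega> g h" using dip_lin[OF f g h, of 1 1] by simp
qed (auto simp: H1_zero dip_pos)

sublocale W: semi_inner "H1 \<Omega>" "hip \<Omega>"
  by unfold_locales
    (simp_all add: hip_def D.zero_mem D.add_mem D.scale_mem D.B_add D.B_scale L2.B_add L2.B_scale H1_L2
      distrib_left dip_pos ip_pos, simp add: dip_sym ip_sym)

text \<open>Translates the two ways in which the gradient enters the problem: the norm in the
  estimates and the integral in the coefficient of the equation.\<close>

lemma Lp_norm_grad:
  assumes "f \<in> H1 \<Omega>"
  shows "Lp_norm 2 \<Omega> (weak_grad \<Omega> f) = D.N f"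
    "(\<integral>x. (norm (weak_grad \<Omega> f x))\<^sup>2 \<partial>M) = dip \<Omega> f f"
proof -
  have "(norm (weak_grad \<Omega> f x))\<^sup>2 = (\<Sum>i\<in>UNIV. weak_partial \<Omega> i f x * weak_partial \<Omega> i f x)" for x
    by (simp add: weak_grad_def power2_norm_eq_inner inner_vec_def)
  then show *: "(\<integral>x. (norm (weak_grad \<Omega> f x))\<^sup>2 \<partial>M) = dip \<Omega> f f"
    using L2_integrable_mult[OF H1_partial(2)[OF assms] H1_partial(2)[OF assms]]
    by (simp add: dip_def ip_def)
  then show "Lp_norm 2 \<Omega> (weak_grad \<Omega> f) = D.N f"
    by (simp add: Lp_norm_def D.N_def powr_half_sqrt dip_pos)
qed

lemma integral_grad_inner:
  assumes "f \<in> H1 \<Omega>" "g \<in> H1 \<Omega>"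
  shows "(\<integral>x. weak_grad \<Omega> f x \<bullet> weak_grad \<Omega> g x \<partial>M) = dip \<Omega> f g"
  using L2_integrable_mult[OF H1_partial(2)[OF assms(1)] H1_partial(2)[OF assms(2)]]
  by (simp add: dip_def ip_def weak_grad_def inner_vec_def)

lemma H1_norm_eq:
  assumes "f \<in> H1 \<Omega>"
  shows "H1_norm \<Omega> f = W.N f"
  using assms
  by (simp add: H1_norm_def Lp_norm_grad Lp_norm_2 L2.N_sq H1_L2 D.N_sq W.N_def hip_def)

lemma N_le_W: "f \<in> H1 \<Omega> \<Longrightarrow> L2.N M f \<le> W.N f"
  and D_le_W: "f \<in> H1 \<Omega> \<Longrightarrow> D.N f \<le> W.N f"
  by (auto simp: W.N_def D.N_def L2.N_def hip_def dip_pos ip_pos)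

lemma W_le: "f \<in> H1 \<Omega> \<Longrightarrow> W.N f \<le> L2.N M f + D.N f"
  unfolding W.N_def D.N_def L2.N_def hip_def
  using ip_pos[of M f] dip_pos[of f] by (intro real_le_lsqrt)  (auto simp: power2_sum)

lemma N_partial_le: "f \<in> H1 \<Omega> \<Longrightarrow> L2.N M (weak_partial \<Omega> i f) \<le> D.N f"
  unfolding L2.N_def D.N_def dip_def
  by (intro real_sqrt_le_mono member_le_sum[of i UNIV "\<lambda>i. ip M (weak_partial \<Omega> i f) (weak_partial \<Omega> i f)"])
    (auto simp: ip_pos)

section \<open>Test functions in H1\<close>

lemma test_L2:
  assumes "\<phi> \<in> test_functions \<Omega>"
  shows "\<phi> \<in> L2 M"
proof -
  obtain B where B: "\<And>x. \<bar>\<phi> x\<bar> \<le> B" using test_function_bounded[OF assms] by metis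
  interpret finite_measure M by (rule finite_measure_M)
  show ?thesis
  proof (rule L2_bound[where g = "\<lambda>x. B\<^sup>2"])
    show "\<phi> \<in> borel_measurable M"
      using test_function_continuous[OF assms] continuous_on_subset
      by (intro continuous_imp_measurable_on_sets_lebesgue) auto
    show "AE x in M. (\<phi> x)\<^sup>2 \<le> B\<^sup>2"
      using B power_mono[of "\<bar>\<phi> _\<bar>" B 2] by (intro AE_I2) simp
  qed auto
qed

end

lemma test_function_mult:
  assumes "\<phi> \<in> test_functions \<Omega>" "\<psi> \<in> test_functions \<Omega>"
  shows "(\<lambda>x. \<phi> x * \<psi> x) \<in> test_functions \<Omega>"
proof -
  obtain K where K: "compact K" "K \<subseteq> \<Omega>" "\<And>x. x \<notin> K \<Longrightarrow> \<phi> x = 0"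
    using test_function_support[OF assms(1)] by metis
  have "smooth_on UNIV (\<lambda>x. \<phi> x * \<psi> x)"
    using assms unfolding test_functions_def smooth_on_def by (intro allI Ck_on_UNIV_mult) auto
  then show ?thesis by (rule test_functionsI[OF _ K(1,2)]) (simp add: K(3))
qed

lemma test_function_line_deriv:
  assumes "\<phi> \<in> test_functions \<Omega>"
  shows "((\<lambda>t. \<phi> (x + t *\<^sub>R e)) has_real_derivative frechet_derivative \<phi> (at (x + t *\<^sub>R e)) e) (at t)"
proof -
  have "((\<lambda>t. \<phi> (x + t *\<^sub>R e)) has_derivative (\<lambda>s. frechet_derivative \<phi> (at (x + t *\<^sub>R e)) (s *\<^sub>R e))) (at t)"
    by (rule has_derivative_compose[OF _ test_function_differentiable[OF assms], of "\<lambda>t. x + t *\<^sub>R e", simplified])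
      (auto intro!: derivative_eq_intros)
  moreover have "frechet_derivative \<phi> (at y) (s *\<^sub>R e) = frechet_derivative \<phi> (at y) e * s" for s y
    using linear_scale[OF has_derivative_linear[OF test_function_differentiable[OF assms, of y]], of s e]
    by (simp add: mult.commute)
  ultimately show ?thesis unfolding has_field_derivative_def by simp
qed

section \<open>Integration by parts for test functions\<close>

lemma integral_UNIV_eq:
  fixes f :: "'a::euclidean_space \<Rightarrow> real"
  assumes "S \<in> sets lebesgue" "f \<in> borel_measurable borel" "\<And>x. x \<notin> S \<Longrightarrow> f x = 0"
  shows "(\<integral>x. f x \<partial>lebesgue_on S) = (\<integral>x. f x \<partial>lborel)"
proof -
  have "(\<integral>x. f x \<partial>lebesgue_on S) = (\<integral>x. f x \<partial>lebesgue)"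
    using assms(1,3) by (simp add: integral_restrict_space) (intro Bochner_Integration.integral_cong; auto simp: indicator_def)
  also have "\<dots> = (\<integral>x. f x \<partial>lborel)"
    using assms(2) by (intro integral_completion) auto
  finally show ?thesis .
qed

lemma lborel_integral_translate:
  fixes f :: "'a::euclidean_space \<Rightarrow> real"
  assumes "f \<in> borel_measurable borel"
  shows "(\<integral>x. f (x + a) \<partial>lborel) = (\<integral>x. f x \<partial>lborel)"
proof -
  have "(\<integral>x. f x \<partial>lborel) = (\<integral>x. f x \<partial>distr lborel borel (\<lambda>x. a + x))"
    by (simp add: lborel_distr_plus)
  also have "\<dots> = (\<integral>x. f (a + x) \<partial>lborel)"
    using assms by (intro integral_distr) auto
  finally show ?thesis by (simp add: add.commute)
qed

lemma test_function_borel: "\<phi> \<in> test_functions \<Omega> \<Longrightarrow> \<phi> \<in> borel_measurable borel"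
  using test_function_continuous borel_measurable_continuous_onI by blast

lemma test_function_integrable_lborel:
  assumes "\<phi> \<in> test_functions \<Omega>"
  shows "integrable lborel \<phi>"
proof -
  obtain K where K: "compact K" "\<And>x. x \<notin> K \<Longrightarrow> \<phi> x = 0" using test_function_support[OF assms] by metis
  obtain B where B: "\<And>x. \<bar>\<phi> x\<bar> \<le> B" using test_function_bounded[OF assms] by metis
  show ?thesis
  proof (rule Bochner_Integration.integrable_bound)
    show "integrable lborel (\<lambda>x. indicator K x * B)"
      using emeasure_bounded_finite[OF compact_imp_bounded[OF K(1)]] compact_imp_closed[OF K(1)]
      by (intro integrable_mult_left) auto
    show "AE x in lborel. norm (\<phi> x) \<le> norm (indicator K x * B)"
      using B K(2) by (intro AE_I2) (force simp: indicator_def intro: order_trans)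
  qed (use test_function_borel[OF assms] in auto)
qed

text \<open>The derivative is a dominated limit of difference quotients, and each quotient
  integrates to zero by translation invariance of Lebesgue measure.\<close>

lemma integral_test_deriv:
  assumes h: "h \<in> test_functions \<Omega>"
  shows "(\<integral>x. frechet_derivative h (at x) e \<partial>lborel) = 0"
proof -
  obtain K where K: "compact K" "\<And>x. x \<notin> K \<Longrightarrow> h x = 0" using test_function_support[OF h] by metis
  obtain B where B: "\<And>x. \<bar>frechet_derivative h (at x) e\<bar> \<le> B"
    using test_function_bounded[OF test_function_deriv[OF h]] by metis
  have B0: "0 \<le> B" using B[of 0] by linarith
  obtain R where R: "\<And>x. x \<in> K \<Longrightarrow> norm x \<le> R" using K(1) compact_imp_bounded bounded_iff by metis
  \<comment> \<open>The radius exceeds that of the support by \<open>norm e\<close>; the steps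
    satisfy \<open>t n \<le> 1\<close>, so all quotients vanish outside this ball.\<close>
  define S where "S = cball (0::real^3) (R + norm e)"
  define t where "t n = 1 / real (Suc n)" for n
  have t: "0 < t n" "t n \<le> 1" for n by (auto simp: t_def)
  define q where "q n x = (h (x + t n *\<^sub>R e) - h x) / t n" for n x
  have hb: "h \<in> borel_measurable borel" by (rule test_function_borel[OF h])
  have qb: "q n \<in> borel_measurable borel" for n
    unfolding q_def using hb by measurable
  have "(\<lambda>n. \<integral>x. q n x \<partial>lborel) \<longlonglongrightarrow> (\<integral>x. frechet_derivative h (at x) e \<partial>lborel)"
  proof (rule integral_dominated_convergence[where w = "\<lambda>x. indicator S x * B"])
    show "AE x in lborel. (\<lambda>n. q n x) \<longlonglongrightarrow> frechet_derivative h (at x) e"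
    proof (rule AE_I2)
      fix x
      have "((\<lambda>s. (h (x + s *\<^sub>R e) - h x) / s) \<longlongrightarrow> frechet_derivative h (at x) e) (at 0)"
        using test_function_line_deriv[OF h, of x e 0] by (simp add: has_field_derivative_iff)
      moreover have "filterlim t (at 0) sequentially"
        unfolding filterlim_at
      proof (intro conjI)
        show "t \<longlonglongrightarrow> 0" using LIMSEQ_inverse_real_of_nat by (simp add: t_def[abs_def] inverse_eq_divide)
        show "\<forall>\<^sub>F n in sequentially. t n \<in> UNIV \<and> t n \<noteq> 0"
          using t(1) by (auto intro!: always_eventually simp: less_imp_neq[symmetric])
      qed
      ultimately show "(\<lambda>n. q n x) \<longlonglongrightarrow> frechet_derivative h (at x) e"
        unfolding q_def by (rule filterlim_compose)
    qed
    show "AE x in lborel. norm (q n x) \<le> indicator S x * B" for n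
    proof (rule AE_I2)
      fix x
      obtain s where s: "h (x + t n *\<^sub>R e) - h (x + 0 *\<^sub>R e) = (t n - 0) * frechet_derivative h (at (x + s *\<^sub>R e)) e"
        using MVT2[OF t(1)[of n], of "\<lambda>s. h (x + s *\<^sub>R e)" "\<lambda>s. frechet_derivative h (at (x + s *\<^sub>R e)) e"]
          test_function_line_deriv[OF h] by blast
      have qB: "\<bar>q n x\<bar> \<le> B" using s t(1)[of n] B by (simp add: q_def)
      have "q n x = 0" if "x \<notin> S"
      proof -
        have "x \<notin> K" "x + t n *\<^sub>R e \<notin> K"
        proof -
          show "x \<notin> K"
          proof
            assume "x \<in> K"
            then have "norm x \<le> R" by (rule R)
            then show False using that norm_ge_zero[of e] unfolding S_def mem_cball_0 by linarith
          qed
          show "x + t n *\<^sub>R e \<notin> K"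
          proof
            assume "x + t n *\<^sub>R e \<in> K"
            then have "norm (x + t n *\<^sub>R e) \<le> R" by (rule R)
            moreover have "norm x \<le> norm (x + t n *\<^sub>R e) + norm (t n *\<^sub>R e)"
              using norm_triangle_ineq4[of "x + t n *\<^sub>R e" "t n *\<^sub>R e"] by simp
            moreover have "norm (t n *\<^sub>R e) \<le> norm e"
              using t[of n] by (simp add: mult_left_le_one_le)
            ultimately show False using that by (simp add: S_def)
          qed
        qed
        then show ?thesis by (simp add: q_def K(2))
      qed
      then show "norm (q n x) \<le> indicator S x * B"
        using qB by (cases "x \<in> S") auto
    qed
    show "integrable lborel (\<lambda>x. indicator S x * B)"
      unfolding S_def using emeasure_bounded_finite[OF bounded_cball[of "0::real^3"]]
      by (intro integrable_mult_left) auto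
    show "(\<lambda>x. frechet_derivative h (at x) e) \<in> borel_measurable lborel"
      using test_function_borel[OF test_function_deriv[OF h]] by simp
  qed (use qb in auto)
  moreover have "(\<integral>x. q n x \<partial>lborel) = 0" for n
  proof -
    have "integrable (distr lborel borel (\<lambda>x. t n *\<^sub>R e + x)) h"
      using test_function_integrable_lborel[OF h] by (simp add: lborel_distr_plus)
    from integrable_distr[OF _ this] have "integrable lborel (\<lambda>x. h (x + t n *\<^sub>R e))"
      by (simp add: add.commute)
    then show ?thesis
      using test_function_integrable_lborel[OF h] lborel_integral_translate[OF hb]
      by (simp add: q_def)
  qed
  ultimately show ?thesis using LIMSEQ_unique[OF _ tendsto_const] by fastforce
qed

section \<open>Density of test functions, closedness of weak derivatives, and Green's
  formula\<close>

context bounded_open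
begin

text \<open>The derivative of the product of two test functions integrates to zero; the product rule
  splits it into the two sides.\<close>

lemma test_is_weak_partial:
  assumes "\<phi> \<in> test_functions \<Omega>"
  shows "is_weak_partial \<Omega> i \<phi> (\<lambda>x. frechet_derivative \<phi> (at x) (axis i 1))"
  unfolding is_weak_partial_def
proof (intro conjI ballI)
  show "locally_integrable \<Omega> \<phi>" "locally_integrable \<Omega> (\<lambda>x. frechet_derivative \<phi> (at x) (axis i 1))"
    using L2_locally_integrable test_L2 assms test_function_deriv by blast+
  fix \<psi> assume \<psi>: "\<psi> \<in> test_functions \<Omega>"
  define e :: "real^3" where "e = axis i 1"
  let ?h = "\<lambda>x. \<phi> x * \<psi> x"
  have h: "?h \<in> test_functions \<Omega>" by (rule test_function_mult[OF assms \<psi>])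
  have "frechet_derivative ?h (at x) = (\<lambda>v. \<phi> x * frechet_derivative \<psi> (at x) v + frechet_derivative \<phi> (at x) v * \<psi> x)" for x
    by (rule sym, rule frechet_derivative_at, rule has_derivative_mult)
      (use assms \<psi> test_function_differentiable in auto)
  then have D: "frechet_derivative ?h (at x) e = \<phi> x * frechet_derivative \<psi> (at x) e + frechet_derivative \<phi> (at x) e * \<psi> x" for x
    by simp
  have z: "frechet_derivative ?h (at x) e = 0" if "x \<notin> \<Omega>" for x
    using test_function_support[OF h] that by (metis subsetD)
  have "(\<integral>x. frechet_derivative ?h (at x) e \<partial>M) = 0"
    using integral_UNIV_eq[OF dom_lebesgue test_function_borel[OF test_function_deriv[OF h]] z]
      integral_test_deriv[OF h, of e] by simp
  moreover have "integrable M (\<lambda>x. \<phi> x * frechet_derivative \<psi> (at x) e)"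
    "integrable M (\<lambda>x. frechet_derivative \<phi> (at x) e * \<psi> x)"
    using assms \<psi> test_L2 test_function_deriv by (auto intro!: L2_integrable_mult)
  ultimately show "(\<integral>x. \<phi> x * frechet_derivative \<psi> (at x) (axis i 1) \<partial>M)
      = - (\<integral>x. frechet_derivative \<phi> (at x) (axis i 1) * \<psi> x \<partial>M)"
    by (simp add: D flip: e_def)
qed

lemma test_H1:
  assumes "\<phi> \<in> test_functions \<Omega>"
  shows "\<phi> \<in> H1 \<Omega>" "AE x in M. weak_partial \<Omega> i \<phi> x = frechet_derivative \<phi> (at x) (axis i 1)"
  using H1I[OF test_L2[OF assms] test_L2[OF test_function_deriv[OF assms]] test_is_weak_partial[OF assms]] by auto

text \<open>For a fixed test function both sides of the defining identity are L2 pairings, hence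
  continuous.\<close>

lemma is_weak_partial_limit:
  assumes u: "\<And>n::nat. u n \<in> L2 M" "\<And>n. v n \<in> L2 M" "\<And>n. is_weak_partial \<Omega> i (u n) (v n)"
    and f: "f \<in> L2 M" "g \<in> L2 M"
    and lim: "(\<lambda>n. L2.N M (\<lambda>x. u n x - f x)) \<longlonglongrightarrow> 0" "(\<lambda>n. L2.N M (\<lambda>x. v n x - g x)) \<longlonglongrightarrow> 0"
  shows "is_weak_partial \<Omega> i f g"
  unfolding is_weak_partial_def
proof (intro conjI ballI L2_locally_integrable f)
  fix \<phi> assume \<phi>: "\<phi> \<in> test_functions \<Omega>"
  let ?d = "\<lambda>x. frechet_derivative \<phi> (at x) (axis i 1)"
  have "(\<lambda>n. ip M ?d (u n)) \<longlonglongrightarrow> ip M ?d f"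
    using u f lim test_L2[OF test_function_deriv[OF \<phi>]] by (intro L2.tendsto_B) auto
  moreover have "(\<lambda>n. ip M \<phi> (v n)) \<longlonglongrightarrow> ip M \<phi> g"
    using u f lim test_L2[OF \<phi>] by (intro L2.tendsto_B) auto
  moreover have "ip M ?d (u n) = - ip M \<phi> (v n)" for n
    using u(3)[of n] \<phi> by (simp add: is_weak_partial_def ip_def mult.commute)
  ultimately have "ip M ?d f = - ip M \<phi> g"
    using LIMSEQ_unique[OF _ tendsto_minus] by fastforce
  then show "(\<integral>x. f x * ?d x \<partial>M) = - (\<integral>x. g x * \<phi> x \<partial>M)"
    by (simp add: ip_def mult.commute)
qed

lemma H10_H1: "f \<in> H10 \<Omega> \<Longrightarrow> f \<in> H1 \<Omega>"
  by (simp add: H10_def)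

lemma test_diff_H1: "f \<in> H1 \<Omega> \<Longrightarrow> \<phi> \<in> test_functions \<Omega> \<Longrightarrow> (\<lambda>x. f x - \<phi> x) \<in> H1 \<Omega>"
  by (simp add: D.diff_mem test_H1)

lemma H10_iff: "f \<in> H10 \<Omega> \<longleftrightarrow> f \<in> H1 \<Omega> \<and> (\<forall>e>0. \<exists>\<phi>\<in>test_functions \<Omega>. W.N (\<lambda>x. f x - \<phi> x) < e)"
  unfolding H10_def using H1_norm_eq[OF test_diff_H1] by auto

lemma H10_approx:
  assumes "f \<in> H10 \<Omega>"
  obtains \<phi> where "\<And>n::nat. \<phi> n \<in> test_functions \<Omega>" "(\<lambda>n. W.N (\<lambda>x. \<phi> n x - f x)) \<longlonglongrightarrow> 0"
    "(\<lambda>n. L2.N M (\<lambda>x. \<phi> n x - f x)) \<longlonglongrightarrow> 0" "(\<lambda>n. D.N (\<lambda>x. \<phi> n x - f x)) \<longlonglongrightarrow> 0"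
proof -
  have fH: "f \<in> H1 \<Omega>" using assms H10_H1 by auto
  have "\<forall>n. \<exists>\<phi>. \<phi> \<in> test_functions \<Omega> \<and> W.N (\<lambda>x. f x - \<phi> x) < 1 / real (Suc n)"
    using assms unfolding H10_iff by (metis of_nat_0_less_iff zero_less_Suc zero_less_divide_1_iff)
  then obtain \<phi> where \<phi>: "\<And>n. \<phi> n \<in> test_functions \<Omega>" "\<And>n. W.N (\<lambda>x. f x - \<phi> n x) < 1 / real (Suc n)"
    by metis
  have H: "(\<lambda>x. \<phi> n x - f x) \<in> H1 \<Omega>" for n using \<phi>(1) test_H1 fH D.diff_mem by blast
  have lt: "W.N (\<lambda>x. \<phi> n x - f x) < 1 / real (Suc n)" for n
    using \<phi>(2)[of n] W.N_minus[OF fH test_H1(1)[OF \<phi>(1)[of n]]] by simp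
  have 1: "(\<lambda>n. W.N (\<lambda>x. \<phi> n x - f x)) \<longlonglongrightarrow> 0"
  proof (rule tendsto_sandwich[OF _ _ tendsto_const])
    show "\<forall>\<^sub>F n in sequentially. W.N (\<lambda>x. \<phi> n x - f x) \<le> inverse (real (Suc n))"
      using lt less_imp_le by (auto simp: inverse_eq_divide intro!: always_eventually)
  qed (use H W.N_nonneg LIMSEQ_inverse_real_of_nat in auto)
  have 2: "(\<lambda>n. L2.N M (\<lambda>x. \<phi> n x - f x)) \<longlonglongrightarrow> 0"
    by (rule tendsto_sandwich[OF _ _ tendsto_const 1])
      (use N_le_W[OF H] L2.N_nonneg[OF H1_L2[OF H]] in \<open>auto intro!: always_eventually\<close>)
  have 3: "(\<lambda>n. D.N (\<lambda>x. \<phi> n x - f x)) \<longlonglongrightarrow> 0"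
    by (rule tendsto_sandwich[OF _ _ tendsto_const 1])
      (use D_le_W[OF H] D.N_nonneg[OF H] in \<open>auto intro!: always_eventually\<close>)
  show thesis using that[OF \<phi>(1) 1 2 3] .
qed

lemma H10_limit:
  assumes "\<And>n::nat. u n \<in> H10 \<Omega>" "f \<in> H1 \<Omega>" "(\<lambda>n. W.N (\<lambda>x. u n x - f x)) \<longlonglongrightarrow> 0"
  shows "f \<in> H10 \<Omega>"
  unfolding H10_iff
proof (intro conjI allI impI assms(2))
  fix e :: real assume e: "0 < e"
  then obtain n where n: "W.N (\<lambda>x. u n x - f x) < e / 2"
    using order_tendstoD(2)[OF assms(3), of "e / 2"] by (auto simp: eventually_sequentially)
  obtain \<phi> where \<phi>: "\<phi> \<in> test_functions \<Omega>" "W.N (\<lambda>x. u n x - \<phi> x) < e / 2"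
    using assms(1)[of n] e unfolding H10_iff by (metis half_gt_zero)
  have uH: "u n \<in> H1 \<Omega>" using assms(1) H10_H1 by auto
  have "W.N (\<lambda>x. (f x - u n x) + (u n x - \<phi> x)) \<le> W.N (\<lambda>x. f x - u n x) + W.N (\<lambda>x. u n x - \<phi> x)"
    using uH assms(2) \<phi>(1) test_diff_H1 D.diff_mem by (intro W.N_triangle) auto
  then have "W.N (\<lambda>x. f x - \<phi> x) < e"
    using n \<phi>(2) W.N_minus[OF uH assms(2)] by simp
  then show "\<exists>\<phi>\<in>test_functions \<Omega>. W.N (\<lambda>x. f x - \<phi> x) < e" using \<phi>(1) by blast
qed

lemma test_H10:
  assumes \<phi>: "\<phi> \<in> test_functions \<Omega>"
  shows "\<phi> \<in> H10 \<Omega>"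
proof -
  have "W.N (\<lambda>x. \<phi> x - \<phi> x) = 0" using W.N_scale[OF test_H1(1)[OF \<phi>], of 0] by simp
  then have "\<exists>\<psi>\<in>test_functions \<Omega>. W.N (\<lambda>x. \<phi> x - \<psi> x) < e" if "0 < e" for e
    using that \<phi> by (intro bexI[of _ \<phi>]) simp_all
  then show ?thesis unfolding H10_iff using test_H1(1)[OF \<phi>] by blast
qed

lemma H10_lin:
  assumes "f \<in> H10 \<Omega>" "g \<in> H10 \<Omega>"
  shows "(\<lambda>x. a * f x + b * g x) \<in> H10 \<Omega>"
proof -
  obtain \<phi> where \<phi>: "\<And>n::nat. \<phi> n \<in> test_functions \<Omega>" "(\<lambda>n. W.N (\<lambda>x. \<phi> n x - f x)) \<longlonglongrightarrow> 0"
    using H10_approx[OF assms(1)] by blast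
  obtain \<psi> where \<psi>: "\<And>n::nat. \<psi> n \<in> test_functions \<Omega>" "(\<lambda>n. W.N (\<lambda>x. \<psi> n x - g x)) \<longlonglongrightarrow> 0"
    using H10_approx[OF assms(2)] by blast
  have H: "f \<in> H1 \<Omega>" "g \<in> H1 \<Omega>" "\<And>n. \<phi> n \<in> H1 \<Omega>" "\<And>n. \<psi> n \<in> H1 \<Omega>"
    using assms H10_H1 \<phi>(1) \<psi>(1) test_H1(1) by auto
  show ?thesis
  proof (rule H10_limit)
    show "(\<lambda>x. a * \<phi> n x + b * \<psi> n x) \<in> H10 \<Omega>" for n
      by (intro test_H10 test_function_lin \<phi> \<psi>)
    show "(\<lambda>x. a * f x + b * g x) \<in> H1 \<Omega>" using H by (intro H1_lin)
    show "(\<lambda>n. W.N (\<lambda>x. (a * \<phi> n x + b * \<psi> n x) - (a * f x + b * g x))) \<longlonglongrightarrow> 0"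
    proof (rule Lim_null_comparison)
      show "\<forall>\<^sub>F n in sequentially. norm (W.N (\<lambda>x. (a * \<phi> n x + b * \<psi> n x) - (a * f x + b * g x)))
          \<le> \<bar>a\<bar> * W.N (\<lambda>x. \<phi> n x - f x) + \<bar>b\<bar> * W.N (\<lambda>x. \<psi> n x - g x)"
      proof (intro always_eventually allI)
        fix n
        have d: "(\<lambda>x. a * (\<phi> n x - f x)) \<in> H1 \<Omega>" "(\<lambda>x. b * (\<psi> n x - g x)) \<in> H1 \<Omega>"
          using H by (auto intro!: D.scale_mem D.diff_mem)
        have "(\<lambda>x. (a * \<phi> n x + b * \<psi> n x) - (a * f x + b * g x)) = (\<lambda>x. a * (\<phi> n x - f x) + b * (\<psi> n x - g x))"
          by (auto simp: algebra_simps)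
        then show "norm (W.N (\<lambda>x. (a * \<phi> n x + b * \<psi> n x) - (a * f x + b * g x)))
          \<le> \<bar>a\<bar> * W.N (\<lambda>x. \<phi> n x - f x) + \<bar>b\<bar> * W.N (\<lambda>x. \<psi> n x - g x)"
          using W.N_triangle[OF d] W.N_nonneg[OF D.add_mem[OF d]] H
          by (simp add: W.N_scale D.diff_mem)
      qed
      show "(\<lambda>n. \<bar>a\<bar> * W.N (\<lambda>x. \<phi> n x - f x) + \<bar>b\<bar> * W.N (\<lambda>x. \<psi> n x - g x)) \<longlonglongrightarrow> 0"
        using tendsto_add[OF tendsto_mult_left[OF \<phi>(2), of "\<bar>a\<bar>"] tendsto_mult_left[OF \<psi>(2), of "\<bar>b\<bar>"]] by simp
    qed
  qed
qed

lemma laplacian_L2: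
  assumes "\<And>i. weak_partial \<Omega> i u \<in> H1 \<Omega>"
  shows "weak_laplacian \<Omega> u \<in> L2 M"
proof -
  have *: "weak_partial \<Omega> i (weak_partial \<Omega> i u) \<in> L2 M" for i using assms H1_partial(2) by auto
  have "(\<lambda>x. \<Sum>i\<in>A. weak_partial \<Omega> i (weak_partial \<Omega> i u) x) \<in> L2 M" if "finite A" for A
    using that by (induction A rule: finite_induct) (auto simp: L2_zero intro!: L2_add *)
  then show ?thesis by (simp add: weak_laplacian_def[abs_def])
qed

text \<open>For a test function \<open>v\<close> this is the definition of the second weak
  derivatives. Both sides are continuous in \<open>v\<close>, in the L2 and the Dirichlet seminorm
  respectively, so density extends it to \<open>H10\<close>; the boundary condition enters through
  this membership.\<close>

lemma Green:
  assumes u: "u \<in> H1 \<Omega>" "\<And>i. weak_partial \<Omega> i u \<in> H1 \<Omega>" and v: "v \<in> H10 \<Omega>"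
  shows "ip M (weak_laplacian \<Omega> u) v = - dip \<Omega> u v"
proof -
  let ?L = "weak_laplacian \<Omega> u"
  have L: "?L \<in> L2 M" by (rule laplacian_L2[OF u(2)])
  have test: "ip M ?L \<phi> = - dip \<Omega> u \<phi>" if \<phi>: "\<phi> \<in> test_functions \<Omega>" for \<phi>
  proof -
    have "ip M (weak_partial \<Omega> i u) (weak_partial \<Omega> i \<phi>) = - ip M (weak_partial \<Omega> i (weak_partial \<Omega> i u)) \<phi>" for i
    proof -
      have "ip M (weak_partial \<Omega> i u) (weak_partial \<Omega> i \<phi>)
          = ip M (weak_partial \<Omega> i u) (\<lambda>x. frechet_derivative \<phi> (at x) (axis i 1))"
        using test_H1[OF \<phi>] u H1_partial(2) test_L2[OF test_function_deriv[OF \<phi>]]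
        by (intro ip_AE_cong partial_measurable) (auto intro: L2_measurable)
      also have "\<dots> = - ip M (weak_partial \<Omega> i (weak_partial \<Omega> i u)) \<phi>"
        using H1_partial(1)[OF u(2), of i i] \<phi> by (simp add: is_weak_partial_def ip_def)
      finally show ?thesis .
    qed
    moreover have "ip M ?L \<phi> = (\<Sum>i\<in>UNIV. ip M (weak_partial \<Omega> i (weak_partial \<Omega> i u)) \<phi>)"
      using L2_integrable_mult[OF H1_partial(2)[OF u(2)] test_L2[OF \<phi>]]
      by (simp add: ip_def weak_laplacian_def sum_distrib_right)
    ultimately show ?thesis by (simp add: dip_def sum_negf)
  qed
  obtain \<phi> where \<phi>: "\<And>n::nat. \<phi> n \<in> test_functions \<Omega>"
    "(\<lambda>n. L2.N M (\<lambda>x. \<phi> n x - v x)) \<longlonglongrightarrow> 0" "(\<lambda>n. D.N (\<lambda>x. \<phi> n x - v x)) \<longlonglongrightarrow> 0"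
    using H10_approx[OF v] by blast
  have "(\<lambda>n. ip M ?L (\<phi> n)) \<longlonglongrightarrow> ip M ?L v"
    using \<phi> L H1_L2[OF H10_H1[OF v]] test_L2 by (intro L2.tendsto_B) auto
  moreover have "(\<lambda>n. dip \<Omega> u (\<phi> n)) \<longlonglongrightarrow> dip \<Omega> u v"
    using \<phi> u H10_H1[OF v] test_H1 by (intro D.tendsto_B) auto
  ultimately show ?thesis using LIMSEQ_unique[OF _ tendsto_minus] test[OF \<phi>(1)] by fastforce
qed

end

section \<open>The Sobolev inequality\<close>

definition v3 :: "real \<Rightarrow> real \<Rightarrow> real \<Rightarrow> real^3" where
  "v3 x y z = x *\<^sub>R axis 1 1 + y *\<^sub>R axis 2 1 + z *\<^sub>R axis 3 1"

lemma v3_nth [simp]: "v3 x y z $ 1 = x" "v3 x y z $ 2 = y" "v3 x y z $ 3 = z"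
  by (simp_all add: v3_def axis_def)

lemma v3_measurable: "(\<lambda>(x, y, z). v3 x y z) \<in> borel_measurable (lborel \<Otimes>\<^sub>M (lborel \<Otimes>\<^sub>M lborel))"
  unfolding v3_def by measurable

lemma sigma_finite_lborel2: "sigma_finite_measure (lborel \<Otimes>\<^sub>M lborel :: (real \<times> real) measure)"
  by (simp add: lborel_prod lborel.sigma_finite_measure_axioms)

text \<open>Lebesgue measure is determined by its values on boxes. This identifies integration over
  \<open>real^3\<close> with iterated integration in three real variables.\<close>

lemma lborel_v3: "lborel = distr (lborel \<Otimes>\<^sub>M (lborel \<Otimes>\<^sub>M lborel)) borel (\<lambda>(x, y, z). v3 x y z)"
proof (rule lborel_eqI)
  fix l u :: "real^3"
  assume le: "\<And>b. b \<in> Basis \<Longrightarrow> l \<bullet> b \<le> u \<bullet> b"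
  have le': "l $ i \<le> u $ i" for i
    using le[of "axis i 1"] by (auto simp: inner_axis axis_in_Basis_iff)
  have "emeasure (distr (lborel \<Otimes>\<^sub>M (lborel \<Otimes>\<^sub>M lborel)) borel (\<lambda>(x, y, z). v3 x y z)) (box l u)
      = emeasure (lborel \<Otimes>\<^sub>M (lborel \<Otimes>\<^sub>M lborel)) ((\<lambda>(x, y, z). v3 x y z) -` box l u)"
    by (subst emeasure_distr) (use v3_measurable in \<open>auto simp: space_pair_measure\<close>)
  also have "(\<lambda>(x, y, z). v3 x y z) -` box l u = {l$1<..<u$1} \<times> {l$2<..<u$2} \<times> {l$3<..<u$3}"
    by (auto simp: mem_box_cart forall_3)
  also have "emeasure (lborel \<Otimes>\<^sub>M (lborel \<Otimes>\<^sub>M lborel)) ({l$1<..<u$1} \<times> {l$2<..<u$2} \<times> {l$3<..<u$3})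
      = ennreal (u$1 - l$1) * (ennreal (u$2 - l$2) * ennreal (u$3 - l$3))"
    using le' by (simp add: sigma_finite_measure.emeasure_pair_measure_Times[OF sigma_finite_lborel2]
        lborel.emeasure_pair_measure_Times)
  also have "\<dots> = ennreal ((u$1 - l$1) * ((u$2 - l$2) * (u$3 - l$3)))"
    using le' by (simp add: ennreal_mult)
  also have "(u$1 - l$1) * ((u$2 - l$2) * (u$3 - l$3)) = (\<Prod>i\<in>UNIV. (u - l) \<bullet> axis i 1)"
    unfolding UNIV_3 inner_axis by (simp add: inner_real_def del: One_nat_def)
  also have "\<dots> = (\<Prod>b\<in>Basis. (u - l) \<bullet> b)"
  proof -
    have B: "(Basis :: (real^3) set) = range (\<lambda>i. axis i 1)" by (auto simp: Basis_vec_def)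
    have "inj (\<lambda>i. axis i 1 :: real^3)" by (simp add: inj_on_def axis_eq_axis)
    then show ?thesis unfolding B by (subst prod.reindex) (auto simp: o_def)
  qed
  finally show "emeasure (distr (lborel \<Otimes>\<^sub>M (lborel \<Otimes>\<^sub>M lborel)) borel (\<lambda>(x, y, z). v3 x y z)) (box l u)
      = ennreal (\<Prod>b\<in>Basis. (u - l) \<bullet> b)" by simp
qed simp

lemma nn_integral_v3:
  assumes [measurable]: "G \<in> borel_measurable (borel :: (real^3) measure)"
  shows "(\<integral>\<^sup>+p. G p \<partial>lborel) = (\<integral>\<^sup>+x. \<integral>\<^sup>+y. \<integral>\<^sup>+z. G (v3 x y z) \<partial>lborel \<partial>lborel \<partial>lborel)"
proof -
  note [measurable] = v3_measurable
  have "(\<integral>\<^sup>+p. G p \<partial>lborel) = (\<integral>\<^sup>+w. G (case w of (x, y, z) \<Rightarrow> v3 x y z) \<partial>(lborel \<Otimes>\<^sub>M (lborel \<Otimes>\<^sub>M lborel)))"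
    by (subst lborel_v3, subst nn_integral_distr) auto
  also have "\<dots> = (\<integral>\<^sup>+x. \<integral>\<^sup>+w. G (case (x, w) of (x, y, z) \<Rightarrow> v3 x y z) \<partial>(lborel \<Otimes>\<^sub>M lborel) \<partial>lborel)"
    by (rule sigma_finite_measure.nn_integral_fst[OF sigma_finite_lborel2, symmetric]) measurable
  also have "\<dots> = (\<integral>\<^sup>+x. \<integral>\<^sup>+y. \<integral>\<^sup>+z. G (v3 x y z) \<partial>lborel \<partial>lborel \<partial>lborel)"
    by (intro nn_integral_cong, subst lborel.nn_integral_fst[symmetric]) auto
  finally show ?thesis .
qed

text \<open>Cauchy--Schwarz in \<open>z\<close>, then in \<open>(x, y)\<close>.\<close>

lemma Loomis_Whitney:
  fixes f g h :: "real \<times> real \<Rightarrow> ennreal"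
  assumes [measurable]: "f \<in> borel_measurable (lborel \<Otimes>\<^sub>M lborel)"
    "g \<in> borel_measurable (lborel \<Otimes>\<^sub>M lborel)" "h \<in> borel_measurable (lborel \<Otimes>\<^sub>M lborel)"
  shows "(\<integral>\<^sup>+x. \<integral>\<^sup>+y. \<integral>\<^sup>+z. f (y, z) * g (x, z) * h (x, y) \<partial>lborel \<partial>lborel \<partial>lborel)\<^sup>2
    \<le> (\<integral>\<^sup>+y. \<integral>\<^sup>+z. (f (y, z))\<^sup>2 \<partial>lborel \<partial>lborel) * (\<integral>\<^sup>+x. \<integral>\<^sup>+z. (g (x, z))\<^sup>2 \<partial>lborel \<partial>lborel)
      * (\<integral>\<^sup>+x. \<integral>\<^sup>+y. (h (x, y))\<^sup>2 \<partial>lborel \<partial>lborel)"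
proof -
  define k where "k w = (\<integral>\<^sup>+z. f (snd w, z) * g (fst w, z) \<partial>lborel)" for w
  have [measurable]: "k \<in> borel_measurable (lborel \<Otimes>\<^sub>M lborel)"
    unfolding k_def by measurable
  have "(\<integral>\<^sup>+x. \<integral>\<^sup>+y. \<integral>\<^sup>+z. f (y, z) * g (x, z) * h (x, y) \<partial>lborel \<partial>lborel \<partial>lborel)
      = (\<integral>\<^sup>+x. \<integral>\<^sup>+y. k (x, y) * h (x, y) \<partial>lborel \<partial>lborel)"
    unfolding k_def by (intro nn_integral_cong, subst nn_integral_multc) auto
  also have "\<dots> = (\<integral>\<^sup>+w. k w * h w \<partial>(lborel \<Otimes>\<^sub>M lborel))"
    by (subst lborel.nn_integral_fst[symmetric]) auto
  also have "\<dots>\<^sup>2 \<le> (\<integral>\<^sup>+w. (k w)\<^sup>2 \<partial>(lborel \<Otimes>\<^sub>M lborel)) * (\<integral>\<^sup>+w. (h w)\<^sup>2 \<partial>(lborel \<Otimes>\<^sub>M lborel))"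
    by (rule Cauchy_Schwarz_nn_integral) measurable
  also have "(\<integral>\<^sup>+w. (h w)\<^sup>2 \<partial>(lborel \<Otimes>\<^sub>M lborel)) = (\<integral>\<^sup>+x. \<integral>\<^sup>+y. (h (x, y))\<^sup>2 \<partial>lborel \<partial>lborel)"
    by (subst lborel.nn_integral_fst[symmetric]) auto
  also have "(\<integral>\<^sup>+w. (k w)\<^sup>2 \<partial>(lborel \<Otimes>\<^sub>M lborel)) = (\<integral>\<^sup>+x. \<integral>\<^sup>+y. (k (x, y))\<^sup>2 \<partial>lborel \<partial>lborel)"
    by (subst lborel.nn_integral_fst[symmetric]) auto
  also have "\<dots> \<le> (\<integral>\<^sup>+x. \<integral>\<^sup>+y. (\<integral>\<^sup>+z. (f (y, z))\<^sup>2 \<partial>lborel) * (\<integral>\<^sup>+z. (g (x, z))\<^sup>2 \<partial>lborel) \<partial>lborel \<partial>lborel)"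
    unfolding k_def fst_conv snd_conv by (intro nn_integral_mono Cauchy_Schwarz_nn_integral) auto
  also have "\<dots> = (\<integral>\<^sup>+x. (\<integral>\<^sup>+y. \<integral>\<^sup>+z. (f (y, z))\<^sup>2 \<partial>lborel \<partial>lborel) * (\<integral>\<^sup>+z. (g (x, z))\<^sup>2 \<partial>lborel) \<partial>lborel)"
    by (intro nn_integral_cong nn_integral_multc) measurable
  also have "\<dots> = (\<integral>\<^sup>+y. \<integral>\<^sup>+z. (f (y, z))\<^sup>2 \<partial>lborel \<partial>lborel) * (\<integral>\<^sup>+x. \<integral>\<^sup>+z. (g (x, z))\<^sup>2 \<partial>lborel \<partial>lborel)"
    by (intro nn_integral_cmult) measurable
  finally show ?thesis by (simp add: mult_right_mono)
qed

section \<open>Line integrals of derivatives and the endpoint Sobolev inequality\<close>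

lemma test_function_line_support:
  fixes e :: "real^3"
  assumes "w \<in> test_functions \<Omega>" "e \<noteq> 0"
  obtains T where "0 < T" "\<And>t. T < \<bar>t\<bar> \<Longrightarrow> w (q + t *\<^sub>R e) = 0"
    "\<And>t v. T < \<bar>t\<bar> \<Longrightarrow> frechet_derivative w (at (q + t *\<^sub>R e)) v = 0"
proof -
  obtain K where K: "compact K" "\<And>x. x \<notin> K \<Longrightarrow> w x = 0"
    "\<And>x v. x \<notin> K \<Longrightarrow> frechet_derivative w (at x) v = 0"
    using test_function_support[OF assms(1)] by metis
  obtain R where R: "0 < R" "\<And>x. x \<in> K \<Longrightarrow> norm x \<le> R"
    using K(1) compact_imp_bounded bounded_pos by metis
  define T where "T = (R + norm q) / norm e"
  have T: "0 < T" using R(1) assms(2) by (auto simp: T_def intro!: divide_pos_pos add_pos_nonneg)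
  have nK: "q + t *\<^sub>R e \<notin> K" if "T < \<bar>t\<bar>" for t
  proof
    assume "q + t *\<^sub>R e \<in> K"
    then have "norm (q + t *\<^sub>R e) \<le> R" by (rule R)
    moreover have "norm (t *\<^sub>R e) \<le> norm (q + t *\<^sub>R e) + norm q"
      using norm_triangle_ineq4[of "q + t *\<^sub>R e" q] by simp
    moreover have "R + norm q < \<bar>t\<bar> * norm e"
      using that assms(2) by (simp add: T_def divide_simps)
    ultimately show False by simp
  qed
  show thesis using that[OF T] nK K(2,3) by blast
qed

lemma test_function_line_cont:
  assumes "w \<in> test_functions \<Omega>"
  shows "continuous_on UNIV (\<lambda>t. frechet_derivative w (at (q + t *\<^sub>R e)) v)"
  by (rule continuous_on_compose2[OF test_function_continuous[OF test_function_deriv[OF assms, of v]]])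
    (auto intro!: continuous_intros)

text \<open>The fundamental theorem of calculus along the line, started at a point beyond the
  support.\<close>

lemma test_function_line_bound:
  fixes e :: "real^3"
  assumes w: "w \<in> test_functions \<Omega>" and e: "e \<noteq> 0"
  shows "ennreal \<bar>w (q + s *\<^sub>R e)\<bar> \<le> (\<integral>\<^sup>+t. ennreal \<bar>frechet_derivative w (at (q + t *\<^sub>R e)) e\<bar> \<partial>lborel)"
    (is "_ \<le> nn_integral lborel ?g")
proof -
  obtain T where T: "0 < T" "\<And>t. T < \<bar>t\<bar> \<Longrightarrow> w (q + t *\<^sub>R e) = 0"
    using test_function_line_support[OF w e] by metis
  \<comment> \<open>A starting parameter to the left of \<open>s\<close> and with modulus above
    \<open>T\<close>, so that \<open>w\<close> vanishes there.\<close>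
  define a where "a = - (T + \<bar>s\<bar>) - 1"
  have a: "a \<le> s" "T < \<bar>a\<bar>" using T(1) by (auto simp: a_def)
  let ?f = "\<lambda>t. frechet_derivative w (at (q + t *\<^sub>R e)) e"
  have c: "isCont ?f t" for t
    using test_function_line_cont[OF w] by (simp add: continuous_on_eq_continuous_within)
  have "(\<integral>t. ?f t * indicator {a..s} t \<partial>lborel) = w (q + s *\<^sub>R e) - w (q + a *\<^sub>R e)"
    by (rule integral_FTC_Icc_real[OF a(1)]) (use test_function_line_deriv[OF w] c in auto)
  then have eq: "w (q + s *\<^sub>R e) = (\<integral>t. indicator {a..s} t *\<^sub>R ?f t \<partial>lborel)"
    using T(2)[OF a(2)] by (simp add: mult.commute)
  have "integrable lborel (\<lambda>t. indicator {a..s} t *\<^sub>R ?f t)"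
    using borel_integrable_atLeastAtMost'[of a s ?f] continuous_on_subset[OF test_function_line_cont[OF w]]
    by (simp add: set_integrable_def)
  then have "ennreal (norm (w (q + s *\<^sub>R e))) \<le> (\<integral>\<^sup>+t. ennreal (norm (indicator {a..s} t *\<^sub>R ?f t)) \<partial>lborel)"
    unfolding eq by (rule integral_norm_bound_ennreal)
  also have "\<dots> \<le> nn_integral lborel ?g"
    by (intro nn_integral_mono ennreal_leI) (auto simp: indicator_def)
  finally show ?thesis by simp
qed

text \<open>Finiteness is what allows real square roots of the line integrals to be taken in
  \<open>Gagliardo_Nirenberg\<close>.\<close>

lemma test_function_line_finite:
  fixes e :: "real^3"
  assumes w: "w \<in> test_functions \<Omega>" and e: "e \<noteq> 0"
  shows "(\<integral>\<^sup>+t. ennreal \<bar>frechet_derivative w (at (q + t *\<^sub>R e)) e\<bar> \<partial>lborel) < \<infinity>"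
proof -
  obtain T where T: "0 < T" "\<And>t v. T < \<bar>t\<bar> \<Longrightarrow> frechet_derivative w (at (q + t *\<^sub>R e)) v = 0"
    using test_function_line_support[OF w e] by metis
  obtain B where B: "\<And>x. \<bar>frechet_derivative w (at x) e\<bar> \<le> B"
    using test_function_bounded[OF test_function_deriv[OF w]] by metis
  have "(\<integral>\<^sup>+t. ennreal \<bar>frechet_derivative w (at (q + t *\<^sub>R e)) e\<bar> \<partial>lborel)
      \<le> (\<integral>\<^sup>+t. ennreal B * indicator {-T..T} t \<partial>lborel)"
  proof (rule nn_integral_mono)
    fix t
    show "ennreal \<bar>frechet_derivative w (at (q + t *\<^sub>R e)) e\<bar> \<le> ennreal B * indicator {-T..T} t"
      using B[of "q + t *\<^sub>R e"] T(2)[of t e] by (cases "\<bar>t\<bar> \<le> T") (auto simp: abs_le_iff ennreal_leI)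
  qed
  also have "\<dots> < \<infinity>" using T(1)
    by (simp add: nn_integral_cmult ennreal_mult_less_top)
  finally show ?thesis .
qed

text \<open>The modulus of \<open>w\<close> is bounded by each of the three line integrals of its
  partial derivatives, hence its power 3/2 by the product of their square roots. Each factor is
  independent of one coordinate, which is the form of \<open>Loomis_Whitney\<close>.\<close>

lemma Gagliardo_Nirenberg:
  assumes w: "w \<in> test_functions \<Omega>"
  shows "(\<integral>\<^sup>+p. ennreal (sqrt (\<bar>w p\<bar> ^ 3)) \<partial>lborel)\<^sup>2
    \<le> (\<Prod>i\<in>UNIV. \<integral>\<^sup>+p. ennreal \<bar>frechet_derivative w (at p) (axis i 1)\<bar> \<partial>lborel)"
proof -
  define G where "G i p = ennreal \<bar>frechet_derivative w (at p) (axis i 1)\<bar>" for i p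
  have [measurable]: "G i \<in> borel_measurable borel" for i
    using test_function_borel[OF test_function_deriv[OF w]] unfolding G_def by measurable
  have [measurable]: "w \<in> borel_measurable borel" using test_function_borel[OF w] .
  have nz: "axis i 1 \<noteq> (0::real^3)" for i by (simp add: axis_eq_0_iff)
  define F1 where "F1 = (\<lambda>(y, z). \<integral>\<^sup>+x. G 1 (v3 x y z) \<partial>lborel)"
  define F2 where "F2 = (\<lambda>(x, z). \<integral>\<^sup>+y. G 2 (v3 x y z) \<partial>lborel)"
  define F3 where "F3 = (\<lambda>(x, y). \<integral>\<^sup>+z. G 3 (v3 x y z) \<partial>lborel)"
  have [measurable]: "F1 \<in> borel_measurable (lborel \<Otimes>\<^sub>M lborel)" "F2 \<in> borel_measurable (lborel \<Otimes>\<^sub>M lborel)"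
    "F3 \<in> borel_measurable (lborel \<Otimes>\<^sub>M lborel)"
    unfolding F1_def F2_def F3_def v3_def by measurable
  have v: "v3 x y z = v3 0 y z + x *\<^sub>R axis 1 1" "v3 x y z = v3 x 0 z + y *\<^sub>R axis 2 1"
    "v3 x y z = v3 x y 0 + z *\<^sub>R axis 3 1" for x y z
    by (simp_all add: v3_def)
  have b: "ennreal \<bar>w (v3 x y z)\<bar> \<le> F1 (y, z)" "ennreal \<bar>w (v3 x y z)\<bar> \<le> F2 (x, z)"
    "ennreal \<bar>w (v3 x y z)\<bar> \<le> F3 (x, y)" for x y z
    using test_function_line_bound[OF w nz[of 1], of "v3 0 y z" x]
      test_function_line_bound[OF w nz[of 2], of "v3 x 0 z" y]
      test_function_line_bound[OF w nz[of 3], of "v3 x y 0" z]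
    by (simp_all add: F1_def F2_def F3_def G_def flip: v)
  have fin: "F1 u < \<infinity>" "F2 u < \<infinity>" "F3 u < \<infinity>" for u
    using test_function_line_finite[OF w nz[of 1], of "v3 0 (fst u) (snd u)"]
      test_function_line_finite[OF w nz[of 2], of "v3 (fst u) 0 (snd u)"]
      test_function_line_finite[OF w nz[of 3], of "v3 (fst u) (snd u) 0"]
    by (simp_all add: F1_def F2_def F3_def G_def case_prod_beta flip: v)
  \<comment> \<open>A square root of the extended value, taken in the reals; squaring it gives
    \<open>F\<close> back only where \<open>F\<close> is finite.\<close>
  define r where "r F u = ennreal (sqrt (enn2real (F u)))" for F :: "real \<times> real \<Rightarrow> ennreal" and u
  have [measurable]: "r F \<in> borel_measurable (lborel \<Otimes>\<^sub>M lborel)"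
    if [measurable]: "F \<in> borel_measurable (lborel \<Otimes>\<^sub>M lborel)" for F
    unfolding r_def by measurable
  have r2: "(r F u)\<^sup>2 = F u" if "F u < \<infinity>" for F u
    using that by (simp add: r_def ennreal_power ennreal_enn2real)
  have pt: "ennreal (sqrt (\<bar>w (v3 x y z)\<bar> ^ 3)) \<le> r F1 (y, z) * r F2 (x, z) * r F3 (x, y)" for x y z
  proof -
    let ?a = "\<bar>w (v3 x y z)\<bar>"
    have c: "ennreal (sqrt ?a) \<le> r F u" if "ennreal ?a \<le> F u" "F u < \<infinity>" for F u
      using that enn2real_mono[OF that(1)] by (auto simp: r_def intro!: ennreal_leI)
    have "ennreal (sqrt (?a ^ 3)) = ennreal (sqrt ?a) * ennreal (sqrt ?a) * ennreal (sqrt ?a)"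
      by (simp only: power3_eq_cube real_sqrt_mult ennreal_mult real_sqrt_ge_zero abs_ge_zero mult_nonneg_nonneg)
    also have "\<dots> \<le> r F1 (y, z) * r F2 (x, z) * r F3 (x, y)"
      using b[of x y z] fin by (intro mult_mono c) auto
    finally show ?thesis .
  qed
  have "(\<integral>\<^sup>+p. ennreal (sqrt (\<bar>w p\<bar> ^ 3)) \<partial>lborel)
      = (\<integral>\<^sup>+x. \<integral>\<^sup>+y. \<integral>\<^sup>+z. ennreal (sqrt (\<bar>w (v3 x y z)\<bar> ^ 3)) \<partial>lborel \<partial>lborel \<partial>lborel)"
    by (rule nn_integral_v3) measurable
  also have "\<dots> \<le> (\<integral>\<^sup>+x. \<integral>\<^sup>+y. \<integral>\<^sup>+z. r F1 (y, z) * r F2 (x, z) * r F3 (x, y) \<partial>lborel \<partial>lborel \<partial>lborel)"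
    by (intro nn_integral_mono pt)
  finally have "(\<integral>\<^sup>+p. ennreal (sqrt (\<bar>w p\<bar> ^ 3)) \<partial>lborel)\<^sup>2
      \<le> (\<integral>\<^sup>+x. \<integral>\<^sup>+y. \<integral>\<^sup>+z. r F1 (y, z) * r F2 (x, z) * r F3 (x, y) \<partial>lborel \<partial>lborel \<partial>lborel)\<^sup>2"
    by (rule power_mono) simp
  also have "\<dots> \<le> (\<integral>\<^sup>+y. \<integral>\<^sup>+z. (r F1 (y, z))\<^sup>2 \<partial>lborel \<partial>lborel) * (\<integral>\<^sup>+x. \<integral>\<^sup>+z. (r F2 (x, z))\<^sup>2 \<partial>lborel \<partial>lborel)
      * (\<integral>\<^sup>+x. \<integral>\<^sup>+y. (r F3 (x, y))\<^sup>2 \<partial>lborel \<partial>lborel)"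
    by (rule Loomis_Whitney) measurable
  also have "\<dots> = (\<integral>\<^sup>+y. \<integral>\<^sup>+z. F1 (y, z) \<partial>lborel \<partial>lborel) * (\<integral>\<^sup>+x. \<integral>\<^sup>+z. F2 (x, z) \<partial>lborel \<partial>lborel)
      * (\<integral>\<^sup>+x. \<integral>\<^sup>+y. F3 (x, y) \<partial>lborel \<partial>lborel)"
    using fin by (simp add: r2)
  also have "(\<integral>\<^sup>+x. \<integral>\<^sup>+y. F3 (x, y) \<partial>lborel \<partial>lborel) = (\<integral>\<^sup>+p. G 3 p \<partial>lborel)"
    by (simp add: F3_def nn_integral_v3)
  also have "(\<integral>\<^sup>+x. \<integral>\<^sup>+z. F2 (x, z) \<partial>lborel \<partial>lborel) = (\<integral>\<^sup>+p. G 2 p \<partial>lborel)"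
  proof -
    have "(\<integral>\<^sup>+z. \<integral>\<^sup>+y. G 2 (v3 x y z) \<partial>lborel \<partial>lborel) = (\<integral>\<^sup>+y. \<integral>\<^sup>+z. G 2 (v3 x y z) \<partial>lborel \<partial>lborel)" for x
      by (rule lborel_pair.Fubini') (unfold v3_def, measurable)
    then show ?thesis by (simp add: F2_def nn_integral_v3[of "G 2"])
  qed
  also have "(\<integral>\<^sup>+y. \<integral>\<^sup>+z. F1 (y, z) \<partial>lborel \<partial>lborel) = (\<integral>\<^sup>+p. G 1 p \<partial>lborel)"
  proof -
    have zx: "(\<integral>\<^sup>+z. \<integral>\<^sup>+x. G 1 (v3 x y z) \<partial>lborel \<partial>lborel) = (\<integral>\<^sup>+x. \<integral>\<^sup>+z. G 1 (v3 x y z) \<partial>lborel \<partial>lborel)" for y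
      by (rule lborel_pair.Fubini') (unfold v3_def, measurable)
    have yx: "(\<integral>\<^sup>+y. \<integral>\<^sup>+x. \<integral>\<^sup>+z. G 1 (v3 x y z) \<partial>lborel \<partial>lborel \<partial>lborel)
        = (\<integral>\<^sup>+x. \<integral>\<^sup>+y. \<integral>\<^sup>+z. G 1 (v3 x y z) \<partial>lborel \<partial>lborel \<partial>lborel)"
      by (rule lborel_pair.Fubini') (unfold v3_def, measurable)
    show ?thesis unfolding F1_def case_prod_conv zx yx by (rule nn_integral_v3[symmetric]) measurable
  qed
  finally show ?thesis unfolding UNIV_3 G_def by (simp add: mult.assoc)
qed

lemma N_sq_integral: "f \<in> L2 N \<Longrightarrow> (L2.N N f)\<^sup>2 = (\<integral>x. (f x)\<^sup>2 \<partial>N)"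
  by (simp add: L2.N_sq ip_def flip: power2_eq_square)

section \<open>The Sobolev inequality on \<open>H10\<close> and the embeddings that follow from
  it\<close>

context bounded_open
begin

lemma test_zero_outside: "\<phi> \<in> test_functions \<Omega> \<Longrightarrow> x \<notin> \<Omega> \<Longrightarrow> \<phi> x = 0"
  using test_function_support[of \<phi> \<Omega>] by (metis subsetD)

lemma nn_integral_lborel_test:
  assumes "\<phi> \<in> test_functions \<Omega>"
  shows "(\<integral>\<^sup>+x. ennreal \<bar>\<phi> x\<bar> \<partial>lborel) = ennreal (\<integral>x. \<bar>\<phi> x\<bar> \<partial>M)"
proof -
  have "(\<integral>\<^sup>+x. ennreal \<bar>\<phi> x\<bar> \<partial>lborel) = ennreal (\<integral>x. \<bar>\<phi> x\<bar> \<partial>lborel)"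
    using test_function_integrable_lborel[OF assms] by (intro nn_integral_eq_integral) auto
  also have "(\<integral>x. \<bar>\<phi> x\<bar> \<partial>lborel) = (\<integral>x. \<bar>\<phi> x\<bar> \<partial>M)"
    using test_function_borel[OF assms] test_zero_outside[OF assms]
    by (intro integral_UNIV_eq[symmetric]) auto
  finally show ?thesis .
qed

lemma N_test_deriv:
  assumes "\<phi> \<in> test_functions \<Omega>"
  shows "L2.N M (\<lambda>x. frechet_derivative \<phi> (at x) (axis i 1)) = L2.N M (weak_partial \<Omega> i \<phi>)"
  using test_H1[OF assms] test_L2[OF test_function_deriv[OF assms]]
  by (intro N_AE_cong partial_measurable L2_measurable) (auto simp: eq_commute)

text \<open>The endpoint inequality is applied to the fourth power of \<open>\<phi>\<close>: its
  power 3/2 is the sixth power of \<open>\<phi>\<close>, and its partial derivatives are 4 times the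
  cube of \<open>\<phi>\<close> times those of \<open>\<phi>\<close>. Cauchy--Schwarz then gives
  \<open>s ^ 4 \<le> (4 * s * d) ^ 3\<close>, and cancelling \<open>s ^ 3\<close> leaves the
  constant 64.\<close>

lemma Sobolev_test:
  assumes \<phi>: "\<phi> \<in> test_functions \<Omega>"
  shows "L2.N M (\<lambda>x. \<phi> x ^ 3) \<le> 64 * D.N \<phi> ^ 3"
proof -
  have \<phi>3: "(\<lambda>x. \<phi> x ^ 3) \<in> test_functions \<Omega>"
    using test_function_mult[OF test_function_mult[OF \<phi> \<phi>] \<phi>] by (simp add: power3_eq_cube)
  have \<phi>6: "(\<lambda>x. \<phi> x ^ 3 * \<phi> x ^ 3) \<in> test_functions \<Omega>"
    by (rule test_function_mult[OF \<phi>3 \<phi>3])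
  define w where "w = (\<lambda>x. \<phi> x ^ 4)"
  have w: "w \<in> test_functions \<Omega>"
    using test_function_mult[OF \<phi>3 \<phi>] by (simp add: w_def numeral_eq_Suc mult.commute mult.left_commute)
  define s where "s = L2.N M (\<lambda>x. \<phi> x ^ 3)"
  define d where "d = D.N \<phi>"
  have s0: "0 \<le> s" and d0: "0 \<le> d"
    unfolding s_def d_def using L2.N_nonneg[OF test_L2[OF \<phi>3]] D.N_nonneg[OF test_H1(1)[OF \<phi>]] by auto
  have l: "(\<integral>\<^sup>+p. ennreal (sqrt (\<bar>w p\<bar> ^ 3)) \<partial>lborel) = ennreal (s\<^sup>2)"
  proof -
    have "sqrt (\<bar>w p\<bar> ^ 3) = \<bar>\<phi> p ^ 3 * \<phi> p ^ 3\<bar>" for p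
      by (rule real_sqrt_unique) (auto simp: w_def abs_mult power_abs simp flip: power_mult power_add)
    then have "(\<integral>\<^sup>+p. ennreal (sqrt (\<bar>w p\<bar> ^ 3)) \<partial>lborel) = ennreal (\<integral>x. \<bar>\<phi> x ^ 3 * \<phi> x ^ 3\<bar> \<partial>M)"
      using nn_integral_lborel_test[OF \<phi>6] by simp
    also have "(\<integral>x. \<bar>\<phi> x ^ 3 * \<phi> x ^ 3\<bar> \<partial>M) = s\<^sup>2"
      unfolding s_def L2.N_sq[OF test_L2[OF \<phi>3]] ip_def by (simp flip: power2_eq_square)
    finally show ?thesis .
  qed
  have r: "(\<integral>\<^sup>+p. ennreal \<bar>frechet_derivative w (at p) (axis i 1)\<bar> \<partial>lborel) \<le> ennreal (4 * s * d)" for i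
  proof -
    let ?e = "axis i 1 :: real^3"
    have D: "frechet_derivative w (at x) ?e = 4 * (\<phi> x ^ 3 * frechet_derivative \<phi> (at x) ?e)" for x
    proof -
      have "(w has_derivative (\<lambda>v. of_nat 4 * frechet_derivative \<phi> (at x) v * \<phi> x ^ (4 - 1))) (at x)"
        unfolding w_def by (rule has_derivative_power[OF test_function_differentiable[OF \<phi>]])
      from frechet_derivative_at[OF this, symmetric] show ?thesis by simp
    qed
    have a: "(\<lambda>x. \<bar>\<phi> x ^ 3\<bar>) \<in> L2 M" "(\<lambda>x. \<bar>frechet_derivative \<phi> (at x) ?e\<bar>) \<in> L2 M"
      using test_L2[OF \<phi>3] test_L2[OF test_function_deriv[OF \<phi>, of ?e]] by (auto simp: L2_def)
    have "(\<integral>x. \<bar>frechet_derivative w (at x) ?e\<bar> \<partial>M)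
        = 4 * ip M (\<lambda>x. \<bar>\<phi> x ^ 3\<bar>) (\<lambda>x. \<bar>frechet_derivative \<phi> (at x) ?e\<bar>)"
      by (simp add: D ip_def abs_mult)
    also have "\<dots> \<le> 4 * (L2.N M (\<lambda>x. \<bar>\<phi> x ^ 3\<bar>) * L2.N M (\<lambda>x. \<bar>frechet_derivative \<phi> (at x) ?e\<bar>))"
      using L2.Cauchy_Schwarz[OF a] by simp
    also have "\<dots> = 4 * (s * L2.N M (\<lambda>x. frechet_derivative \<phi> (at x) ?e))"
      by (simp add: s_def L2.N_def ip_def)
    also have "\<dots> \<le> 4 * (s * d)"
      unfolding d_def N_test_deriv[OF \<phi>] using N_partial_le[OF test_H1(1)[OF \<phi>]] s0
      by (intro mult_left_mono) auto
    finally show ?thesis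
      by (simp add: nn_integral_lborel_test[OF test_function_deriv[OF w]] ennreal_leI mult.assoc)
  qed
  have "ennreal ((s\<^sup>2)\<^sup>2) \<le> (\<Prod>i\<in>(UNIV::3 set). ennreal (4 * s * d))"
  proof -
    have "ennreal ((s\<^sup>2)\<^sup>2)
        \<le> (\<Prod>i\<in>UNIV. \<integral>\<^sup>+p. ennreal \<bar>frechet_derivative w (at p) (axis i 1)\<bar> \<partial>lborel)"
      using Gagliardo_Nirenberg[OF w] unfolding l by (simp add: ennreal_power)
    also have "\<dots> \<le> (\<Prod>i\<in>(UNIV::3 set). ennreal (4 * s * d))"
      unfolding UNIV_3 using r by (auto intro!: mult_mono)
    finally show ?thesis .
  qed
  also have "\<dots> = ennreal ((4 * s * d) ^ 3)"
    using s0 d0 by (simp add: ennreal_power)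
  finally have "(s\<^sup>2)\<^sup>2 \<le> (4 * s * d) ^ 3"
    using s0 d0 by (subst (asm) ennreal_le_iff) auto
  then have le: "s ^ 3 * s \<le> s ^ 3 * (64 * d ^ 3)"
    by (simp add: power_mult_distrib power_numeral_reduce numeral_eq_Suc algebra_simps)
  have "s \<le> 64 * d ^ 3"
  proof (cases "s = 0")
    case False
    then have "0 < s ^ 3" using s0 by simp
    then show ?thesis using le mult_le_cancel_left_pos by blast
  qed (use d0 in simp)
  then show ?thesis by (simp add: s_def d_def)
qed

text \<open>Approximating test functions converge almost everywhere along a subsequence, so Fatou's
  lemma carries over both the integrability and the bound.\<close>

lemma Sobolev:
  assumes u: "u \<in> H10 \<Omega>"
  shows "(\<lambda>x. u x ^ 3) \<in> L2 M" "L2.N M (\<lambda>x. u x ^ 3) \<le> 64 * D.N u ^ 3"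
proof -
  obtain \<phi> where \<phi>: "\<And>n::nat. \<phi> n \<in> test_functions \<Omega>"
    "(\<lambda>n. L2.N M (\<lambda>x. \<phi> n x - u x)) \<longlonglongrightarrow> 0" "(\<lambda>n. D.N (\<lambda>x. \<phi> n x - u x)) \<longlonglongrightarrow> 0"
    using H10_approx[OF u] by blast
  have uH: "u \<in> H1 \<Omega>" using u H10_H1 by auto
  obtain r :: "nat \<Rightarrow> nat" where r: "strict_mono r" "AE x in M. (\<lambda>n. \<phi> (r n) x) \<longlonglongrightarrow> u x"
    using L2_tendsto_AE_subseq[OF finite_measure_M test_L2[OF \<phi>(1)] H1_L2[OF uH] \<phi>(2)] by blast
  have lim: "(\<lambda>n. D.N (\<phi> (r n))) \<longlonglongrightarrow> D.N u"
    using D.tendsto_N[of \<phi> sequentially u] \<phi>(1,3) test_H1 uH LIMSEQ_subseq_LIMSEQ[OF _ r(1), of "\<lambda>n. D.N (\<phi> n)"]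
    by (simp add: o_def)
  have lim': "(\<lambda>n. 64 * D.N (\<phi> (r n)) ^ 3) \<longlonglongrightarrow> 64 * D.N u ^ 3"
    by (intro tendsto_intros lim)
  have t3: "(\<lambda>x. \<phi> n x ^ 3) \<in> L2 M" for n
    using test_L2[OF test_function_mult[OF test_function_mult[OF \<phi>(1) \<phi>(1)] \<phi>(1)], of n n n]
    by (simp add: power3_eq_cube)
  have m: "(\<lambda>x. u x ^ 3) \<in> borel_measurable M"
    using L2_measurable[OF H1_L2[OF uH]] by measurable
  have conv: "AE x in M. (\<lambda>n. \<phi> (r n) x ^ 3) \<longlonglongrightarrow> u x ^ 3"
    using r(2) by eventually_elim (intro tendsto_intros)
  \<comment> \<open>The approximants obey a bound \<open>C\<close> eventually only if
    \<open>C\<close> lies strictly above the limit; the sharp constant is recovered by letting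
    \<open>C\<close> decrease.\<close>
  have *: "(\<lambda>x. u x ^ 3) \<in> L2 M \<and> L2.N M (\<lambda>x. u x ^ 3) \<le> C" if "64 * D.N u ^ 3 < C" for C
  proof -
    have "\<forall>\<^sub>F n in sequentially. L2.N M (\<lambda>x. \<phi> (r n) x ^ 3) \<le> C"
      using order_tendstoD(2)[OF lim' that]
      by eventually_elim (use Sobolev_test[OF \<phi>(1)] in \<open>meson less_imp_le order_trans\<close>)
    from Fatou_N[of "\<lambda>n x. \<phi> (r n) x ^ 3", OF t3 m conv this] show ?thesis by blast
  qed
  show "(\<lambda>x. u x ^ 3) \<in> L2 M" using *[of "64 * D.N u ^ 3 + 1"] by simp
  show "L2.N M (\<lambda>x. u x ^ 3) \<le> 64 * D.N u ^ 3" using * by (meson dense_ge)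
qed

text \<open>For Dirichlet norm 1, \<open>\<bar>s\<bar>\<^sup>r \<le> 1 + s\<^sup>6\<close> bounds the integral by \<open>\<bar>\<Omega>\<bar> + 64\<^sup>2\<close>; the general case is
  homogeneity.\<close>

definition embed_const :: real where
  "embed_const = measure M (space M) + 4096"

lemma embed_const_pos: "0 < embed_const"
  by (simp add: embed_const_def add_nonneg_pos)

lemma H10_scale: "u \<in> H10 \<Omega> \<Longrightarrow> (\<lambda>x. c * u x) \<in> H10 \<Omega>"
  using H10_lin[of u u c 0] by simp

lemma H10_diff: "u \<in> H10 \<Omega> \<Longrightarrow> v \<in> H10 \<Omega> \<Longrightarrow> (\<lambda>x. u x - v x) \<in> H10 \<Omega>"
  using H10_lin[of u v 1 "-1"] by simp

lemma Lr_embedding: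
  assumes u: "u \<in> H10 \<Omega>" and r: "0 < r" "r \<le> 6"
  shows "integrable M (\<lambda>x. \<bar>u x\<bar> powr r)" "(\<integral>x. \<bar>u x\<bar> powr r \<partial>M) \<le> embed_const * D.N u powr r"
proof -
  interpret finite_measure M by (rule finite_measure_M)
  have uH: "v \<in> H1 \<Omega>" if "v \<in> H10 \<Omega>" for v using that H10_H1 by auto
  have b: "\<bar>a\<bar> powr r \<le> 1 + (a ^ 3)\<^sup>2" for a :: real
  proof (cases "\<bar>a\<bar> \<le> 1")
    case True
    then have "\<bar>a\<bar> powr r \<le> 1 powr r" using r by (intro powr_mono2) auto
    then show ?thesis by (smt (verit) powr_one_eq_one zero_le_power2)
  next
    case False
    then have "\<bar>a\<bar> powr r \<le> \<bar>a\<bar> powr 6" using r by (intro powr_mono) auto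
    also have "\<dots> = (a ^ 3)\<^sup>2" using False by (simp add: power_mult[symmetric] power_even_abs)
    finally show ?thesis by simp
  qed
  have int: "integrable M (\<lambda>x. \<bar>v x\<bar> powr r)" "(\<integral>x. \<bar>v x\<bar> powr r \<partial>M) \<le> measure M (space M) + (64 * D.N v ^ 3)\<^sup>2"
    if v: "v \<in> H10 \<Omega>" for v
  proof -
    have [measurable]: "v \<in> borel_measurable M" using L2_measurable[OF H1_L2[OF uH[OF v]]] .
    have i: "integrable M (\<lambda>x. 1 + (v x ^ 3)\<^sup>2)" using L2_integrable_sq[OF Sobolev(1)[OF v]] by simp
    show 1: "integrable M (\<lambda>x. \<bar>v x\<bar> powr r)"
      by (rule Bochner_Integration.integrable_bound[OF i]) (use b in auto)
    have "(\<integral>x. \<bar>v x\<bar> powr r \<partial>M) \<le> (\<integral>x. 1 + (v x ^ 3)\<^sup>2 \<partial>M)"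
      by (rule integral_mono[OF 1 i]) (rule b)
    also have "\<dots> = measure M (space M) + (L2.N M (\<lambda>x. v x ^ 3))\<^sup>2"
      using L2_integrable_sq[OF Sobolev(1)[OF v]]
      by (simp add: N_sq_integral[OF Sobolev(1)[OF v]])
    also have "(L2.N M (\<lambda>x. v x ^ 3))\<^sup>2 \<le> (64 * D.N v ^ 3)\<^sup>2"
      using Sobolev[OF v] L2.N_nonneg by (intro power_mono) auto
    finally show "(\<integral>x. \<bar>v x\<bar> powr r \<partial>M) \<le> measure M (space M) + (64 * D.N v ^ 3)\<^sup>2" by simp
  qed
  show "integrable M (\<lambda>x. \<bar>u x\<bar> powr r)" by (rule int(1)[OF u])
  define d where "d = D.N u"
  have d0: "0 \<le> d" using D.N_nonneg[OF uH[OF u]] by (simp add: d_def)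
  show "(\<integral>x. \<bar>u x\<bar> powr r \<partial>M) \<le> embed_const * D.N u powr r"
  proof (cases "d = 0")
    case True
    \<comment> \<open>Normalization is impossible here, but the Sobolev inequality itself makes
      \<open>u\<close> vanish almost everywhere.\<close>
    have "L2.N M (\<lambda>x. u x ^ 3) = 0"
      using Sobolev[OF u] L2.N_nonneg[OF Sobolev(1)[OF u]] True by (simp add: d_def)
    then have "AE x in M. u x ^ 3 = 0" by (rule N_zero_AE[OF Sobolev(1)[OF u]])
    then have "AE x in M. \<bar>u x\<bar> powr r = 0" by eventually_elim auto
    then have "(\<integral>x. \<bar>u x\<bar> powr r \<partial>M) = 0" by (rule integral_eq_zero_AE)
    then show ?thesis using embed_const_pos by simp
  next
    case False
    then have dp: "0 < d" using d0 by simp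
    let ?v = "\<lambda>x. (1 / d) * u x"
    have v: "?v \<in> H10 \<Omega>" by (rule H10_scale[OF u])
    have "D.N ?v = 1" using D.N_scale[OF uH[OF u], of "1 / d"] dp by (simp add: d_def)
    then have "(\<integral>x. \<bar>?v x\<bar> powr r \<partial>M) \<le> embed_const" using int(2)[OF v] by (simp add: embed_const_def)
    moreover have "\<bar>?v x\<bar> powr r = \<bar>u x\<bar> powr r / d powr r" for x
      using dp by (simp add: abs_mult powr_divide)
    ultimately have "(\<integral>x. \<bar>u x\<bar> powr r \<partial>M) / d powr r \<le> embed_const" by simp
    then show ?thesis using dp by (simp add: d_def divide_simps)
  qed
qed

lemma Poincare:
  assumes u: "u \<in> H10 \<Omega>"
  shows "(L2.N M u)\<^sup>2 \<le> embed_const * (D.N u)\<^sup>2"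
proof -
  show ?thesis
    using Lr_embedding(2)[OF u, of 2] D.N_nonneg[OF H10_H1[OF u]]
    by (simp add: N_sq_integral[OF H1_L2[OF H10_H1[OF u]]])
qed

end

section \<open>Rellich compactness\<close>

lemma nn_integral_lborel_translate:
  fixes f :: "'a::euclidean_space \<Rightarrow> ennreal"
  assumes "f \<in> borel_measurable borel"
  shows "(\<integral>\<^sup>+x. f (x + a) \<partial>lborel) = (\<integral>\<^sup>+x. f x \<partial>lborel)"
proof -
  have "(\<integral>\<^sup>+x. f x \<partial>lborel) = (\<integral>\<^sup>+x. f x \<partial>distr lborel borel (\<lambda>x. a + x))"
    by (simp add: lborel_distr_plus)
  also have "\<dots> = (\<integral>\<^sup>+x. f (a + x) \<partial>lborel)"
    using assms by (intro nn_integral_distr) auto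
  finally show ?thesis by (simp add: add.commute)
qed

text \<open>Cauchy--Schwarz against the indicator of \<open>B\<close>. The right-hand side is an
  extended nonnegative integral so that it can be integrated in a further variable and the order
  exchanged.\<close>

lemma sq_integral_le:
  fixes f :: "'a::euclidean_space \<Rightarrow> real"
  assumes B: "compact B" and f: "continuous_on UNIV f"
  shows "ennreal ((\<integral>z. indicator B z * f z \<partial>lborel)\<^sup>2)
    \<le> emeasure lborel B * (\<integral>\<^sup>+z. ennreal ((f z)\<^sup>2) * indicator B z \<partial>lborel)"
proof -
  have [measurable]: "f \<in> borel_measurable borel" using f by (rule borel_measurable_continuous_onI)
  have [measurable]: "B \<in> sets borel" using B by (simp add: borel_compact)
  have "integrable lborel (\<lambda>z. indicator B z *\<^sub>R f z)"
    by (rule borel_integrable_compact[OF B]) (use f continuous_on_subset in auto)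
  then have "ennreal (norm (\<integral>z. indicator B z * f z \<partial>lborel)) \<le> (\<integral>\<^sup>+z. ennreal (norm (indicator B z * f z)) \<partial>lborel)"
    by (intro integral_norm_bound_ennreal) simp
  also have "\<dots> = (\<integral>\<^sup>+z. indicator B z * (ennreal \<bar>f z\<bar> * indicator B z) \<partial>lborel)"
    by (intro nn_integral_cong) (auto simp: indicator_def)
  finally have "(ennreal (norm (\<integral>z. indicator B z * f z \<partial>lborel)))\<^sup>2
      \<le> (\<integral>\<^sup>+z. indicator B z * (ennreal \<bar>f z\<bar> * indicator B z) \<partial>lborel)\<^sup>2"
    by (rule power_mono) simp
  also have "\<dots> \<le> (\<integral>\<^sup>+z. (indicator B z)\<^sup>2 \<partial>lborel) * (\<integral>\<^sup>+z. (ennreal \<bar>f z\<bar> * indicator B z)\<^sup>2 \<partial>lborel)"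
    by (rule Cauchy_Schwarz_nn_integral) measurable
  also have "(\<integral>\<^sup>+z. (indicator B z)\<^sup>2 \<partial>lborel) = (\<integral>\<^sup>+z. indicator B z \<partial>lborel)"
    by (intro nn_integral_cong) (auto simp: indicator_def)
  also have "\<dots> = emeasure lborel B" by simp
  also have "(\<integral>\<^sup>+z. (ennreal \<bar>f z\<bar> * indicator B z)\<^sup>2 \<partial>lborel) = (\<integral>\<^sup>+z. ennreal ((f z)\<^sup>2) * indicator B z \<partial>lborel)"
    by (intro nn_integral_cong) (auto simp: indicator_def ennreal_power)
  finally show ?thesis by (simp add: ennreal_power)
qed

section \<open>Translation estimates and averages over balls\<close>

context bounded_open
begin

lemma nn_integral_sq_test:
  assumes "h \<in> test_functions \<Omega>"
  shows "(\<integral>\<^sup>+x. ennreal ((h x)\<^sup>2) \<partial>lborel) = ennreal ((L2.N M h)\<^sup>2)"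
  using nn_integral_lborel_test[OF test_function_mult[OF assms assms]] N_sq_integral[OF test_L2[OF assms]]
  by (simp flip: power2_eq_square)

text \<open>The directional derivative is the inner product of \<open>z\<close> with the gradient,
  so pointwise Cauchy--Schwarz can be integrated.\<close>

lemma N_sq_dir_deriv_le:
  assumes \<phi>: "\<phi> \<in> test_functions \<Omega>"
  shows "(L2.N M (\<lambda>x. frechet_derivative \<phi> (at x) z))\<^sup>2 \<le> (norm z)\<^sup>2 * (D.N \<phi>)\<^sup>2"
proof -
  define g where "g x = (\<chi> i. frechet_derivative \<phi> (at x) (axis i 1))" for x
  have sq: "(norm (g x))\<^sup>2 = (\<Sum>i\<in>UNIV. (frechet_derivative \<phi> (at x) (axis i 1))\<^sup>2)" for x
    by (simp add: g_def power2_norm_eq_inner inner_vec_def flip: power2_eq_square)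
  have d: "frechet_derivative \<phi> (at x) z = g x \<bullet> z" for x
  proof -
    have lin: "linear (frechet_derivative \<phi> (at x))"
      using test_function_differentiable[OF \<phi>] has_derivative_linear by blast
    have "frechet_derivative \<phi> (at x) z = frechet_derivative \<phi> (at x) (\<Sum>i\<in>UNIV. (z $ i) *s axis i 1)"
      by (simp add: basis_expansion)
    also have "\<dots> = (\<Sum>i\<in>UNIV. z $ i * frechet_derivative \<phi> (at x) (axis i 1))"
      by (simp add: linear_sum[OF lin] linear_scale[OF lin] scalar_mult_eq_scaleR)
    finally show ?thesis by (simp add: g_def inner_vec_def mult.commute)
  qed
  have "(L2.N M (\<lambda>x. frechet_derivative \<phi> (at x) z))\<^sup>2 = (\<integral>x. (frechet_derivative \<phi> (at x) z)\<^sup>2 \<partial>M)"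
    by (rule N_sq_integral[OF test_L2[OF test_function_deriv[OF \<phi>]]])
  also have "\<dots> \<le> (\<integral>x. (norm z)\<^sup>2 * (\<Sum>i\<in>UNIV. (frechet_derivative \<phi> (at x) (axis i 1))\<^sup>2) \<partial>M)"
  proof (rule integral_mono)
    show "integrable M (\<lambda>x. (frechet_derivative \<phi> (at x) z)\<^sup>2)"
      by (rule L2_integrable_sq[OF test_L2[OF test_function_deriv[OF \<phi>]]])
    show "integrable M (\<lambda>x. (norm z)\<^sup>2 * (\<Sum>i\<in>UNIV. (frechet_derivative \<phi> (at x) (axis i 1))\<^sup>2))"
      using L2_integrable_sq[OF test_L2[OF test_function_deriv[OF \<phi>]]] by auto
    show "(frechet_derivative \<phi> (at x) z)\<^sup>2 \<le> (norm z)\<^sup>2 * (\<Sum>i\<in>UNIV. (frechet_derivative \<phi> (at x) (axis i 1))\<^sup>2)" for x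
      using Cauchy_Schwarz_ineq[of "g x" z] by (simp add: d mult.commute flip: sq power2_norm_eq_inner)
  qed
  also have "\<dots> = (norm z)\<^sup>2 * (\<Sum>i\<in>UNIV. (L2.N M (\<lambda>x. frechet_derivative \<phi> (at x) (axis i 1)))\<^sup>2)"
    using L2_integrable_sq[OF test_L2[OF test_function_deriv[OF \<phi>]]]
    by (simp add: N_sq_integral[OF test_L2[OF test_function_deriv[OF \<phi>]]])
  also have "(\<Sum>i\<in>UNIV. (L2.N M (\<lambda>x. frechet_derivative \<phi> (at x) (axis i 1)))\<^sup>2) = (D.N \<phi>)\<^sup>2"
    unfolding N_test_deriv[OF \<phi>]
    using H1_partial(2)[OF test_H1(1)[OF \<phi>]] test_H1(1)[OF \<phi>] by (simp add: D.N_sq dip_def L2.N_sq)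
  finally show ?thesis .
qed

text \<open>The increment is the integral over the unit interval of the derivative along
  \<open>z\<close>. After Cauchy--Schwarz in \<open>t\<close> and an exchange of integrals,
  translation invariance removes the shift by \<open>t *\<^sub>R z\<close>.\<close>

lemma translation_estimate:
  assumes \<phi>: "\<phi> \<in> test_functions \<Omega>"
  shows "(\<integral>\<^sup>+x. ennreal ((\<phi> (x + z) - \<phi> x)\<^sup>2) \<partial>lborel) \<le> ennreal ((norm z)\<^sup>2 * (D.N \<phi>)\<^sup>2)"
proof -
  define h where "h = (\<lambda>y. frechet_derivative \<phi> (at y) z)"
  have h: "h \<in> test_functions \<Omega>" unfolding h_def by (rule test_function_deriv[OF \<phi>])
  have [measurable]: "h \<in> borel_measurable borel" by (rule test_function_borel[OF h])
  have c: "continuous_on UNIV (\<lambda>t. h (x + t *\<^sub>R z))" for x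
    unfolding h_def by (rule test_function_line_cont[OF \<phi>])
  have pt: "ennreal ((\<phi> (x + z) - \<phi> x)\<^sup>2) \<le> (\<integral>\<^sup>+t. ennreal ((h (x + t *\<^sub>R z))\<^sup>2) * indicator {0..1} t \<partial>lborel)" for x
  proof -
    have "(\<integral>t. h (x + t *\<^sub>R z) * indicator {0..1} t \<partial>lborel) = \<phi> (x + 1 *\<^sub>R z) - \<phi> (x + 0 *\<^sub>R z)"
      by (rule integral_FTC_Icc_real)
        (use test_function_line_deriv[OF \<phi>] c in \<open>auto simp: h_def continuous_on_eq_continuous_within\<close>)
    then have eq: "\<phi> (x + z) - \<phi> x = (\<integral>t. indicator {0..1} t * h (x + t *\<^sub>R z) \<partial>lborel)"
      by (simp add: mult.commute)
    show ?thesis unfolding eq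
      using sq_integral_le[OF compact_Icc[of "0::real" 1] c[of x]] by simp
  qed
  have "(\<integral>\<^sup>+x. ennreal ((\<phi> (x + z) - \<phi> x)\<^sup>2) \<partial>lborel)
      \<le> (\<integral>\<^sup>+x. \<integral>\<^sup>+t. ennreal ((h (x + t *\<^sub>R z))\<^sup>2) * indicator {0..1} t \<partial>lborel \<partial>lborel)"
    by (intro nn_integral_mono pt)
  also have "\<dots> = (\<integral>\<^sup>+t. \<integral>\<^sup>+x. ennreal ((h (x + t *\<^sub>R z))\<^sup>2) * indicator {0..1::real} t \<partial>lborel \<partial>lborel)"
    by (rule lborel_pair.Fubini'[symmetric]) measurable
  also have "\<dots> = (\<integral>\<^sup>+t. (\<integral>\<^sup>+x. ennreal ((h x)\<^sup>2) \<partial>lborel) * indicator {0..1::real} t \<partial>lborel)"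
  proof (intro nn_integral_cong)
    fix t :: real
    have "(\<integral>\<^sup>+x. ennreal ((h (x + t *\<^sub>R z))\<^sup>2) * indicator {0..1} t \<partial>lborel)
        = (\<integral>\<^sup>+x. ennreal ((h (x + t *\<^sub>R z))\<^sup>2) \<partial>lborel) * indicator {0..1} t"
      by (rule nn_integral_multc) measurable
    also have "(\<integral>\<^sup>+x. ennreal ((h (x + t *\<^sub>R z))\<^sup>2) \<partial>lborel) = (\<integral>\<^sup>+x. ennreal ((h x)\<^sup>2) \<partial>lborel)"
      by (rule nn_integral_lborel_translate) measurable
    finally show "(\<integral>\<^sup>+x. ennreal ((h (x + t *\<^sub>R z))\<^sup>2) * indicator {0..1} t \<partial>lborel)
        = (\<integral>\<^sup>+x. ennreal ((h x)\<^sup>2) \<partial>lborel) * indicator {0..1} t" .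
  qed
  also have "\<dots> = (\<integral>\<^sup>+x. ennreal ((h x)\<^sup>2) \<partial>lborel)"
    by (simp add: nn_integral_cmult)
  also have "\<dots> \<le> ennreal ((norm z)\<^sup>2 * (D.N \<phi>)\<^sup>2)"
    unfolding nn_integral_sq_test[OF h] unfolding h_def by (intro ennreal_leI N_sq_dir_deriv_le[OF \<phi>])
  finally show ?thesis .
qed

text \<open>Averages over small balls are close to the function in \<open>L\<^sup>2\<close>, uniformly in terms of the Dirichlet
  norm, and they are equicontinuous; so Arzela--Ascoli applies to them.\<close>

definition ball_avg :: "real \<Rightarrow> (real^3 \<Rightarrow> real) \<Rightarrow> real^3 \<Rightarrow> real" where
  "ball_avg r f x = (\<integral>z. indicator (cball 0 r) z * f (x + z) \<partial>lborel) / measure lborel (cball (0::real^3) r)"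

lemma ball_avg_integrable:
  assumes "f \<in> test_functions \<Omega>"
  shows "integrable lborel (\<lambda>z. indicator (cball 0 r) z * f (x + z))"
proof -
  have "continuous_on (cball 0 r) (\<lambda>z. f (x + z))"
    by (rule continuous_on_compose2[OF test_function_continuous[OF assms]]) (auto intro!: continuous_intros)
  from borel_integrable_compact[OF compact_cball this] show ?thesis by simp
qed

lemma emeasure_cball_eq: "emeasure lborel (cball (0::real^3) r) = ennreal (measure lborel (cball (0::real^3) r))"
  using emeasure_bounded_finite[OF bounded_cball[of "0::real^3" r]]
  by (intro emeasure_eq_ennreal_measure) (simp add: less_top)

text \<open>The square of a mean is at most the mean of the squares. Stated for any \<open>c\<close>
  that is the mean of \<open>G\<close>, it serves for the deviation from the average, the difference
  of two averages and the average itself.\<close>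

lemma ball_avg_sq_le:
  fixes G :: "real^3 \<Rightarrow> real"
  assumes r: "0 < r" and G: "continuous_on UNIV G"
    and eq: "c * measure lborel (cball (0::real^3) r) = (\<integral>z. indicator (cball 0 r) z * G z \<partial>lborel)"
  shows "ennreal (c\<^sup>2) * ennreal (measure lborel (cball (0::real^3) r))
    \<le> (\<integral>\<^sup>+z. ennreal ((G z)\<^sup>2) * indicator (cball 0 r) z \<partial>lborel)"
proof -
  define m where "m = measure lborel (cball (0::real^3) r)"
  have m: "0 < m" using content_cball_pos[OF r] by (simp add: m_def)
  define J where "J = (\<integral>\<^sup>+z. ennreal ((G z)\<^sup>2) * indicator (cball 0 r) z \<partial>lborel)"
  have "ennreal ((c * m)\<^sup>2) \<le> ennreal m * J"
    using sq_integral_le[OF compact_cball[of "0::real^3" r] G]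
    unfolding eq[symmetric] emeasure_cball_eq by (simp add: m_def J_def)
  moreover have "ennreal ((c * m)\<^sup>2) = ennreal m * (ennreal (c\<^sup>2) * ennreal m)"
  proof -
    have "(c * m)\<^sup>2 = m * (c\<^sup>2 * m)" by (simp add: power2_eq_square)
    then show ?thesis using m by (simp add: ennreal_mult)
  qed
  ultimately have le: "ennreal m * (ennreal (c\<^sup>2) * ennreal m) \<le> ennreal m * J" by simp
  show ?thesis
    unfolding m_def[symmetric] J_def[symmetric]
  \<comment> \<open>The common factor is cancelled in the reals, hence the separate case of an
    infinite right-hand side, where the claim is trivial.\<close>
  proof (cases "J = top")
    case False
    then obtain j where j: "J = ennreal j" "0 \<le> j" by (cases J) auto
    show "ennreal (c\<^sup>2) * ennreal m \<le> J"
      using le m by (simp add: j flip: ennreal_mult)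
  qed simp
qed

lemma ball_avg_borel:
  assumes [measurable]: "f \<in> borel_measurable borel"
  shows "ball_avg r f \<in> borel_measurable borel"
proof -
  define B where "B = cball (0::real^3) r"
  have [measurable]: "B \<in> sets borel" by (simp add: B_def)
  show ?thesis unfolding ball_avg_def B_def[symmetric] by measurable
qed

text \<open>The deviation at \<open>x\<close> is the mean of the increments
  \<open>\<phi> (x + z) - \<phi> x\<close> over \<open>z\<close> in the ball; after an exchange of
  integrals each \<open>z\<close> contributes at most what \<open>translation_estimate\<close>
  allows for \<open>norm z \<le> r\<close>.\<close>

lemma ball_avg_L2:
  assumes \<phi>: "\<phi> \<in> test_functions \<Omega>" and r: "0 < r"
  shows "(\<integral>\<^sup>+x. ennreal ((\<phi> x - ball_avg r \<phi> x)\<^sup>2) \<partial>lborel) \<le> ennreal (r\<^sup>2 * (D.N \<phi>)\<^sup>2)"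
proof -
  define B where "B = cball (0::real^3) r"
  define m where "m = measure lborel B"
  have m: "0 < m" using content_cball_pos[OF r] by (simp add: m_def B_def)
  have em: "emeasure lborel B = ennreal m" using emeasure_cball_eq by (simp add: m_def B_def)
  have [measurable]: "\<phi> \<in> borel_measurable borel" by (rule test_function_borel[OF \<phi>])
  have [measurable]: "B \<in> sets borel" by (simp add: B_def)
  have cont: "continuous_on UNIV (\<lambda>z. \<phi> (x + z) - \<phi> x)" for x
    by (intro continuous_intros continuous_on_compose2[OF test_function_continuous[OF \<phi>], of UNIV "\<lambda>z. x + z"]) auto
  have [measurable]: "ball_avg r \<phi> \<in> borel_measurable borel"
    by (rule ball_avg_borel) measurable
  have pt: "ennreal ((\<phi> x - ball_avg r \<phi> x)\<^sup>2) * ennreal m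
      \<le> (\<integral>\<^sup>+z. ennreal ((\<phi> (x + z) - \<phi> x)\<^sup>2) * indicator B z \<partial>lborel)" for x
  proof -
    have "(\<integral>z. indicator B z * (\<phi> (x + z) - \<phi> x) \<partial>lborel)
        = (\<integral>z. indicator B z * \<phi> (x + z) \<partial>lborel) - m * \<phi> x"
      using ball_avg_integrable[OF \<phi>, of r x] em
      by (simp add: right_diff_distrib B_def m_def less_top[symmetric])
    then have "(ball_avg r \<phi> x - \<phi> x) * m = (\<integral>z. indicator B z * (\<phi> (x + z) - \<phi> x) \<partial>lborel)"
      using m by (simp add: ball_avg_def B_def[symmetric] m_def[symmetric] left_diff_distrib)
    from ball_avg_sq_le[OF r cont, of "ball_avg r \<phi> x - \<phi> x" x, folded B_def, folded m_def, OF this]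
    show ?thesis by (simp add: power2_commute)
  qed
  have "(\<integral>\<^sup>+x. ennreal ((\<phi> x - ball_avg r \<phi> x)\<^sup>2) \<partial>lborel) * ennreal m
      = (\<integral>\<^sup>+x. ennreal ((\<phi> x - ball_avg r \<phi> x)\<^sup>2) * ennreal m \<partial>lborel)"
    by (rule nn_integral_multc[symmetric]) measurable
  also have "\<dots> \<le> (\<integral>\<^sup>+x. \<integral>\<^sup>+z. ennreal ((\<phi> (x + z) - \<phi> x)\<^sup>2) * indicator B z \<partial>lborel \<partial>lborel)"
    by (intro nn_integral_mono pt)
  also have "\<dots> = (\<integral>\<^sup>+z. \<integral>\<^sup>+x. ennreal ((\<phi> (x + z) - \<phi> x)\<^sup>2) * indicator B z \<partial>lborel \<partial>lborel)"
    by (rule lborel_pair.Fubini'[symmetric]) measurable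
  also have "\<dots> = (\<integral>\<^sup>+z. (\<integral>\<^sup>+x. ennreal ((\<phi> (x + z) - \<phi> x)\<^sup>2) \<partial>lborel) * indicator B z \<partial>lborel)"
    by (intro nn_integral_cong nn_integral_multc) measurable
  also have "\<dots> \<le> (\<integral>\<^sup>+z. ennreal (r\<^sup>2 * (D.N \<phi>)\<^sup>2) * indicator B z \<partial>lborel)"
  proof (intro nn_integral_mono)
    fix z
    have "(\<integral>\<^sup>+x. ennreal ((\<phi> (x + z) - \<phi> x)\<^sup>2) \<partial>lborel) \<le> ennreal (r\<^sup>2 * (D.N \<phi>)\<^sup>2)" if "z \<in> B"
      using that r by (intro order_trans[OF translation_estimate[OF \<phi>]] ennreal_leI mult_right_mono power_mono)
        (auto simp: B_def)
    then show "(\<integral>\<^sup>+x. ennreal ((\<phi> (x + z) - \<phi> x)\<^sup>2) \<partial>lborel) * indicator B z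
        \<le> ennreal (r\<^sup>2 * (D.N \<phi>)\<^sup>2) * indicator B z"
      by (auto simp: indicator_def)
  qed
  also have "\<dots> = ennreal (r\<^sup>2 * (D.N \<phi>)\<^sup>2) * ennreal m"
    by (simp add: nn_integral_cmult em)
  finally have "ennreal m * (\<integral>\<^sup>+x. ennreal ((\<phi> x - ball_avg r \<phi> x)\<^sup>2) \<partial>lborel)
      \<le> ennreal m * ennreal (r\<^sup>2 * (D.N \<phi>)\<^sup>2)" by (simp add: mult.commute)
  then show ?thesis
    using m by (subst (asm) ennreal_mult_le_mult_iff) auto
qed

text \<open>The difference of the averages is the mean of
  \<open>\<phi> (x + z) - \<phi> (y + z)\<close>. Enlarging the ball to the whole space and
  substituting \<open>z + y\<close> reduces it to a translation by \<open>x - y\<close>. The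
  resulting Lipschitz constant grows as \<open>r\<close> shrinks, so \<open>r\<close> has to be
  fixed before compactness is used.\<close>

lemma ball_avg_Lipschitz:
  assumes \<phi>: "\<phi> \<in> test_functions \<Omega>" and r: "0 < r"
  shows "\<bar>ball_avg r \<phi> x - ball_avg r \<phi> y\<bar> * sqrt (measure lborel (cball (0::real^3) r)) \<le> norm (x - y) * D.N \<phi>"
proof -
  define m where "m = measure lborel (cball (0::real^3) r)"
  have m: "0 < m" using content_cball_pos[OF r] by (simp add: m_def)
  have [measurable]: "\<phi> \<in> borel_measurable borel" by (rule test_function_borel[OF \<phi>])
  have D0: "0 \<le> D.N \<phi>" by (rule D.N_nonneg[OF test_H1(1)[OF \<phi>]])
  have cont: "continuous_on UNIV (\<lambda>z. \<phi> (x + z) - \<phi> (y + z))"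
    by (intro continuous_intros continuous_on_compose2[OF test_function_continuous[OF \<phi>], of UNIV "\<lambda>z. _ + z"]) auto
  have "(ball_avg r \<phi> x - ball_avg r \<phi> y) * m
      = (\<integral>z. indicator (cball 0 r) z * (\<phi> (x + z) - \<phi> (y + z)) \<partial>lborel)"
    using ball_avg_integrable[OF \<phi>] m by (simp add: ball_avg_def m_def right_diff_distrib left_diff_distrib)
  from ball_avg_sq_le[OF r cont, folded m_def, OF this]
  have "ennreal ((ball_avg r \<phi> x - ball_avg r \<phi> y)\<^sup>2) * ennreal m
      \<le> (\<integral>\<^sup>+z. ennreal ((\<phi> (x + z) - \<phi> (y + z))\<^sup>2) * indicator (cball 0 r) z \<partial>lborel)" .
  also have "\<dots> \<le> (\<integral>\<^sup>+z. ennreal ((\<phi> (x + z) - \<phi> (y + z))\<^sup>2) \<partial>lborel)"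
    by (intro nn_integral_mono) (auto simp: indicator_def)
  also have "\<dots> = (\<integral>\<^sup>+z. ennreal ((\<phi> ((z + y) + (x - y)) - \<phi> (z + y))\<^sup>2) \<partial>lborel)"
    by (simp add: add.commute)
  also have "\<dots> = (\<integral>\<^sup>+z. ennreal ((\<phi> (z + (x - y)) - \<phi> z)\<^sup>2) \<partial>lborel)"
    by (rule nn_integral_lborel_translate[of "\<lambda>z. ennreal ((\<phi> (z + (x - y)) - \<phi> z)\<^sup>2)"]) measurable
  also have "\<dots> \<le> ennreal ((norm (x - y))\<^sup>2 * (D.N \<phi>)\<^sup>2)"
    by (rule translation_estimate[OF \<phi>])
  finally have "(ball_avg r \<phi> x - ball_avg r \<phi> y)\<^sup>2 * m \<le> (norm (x - y) * D.N \<phi>)\<^sup>2"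
    using m by (simp add: power_mult_distrib flip: ennreal_mult)
  then have "(\<bar>ball_avg r \<phi> x - ball_avg r \<phi> y\<bar> * sqrt m)\<^sup>2 \<le> (norm (x - y) * D.N \<phi>)\<^sup>2"
    using m by (simp add: power_mult_distrib)
  then show ?thesis unfolding m_def by (rule power2_le_imp_le) (use D0 in simp)
qed

lemma ball_avg_bounded:
  assumes \<phi>: "\<phi> \<in> test_functions \<Omega>" and r: "0 < r"
  shows "\<bar>ball_avg r \<phi> x\<bar> * sqrt (measure lborel (cball (0::real^3) r)) \<le> L2.N M \<phi>"
proof -
  define m where "m = measure lborel (cball (0::real^3) r)"
  have m: "0 < m" using content_cball_pos[OF r] by (simp add: m_def)
  have [measurable]: "\<phi> \<in> borel_measurable borel" by (rule test_function_borel[OF \<phi>])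
  have cont: "continuous_on UNIV (\<lambda>z. \<phi> (x + z))"
    by (intro continuous_intros continuous_on_compose2[OF test_function_continuous[OF \<phi>], of UNIV "\<lambda>z. _ + z"]) auto
  have "ball_avg r \<phi> x * m = (\<integral>z. indicator (cball 0 r) z * \<phi> (x + z) \<partial>lborel)"
    using m by (simp add: ball_avg_def m_def)
  from ball_avg_sq_le[OF r cont, folded m_def, OF this]
  have "ennreal ((ball_avg r \<phi> x)\<^sup>2) * ennreal m
      \<le> (\<integral>\<^sup>+z. ennreal ((\<phi> (x + z))\<^sup>2) * indicator (cball 0 r) z \<partial>lborel)" .
  also have "\<dots> \<le> (\<integral>\<^sup>+z. ennreal ((\<phi> (z + x))\<^sup>2) \<partial>lborel)"
    by (intro nn_integral_mono) (auto simp: indicator_def add.commute)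
  also have "\<dots> = (\<integral>\<^sup>+z. ennreal ((\<phi> z)\<^sup>2) \<partial>lborel)"
    by (rule nn_integral_lborel_translate[of "\<lambda>z. ennreal ((\<phi> z)\<^sup>2)"]) measurable
  also have "\<dots> = ennreal ((L2.N M \<phi>)\<^sup>2)" by (rule nn_integral_sq_test[OF \<phi>])
  finally have "(ball_avg r \<phi> x)\<^sup>2 * m \<le> (L2.N M \<phi>)\<^sup>2"
    using m by (simp flip: ennreal_mult)
  then have "(\<bar>ball_avg r \<phi> x\<bar> * sqrt m)\<^sup>2 \<le> (L2.N M \<phi>)\<^sup>2"
    using m by (simp add: power_mult_distrib)
  then show ?thesis unfolding m_def by (rule power2_le_imp_le) (rule L2.N_nonneg[OF test_L2[OF \<phi>]])
qed

lemma ball_avg_diff: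
  assumes "\<phi> \<in> test_functions \<Omega>" "\<psi> \<in> test_functions \<Omega>"
  shows "ball_avg r (\<lambda>x. \<phi> x - \<psi> x) x = ball_avg r \<phi> x - ball_avg r \<psi> x"
  using ball_avg_integrable[OF assms(1)] ball_avg_integrable[OF assms(2)]
  by (simp add: ball_avg_def right_diff_distrib diff_divide_distrib)

lemma test_diff:
  assumes "\<phi> \<in> test_functions \<Omega>" "\<psi> \<in> test_functions \<Omega>"
  shows "(\<lambda>x. \<phi> x - \<psi> x) \<in> test_functions \<Omega>"
  using test_function_lin[OF assms, of 1 "-1"] by simp

text \<open>Splits \<open>f\<close> into its deviation from the average, small with
  \<open>r\<close>, and the average, controlled by its supremum.\<close>

lemma N_le_ball_avg:
  assumes f: "f \<in> test_functions \<Omega>" and r: "0 < r" and b: "\<And>x. x \<in> \<Omega> \<Longrightarrow> \<bar>ball_avg r f x\<bar> \<le> b"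
  shows "L2.N M f \<le> r * D.N f + b * sqrt (measure M (space M)) "
proof (cases "\<Omega> = {}")
  \<comment> \<open>On the empty domain the assumption says nothing about \<open>b\<close>, which
    may be negative.\<close>
  case True
  then have "L2.N M f = 0" "measure M (space M) = 0" by (simp_all add: L2.N_def ip_def)
  then show ?thesis using r D.N_nonneg[OF test_H1(1)[OF f]] by simp
next
  case False
  interpret finite_measure M by (rule finite_measure_M)
  have b0: "0 \<le> b" using False b by (force intro: order_trans[OF abs_ge_zero])
  have [measurable]: "f \<in> borel_measurable borel" by (rule test_function_borel[OF f])
  have bm: "ball_avg r f \<in> borel_measurable borel"
    by (rule ball_avg_borel) measurable
  have bM: "g \<in> borel_measurable M" if "g \<in> borel_measurable borel" for g :: "real^3 \<Rightarrow> real"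
    using that by (simp add: measurable_completion measurable_restrict_space1)
  have A: "ball_avg r f \<in> L2 M" "L2.N M (ball_avg r f) \<le> b * sqrt (measure M (space M))"
  proof -
    have sq: "(ball_avg r f x)\<^sup>2 \<le> b\<^sup>2" if "x \<in> \<Omega>" for x
      using power_mono[OF b[OF that], of 2] by simp
    show 1: "ball_avg r f \<in> L2 M"
      by (rule L2_bound[OF bM[OF bm], of "\<lambda>x. b\<^sup>2"]) (use sq in auto)
    have "(L2.N M (ball_avg r f))\<^sup>2 \<le> (\<integral>x. b\<^sup>2 \<partial>M)"
      unfolding N_sq_integral[OF 1] by (rule integral_mono[OF L2_integrable_sq[OF 1]]) (use sq in auto)
    also have "\<dots> = (b * sqrt (measure M (space M)))\<^sup>2" by (simp add: power_mult_distrib)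
    finally show "L2.N M (ball_avg r f) \<le> b * sqrt (measure M (space M))"
      by (rule power2_le_imp_le) (use b0 in simp)
  qed
  have dL: "(\<lambda>x. f x - ball_avg r f x) \<in> L2 M" by (rule L2.diff_mem[OF test_L2[OF f] A(1)])
  have "ennreal ((L2.N M (\<lambda>x. f x - ball_avg r f x))\<^sup>2) = (\<integral>\<^sup>+x. ennreal ((f x - ball_avg r f x)\<^sup>2) \<partial>M)"
    unfolding N_sq_integral[OF dL] using L2_integrable_sq[OF dL] by (intro nn_integral_eq_integral[symmetric]) auto
  also have "\<dots> \<le> (\<integral>\<^sup>+x. ennreal ((f x - ball_avg r f x)\<^sup>2) \<partial>lebesgue)"
    by (subst nn_integral_restrict_space) (auto intro!: nn_integral_mono simp: indicator_def)
  also have "\<dots> = (\<integral>\<^sup>+x. ennreal ((f x - ball_avg r f x)\<^sup>2) \<partial>lborel)"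
    by (rule nn_integral_completion)
  also have "\<dots> \<le> ennreal (r\<^sup>2 * (D.N f)\<^sup>2)" by (rule ball_avg_L2[OF f r])
  finally have "(L2.N M (\<lambda>x. f x - ball_avg r f x))\<^sup>2 \<le> (r * D.N f)\<^sup>2"
    by (simp add: power_mult_distrib)
  then have "L2.N M (\<lambda>x. f x - ball_avg r f x) \<le> r * D.N f"
    by (rule power2_le_imp_le) (use r D.N_nonneg[OF test_H1(1)[OF f]] in simp)
  then show ?thesis using L2.N_triangle_diff[OF test_L2[OF f] A(1)] A(2) by linarith
qed

text \<open>The radius is fixed first, so that all deviations from the averages together cost less
  than \<open>e / 2\<close>. For this radius Arzela--Ascoli provides a subsequence of the averages
  that is uniformly close to its limit.\<close>

lemma Rellich_step:
  assumes \<phi>: "\<And>n::nat. \<phi> n \<in> test_functions \<Omega>" and K: "\<And>n. L2.N M (\<phi> n) \<le> K" "\<And>n. D.N (\<phi> n) \<le> K"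
    and e: "0 < e"
  shows "\<exists>s::nat\<Rightarrow>nat. strict_mono s \<and> (\<forall>i j. L2.N M (\<lambda>x. \<phi> (s i) x - \<phi> (s j) x) < e)"
proof -
  have K0: "0 \<le> K" using K(2)[of 0] D.N_nonneg[OF test_H1(1)[OF \<phi>[of 0]]] by linarith
  \<comment> \<open>The factor \<open>2 * K\<close> bounds the Dirichlet norm of a difference of two
    members, and \<open>r * (2 * K)\<close> stays below \<open>e / 2\<close>; the summand 1 guards
    against \<open>K = 0\<close>.\<close>
  define r where "r = e / (4 * (K + 1))"
  have r: "0 < r" using e K0 by (simp add: r_def)
  have rK: "r * (2 * K) < e / 2" using e K0 by (simp add: r_def divide_simps)
  define m where "m = sqrt (measure lborel (cball (0::real^3) r))"
  have m: "0 < m" using content_cball_pos[OF r] by (simp add: m_def)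
  define c where "c = sqrt (measure M (space M)) + 1"
  have c: "0 < c" by (simp add: c_def add_nonneg_pos)
  have S: "compact (closure \<Omega>)" using bounded_dom by (simp add: compact_closure)
  obtain g k where g: "strict_mono (k :: nat \<Rightarrow> nat)"
    "\<And>e. 0 < e \<Longrightarrow> \<exists>N. \<forall>n x. n \<ge> N \<and> x \<in> closure \<Omega> \<longrightarrow> norm (ball_avg r (\<phi> (k n)) x - g x) < e"
  proof (rule Arzela_Ascoli[OF S, of "\<lambda>n. ball_avg r (\<phi> n)" "K / m"])
    show "norm (ball_avg r (\<phi> n) x) \<le> K / m" for n x
      using order_trans[OF ball_avg_bounded[OF \<phi> r] K(1)] m by (simp add: m_def field_simps)
    show "\<exists>d>0. \<forall>n y. y \<in> closure \<Omega> \<and> norm (x - y) < d \<longrightarrow> norm (ball_avg r (\<phi> n) x - ball_avg r (\<phi> n) y) < e"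
      if "0 < e" for x e
    proof (intro exI[of _ "e * m / (K + 1)"] conjI allI impI)
      show "0 < e * m / (K + 1)" using that m K0 by simp
      fix n y assume y: "y \<in> closure \<Omega> \<and> norm (x - y) < e * m / (K + 1)"
      have "\<bar>ball_avg r (\<phi> n) x - ball_avg r (\<phi> n) y\<bar> * m \<le> norm (x - y) * D.N (\<phi> n)"
        unfolding m_def by (rule ball_avg_Lipschitz[OF \<phi> r])
      also have "\<dots> \<le> norm (x - y) * (K + 1)" using K(2)[of n] by (intro mult_left_mono) auto
      also have "\<dots> < e * m" using y K0 by (simp add: field_simps)
      finally show "norm (ball_avg r (\<phi> n) x - ball_avg r (\<phi> n) y) < e" using m by simp
    qed
  qed blast
  \<comment> \<open>Two averages within \<open>\<eta>\<close> of the limit differ by at most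
    \<open>2 * \<eta>\<close>, and \<open>2 * \<eta> * c = e / 2\<close>.\<close>
  define \<eta> where "\<eta> = e / (4 * c)"
  have \<eta>: "0 < \<eta>" using e c by (simp add: \<eta>_def)
  obtain n0 where n0: "\<And>n x. n \<ge> n0 \<Longrightarrow> x \<in> closure \<Omega> \<Longrightarrow> norm (ball_avg r (\<phi> (k n)) x - g x) < \<eta>"
    using g(2)[OF \<eta>] by blast
  have "L2.N M (\<lambda>x. \<phi> (k (i + n0)) x - \<phi> (k (j + n0)) x) < e" for i j
  proof -
    let ?f = "\<lambda>x. \<phi> (k (i + n0)) x - \<phi> (k (j + n0)) x"
    have f: "?f \<in> test_functions \<Omega>" by (rule test_diff[OF \<phi> \<phi>])
    have "\<bar>ball_avg r ?f x\<bar> \<le> 2 * \<eta>" if "x \<in> \<Omega>" for x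
    proof -
      have "x \<in> closure \<Omega>" using that closure_subset by auto
      then show ?thesis
        using n0[of "i + n0" x] n0[of "j + n0" x] unfolding ball_avg_diff[OF \<phi> \<phi>] by auto
    qed
    then have "L2.N M ?f \<le> r * D.N ?f + 2 * \<eta> * sqrt (measure M (space M))"
      by (rule N_le_ball_avg[OF f r])
    moreover have "D.N ?f \<le> 2 * K"
      using D.N_triangle[of "\<phi> (k (i + n0))" "\<lambda>x. (-1) * \<phi> (k (j + n0)) x"] D.N_scale[of "\<phi> (k (j + n0))" "-1"]
        D.scale_mem[of "\<phi> (k (j + n0))" "-1"] test_H1(1)[OF \<phi>] K(2)[of "k (i + n0)"] K(2)[of "k (j + n0)"] by simp
    then have "r * D.N ?f \<le> r * (2 * K)" using r by (intro mult_left_mono) auto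
    moreover have "2 * \<eta> * sqrt (measure M (space M)) \<le> e / 2"
    proof -
      have "2 * \<eta> * sqrt (measure M (space M)) \<le> 2 * \<eta> * c" using \<eta> by (intro mult_left_mono) (auto simp: c_def)
      also have "\<dots> = e / 2" using c by (simp add: \<eta>_def)
      finally show ?thesis .
    qed
    ultimately show ?thesis using rK by linarith
  qed
  moreover have "strict_mono (\<lambda>i. k (i + n0))"
    using g(1) by (simp add: strict_mono_def)
  ultimately show ?thesis by (intro exI[of _ "\<lambda>i. k (i + n0)"]) simp
qed

text \<open>A diagonal argument: \<open>P k\<close> passes to subsequences, so the diagonal sequence
  satisfies it from index \<open>Suc k\<close> on.\<close>

lemma Rellich:
  assumes \<phi>: "\<And>n::nat. \<phi> n \<in> test_functions \<Omega>" and K: "\<And>n. L2.N M (\<phi> n) \<le> K" "\<And>n. D.N (\<phi> n) \<le> K"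
  shows "\<exists>s::nat\<Rightarrow>nat. strict_mono s \<and>
    (\<forall>e>0. \<exists>n0. \<forall>m\<ge>n0. \<forall>n\<ge>n0. L2.N M (\<lambda>x. \<phi> (s m) x - \<phi> (s n) x) < e)"
proof -
  define P where "P k s \<longleftrightarrow> (\<forall>i j. L2.N M (\<lambda>x. \<phi> (s i) x - \<phi> (s j) x) < 1 / real (Suc k))"
    for k and s :: "nat \<Rightarrow> nat"
  interpret subseqs P
  proof
    fix n and s :: "nat \<Rightarrow> nat"
    show "\<exists>r'. strict_mono r' \<and> P n (s \<circ> r')"
      using Rellich_step[of "\<lambda>i. \<phi> (s i)" K "1 / real (Suc n)"] \<phi> K by (simp add: P_def)
  qed
  have P: "P k (diagseq \<circ> ((+) (Suc k)))" for k
    by (rule diagseq_holds) (simp add: P_def)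
  show ?thesis
  proof (intro exI[of _ diagseq] conjI subseq_diagseq allI impI)
    fix e :: real assume "0 < e"
    then obtain k where k: "1 / real (Suc k) < e" using nat_approx_posE by metis
    show "\<exists>n0. \<forall>m\<ge>n0. \<forall>n\<ge>n0. L2.N M (\<lambda>x. \<phi> (diagseq m) x - \<phi> (diagseq n) x) < e"
    proof (intro exI[of _ "Suc k"] allI impI)
      fix m n assume "Suc k \<le> m" "Suc k \<le> n"
      then obtain i j where "m = Suc k + i" "n = Suc k + j" by (metis le_Suc_ex)
      then have "L2.N M (\<lambda>x. \<phi> (diagseq m) x - \<phi> (diagseq n) x) < 1 / real (Suc k)"
        using P[of k] by (simp add: P_def)
      then show "L2.N M (\<lambda>x. \<phi> (diagseq m) x - \<phi> (diagseq n) x) < e" using k by linarith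
    qed
  qed
qed

end

section \<open>The principal eigenvalue\<close>

context bounded_open
begin

lemma partial_diff_N:
  assumes "f \<in> H1 \<Omega>" "g \<in> H1 \<Omega>"
  shows "L2.N M (\<lambda>x. weak_partial \<Omega> i f x - weak_partial \<Omega> i g x) = L2.N M (weak_partial \<Omega> i (\<lambda>x. f x - g x))"
proof -
  have "AE x in M. weak_partial \<Omega> i (\<lambda>x. 1 * f x + (-1) * g x) x = 1 * weak_partial \<Omega> i f x + (-1) * weak_partial \<Omega> i g x"
    by (rule H1_lin[OF assms])
  then have "AE x in M. weak_partial \<Omega> i f x - weak_partial \<Omega> i g x = weak_partial \<Omega> i (\<lambda>x. f x - g x) x"
    by (simp add: eq_commute)
  then show ?thesis
    using H1_partial(2)[OF assms(1)] H1_partial(2)[OF assms(2)] H1_partial(2)[OF D.diff_mem[OF assms]]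
    by (intro N_AE_cong) (auto intro!: L2_measurable L2.diff_mem)
qed

text \<open>The functions and each of their partial derivatives converge separately in L2;
  closedness of the weak derivative ties the limits together.\<close>

lemma H10_complete:
  assumes u: "\<And>n::nat. u n \<in> H10 \<Omega>"
    and cN: "\<And>e. 0 < e \<Longrightarrow> \<exists>k. \<forall>m\<ge>k. \<forall>n\<ge>k. L2.N M (\<lambda>x. u m x - u n x) < e"
    and cD: "\<And>e. 0 < e \<Longrightarrow> \<exists>k. \<forall>m\<ge>k. \<forall>n\<ge>k. D.N (\<lambda>x. u m x - u n x) < e"
  shows "\<exists>f\<in>H10 \<Omega>. (\<lambda>n. L2.N M (\<lambda>x. u n x - f x)) \<longlonglongrightarrow> 0 \<and> (\<lambda>n. D.N (\<lambda>x. u n x - f x)) \<longlonglongrightarrow> 0"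
proof -
  have uH: "u n \<in> H1 \<Omega>" for n using u H10_H1 by auto
  obtain f where f: "f \<in> L2 M" "(\<lambda>n. L2.N M (\<lambda>x. u n x - f x)) \<longlonglongrightarrow> 0"
    using L2_complete[OF finite_measure_M, of u] H1_L2[OF uH] cN by blast
  have "\<exists>g\<in>L2 M. (\<lambda>n. L2.N M (\<lambda>x. weak_partial \<Omega> i (u n) x - g x)) \<longlonglongrightarrow> 0" for i
  proof (rule L2_complete[OF finite_measure_M H1_partial(2)[OF uH]])
    fix e :: real assume "0 < e"
    then obtain k where k: "\<forall>m\<ge>k. \<forall>n\<ge>k. D.N (\<lambda>x. u m x - u n x) < e" using cD by blast
    have "L2.N M (\<lambda>x. weak_partial \<Omega> i (u m) x - weak_partial \<Omega> i (u n) x) < e" if "k \<le> m" "k \<le> n" for m n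
      using N_partial_le[OF D.diff_mem[OF uH uH], of i m n] k that unfolding partial_diff_N[OF uH uH]
      by (meson le_less_trans)
    then show "\<exists>K. \<forall>m\<ge>K. \<forall>n\<ge>K. L2.N M (\<lambda>x. weak_partial \<Omega> i (u m) x - weak_partial \<Omega> i (u n) x) < e"
      by blast
  qed
  then have "\<exists>g. \<forall>i. g i \<in> L2 M \<and> (\<lambda>n. L2.N M (\<lambda>x. weak_partial \<Omega> i (u n) x - g i x)) \<longlonglongrightarrow> 0"
    by (intro choice) blast
  then obtain g where g: "\<And>i. g i \<in> L2 M"
    "\<And>i. (\<lambda>n. L2.N M (\<lambda>x. weak_partial \<Omega> i (u n) x - g i x)) \<longlonglongrightarrow> 0" by blast
  have wp: "is_weak_partial \<Omega> i f (g i)" for i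
    by (rule is_weak_partial_limit[OF H1_L2[OF uH] H1_partial(2)[OF uH] H1_partial(1)[OF uH] f(1) g(1) f(2) g(2)])
  have fH: "f \<in> H1 \<Omega>" and fg: "AE x in M. weak_partial \<Omega> i f x = g i x" for i
    using H1I[OF f(1) g(1) wp] by auto
  have P: "(\<lambda>n. L2.N M (weak_partial \<Omega> i (\<lambda>x. u n x - f x))) \<longlonglongrightarrow> 0" for i
  proof -
    have "L2.N M (weak_partial \<Omega> i (\<lambda>x. u n x - f x)) = L2.N M (\<lambda>x. weak_partial \<Omega> i (u n) x - g i x)" for n
      unfolding partial_diff_N[OF uH fH, symmetric]
      using H1_partial(2)[OF uH] H1_partial(2)[OF fH] g(1) fg[of i]
      by (intro N_AE_cong) (auto intro!: L2_measurable L2.diff_mem)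
    then show ?thesis using g(2)[of i] by simp
  qed
  have "(\<lambda>n. sqrt (\<Sum>i\<in>UNIV. (L2.N M (weak_partial \<Omega> i (\<lambda>x. u n x - f x)))\<^sup>2)) \<longlonglongrightarrow> sqrt (\<Sum>i\<in>(UNIV::3 set). 0\<^sup>2)"
    by (intro tendsto_intros P)
  moreover have "sqrt (\<Sum>i\<in>UNIV. (L2.N M (weak_partial \<Omega> i (\<lambda>x. u n x - f x)))\<^sup>2) = D.N (\<lambda>x. u n x - f x)" for n
    using H1_partial(2)[OF D.diff_mem[OF uH fH]] by (simp add: D.N_def dip_def L2.N_sq)
  ultimately have limD: "(\<lambda>n. D.N (\<lambda>x. u n x - f x)) \<longlonglongrightarrow> 0" by simp
  have "(\<lambda>n. W.N (\<lambda>x. u n x - f x)) \<longlonglongrightarrow> 0"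
  proof (rule Lim_null_comparison)
    show "\<forall>\<^sub>F n in sequentially. norm (W.N (\<lambda>x. u n x - f x)) \<le> L2.N M (\<lambda>x. u n x - f x) + D.N (\<lambda>x. u n x - f x)"
      using W_le[OF D.diff_mem[OF uH fH]] W.N_nonneg[OF D.diff_mem[OF uH fH]] by (intro always_eventually) auto
    show "(\<lambda>n. L2.N M (\<lambda>x. u n x - f x) + D.N (\<lambda>x. u n x - f x)) \<longlonglongrightarrow> 0"
      using tendsto_add[OF f(2) limD] by simp
  qed
  then have "f \<in> H10 \<Omega>" by (rule H10_limit[OF u fH])
  then show ?thesis using f(2) limD by blast
qed

text \<open>Rellich makes a minimizing sequence Cauchy in \<open>L\<^sup>2\<close>, and the parallelogram identity then makes it
  Cauchy in the Dirichlet norm, so that no weak compactness is needed.\<close>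

lemma Rayleigh_minimizer:
  assumes nz: "\<phi>0 \<in> test_functions \<Omega>" "L2.N M \<phi>0 \<noteq> 0"
  shows "\<exists>c. \<exists>u\<in>H10 \<Omega>. L2.N M u = 1 \<and> (D.N u)\<^sup>2 = c \<and> (\<forall>v\<in>H10 \<Omega>. c * (L2.N M v)\<^sup>2 \<le> (D.N v)\<^sup>2)"
proof -
  \<comment> \<open>The infimum is taken over normalized test functions, for which Rellich
    compactness was proved; density extends the lower bound \<open>c\<close> to all of
    \<open>H10\<close>.\<close>
  define T where "T = {\<phi> \<in> test_functions \<Omega>. L2.N M \<phi> = 1}"
  have TH: "\<phi> \<in> test_functions \<Omega>" "\<phi> \<in> H1 \<Omega>" "\<phi> \<in> L2 M" "L2.N M \<phi> = 1" if "\<phi> \<in> T" for \<phi>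
    using that test_H1 test_L2 by (auto simp: T_def)
  have normalise: "(\<lambda>x. (1 / L2.N M \<phi>) * \<phi> x) \<in> T" if "\<phi> \<in> test_functions \<Omega>" "L2.N M \<phi> \<noteq> 0" for \<phi>
  proof -
    have "0 < L2.N M \<phi>" using that L2.N_nonneg[OF test_L2[OF that(1)]] by simp
    then show ?thesis
      using test_function_lin[OF that(1) that(1), of "1 / L2.N M \<phi>" 0] L2.N_scale[OF test_L2[OF that(1)], of "1 / L2.N M \<phi>"]
      by (simp add: T_def)
  qed
  define c where "c = (INF \<phi>\<in>T. (D.N \<phi>)\<^sup>2)"
  have ne: "T \<noteq> {}" using normalise[OF nz] by blast
  have bdd: "bdd_below ((\<lambda>\<phi>. (D.N \<phi>)\<^sup>2) ` T)" by (intro bdd_belowI[of _ 0]) auto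
  have c_le: "c \<le> (D.N \<phi>)\<^sup>2" if "\<phi> \<in> T" for \<phi>
    unfolding c_def by (rule cINF_lower[OF bdd that])
  have c0: "0 \<le> c" unfolding c_def by (rule cINF_greatest[OF ne]) simp
  have le_test: "c * (L2.N M \<phi>)\<^sup>2 \<le> (D.N \<phi>)\<^sup>2" if \<phi>: "\<phi> \<in> test_functions \<Omega>" for \<phi>
  proof (cases "L2.N M \<phi> = 0")
    case False
    then have "0 < L2.N M \<phi>" using L2.N_nonneg[OF test_L2[OF \<phi>]] by simp
    moreover from this have "D.N (\<lambda>x. (1 / L2.N M \<phi>) * \<phi> x) = D.N \<phi> / L2.N M \<phi>"
      using D.N_scale[OF test_H1(1)[OF \<phi>], of "1 / L2.N M \<phi>"] by (simp only: abs_of_pos zero_less_divide_1_iff) simp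
    then have "c \<le> (D.N \<phi> / L2.N M \<phi>)\<^sup>2" using c_le[OF normalise[OF \<phi> False]] by (simp only:)
    ultimately show ?thesis by (simp add: power_divide pos_le_divide_eq)
  qed simp
  have le: "c * (L2.N M v)\<^sup>2 \<le> (D.N v)\<^sup>2" if v: "v \<in> H10 \<Omega>" for v
  proof -
    obtain \<phi> where \<phi>: "\<And>n::nat. \<phi> n \<in> test_functions \<Omega>"
      "(\<lambda>n. L2.N M (\<lambda>x. \<phi> n x - v x)) \<longlonglongrightarrow> 0" "(\<lambda>n. D.N (\<lambda>x. \<phi> n x - v x)) \<longlonglongrightarrow> 0"
      using H10_approx[OF v] by blast
    have vH: "v \<in> H1 \<Omega>" using v H10_H1 by auto
    have "(\<lambda>n. L2.N M (\<phi> n)) \<longlonglongrightarrow> L2.N M v" "(\<lambda>n. D.N (\<phi> n)) \<longlonglongrightarrow> D.N v"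
      using \<phi> vH test_L2 test_H1(1) H1_L2 by (auto intro!: L2.tendsto_N D.tendsto_N)
    then have "(\<lambda>n. c * (L2.N M (\<phi> n))\<^sup>2) \<longlonglongrightarrow> c * (L2.N M v)\<^sup>2" "(\<lambda>n. (D.N (\<phi> n))\<^sup>2) \<longlonglongrightarrow> (D.N v)\<^sup>2"
      by (auto intro!: tendsto_intros)
    then show ?thesis by (rule LIMSEQ_le) (use le_test[OF \<phi>(1)] in auto)
  qed
  have "\<exists>\<phi>\<in>T. (D.N \<phi>)\<^sup>2 < c + 1 / real (Suc n)" for n
    using cINF_less_iff[OF ne bdd, of "c + 1 / real (Suc n)"] by (simp add: c_def)
  then have "\<exists>\<phi>. \<forall>n. \<phi> n \<in> T \<and> (D.N (\<phi> n))\<^sup>2 < c + 1 / real (Suc n)"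
    by (intro choice) blast
  then obtain \<phi> where \<phi>: "\<And>n. \<phi> n \<in> T" "\<And>n. (D.N (\<phi> n))\<^sup>2 < c + 1 / real (Suc n)" by blast
  have DK: "D.N (\<phi> n) \<le> c + 2" for n
  proof (rule power2_le_imp_le)
    have "1 / real (Suc n) \<le> 1" by simp
    then have "(D.N (\<phi> n))\<^sup>2 \<le> c + 1" using \<phi>(2)[of n] by linarith
    also have "\<dots> \<le> (c + 2)\<^sup>2" using c0 by (simp add: power2_eq_square algebra_simps)
    finally show "(D.N (\<phi> n))\<^sup>2 \<le> (c + 2)\<^sup>2" .
  qed (use c0 in simp)
  have NK: "L2.N M (\<phi> n) \<le> c + 2" for n using TH(4)[OF \<phi>(1)] c0 by simp
  obtain s :: "nat \<Rightarrow> nat" where s0: "strict_mono s \<and>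
      (\<forall>e>0. \<exists>n0. \<forall>m\<ge>n0. \<forall>n\<ge>n0. L2.N M (\<lambda>x. \<phi> (s m) x - \<phi> (s n) x) < e)"
    using Rellich[OF TH(1)[OF \<phi>(1)] NK DK] by (rule exE)
  have s: "strict_mono s"
    "\<And>e. 0 < e \<Longrightarrow> \<exists>n0. \<forall>m\<ge>n0. \<forall>n\<ge>n0. L2.N M (\<lambda>x. \<phi> (s m) x - \<phi> (s n) x) < e"
    using s0 by simp_all
  let ?u = "\<lambda>n. \<phi> (s n)"
  have uT: "?u n \<in> T" for n using \<phi> by auto
  \<comment> \<open>The Rayleigh bound applied to the sum of two members costs \<open>4 * c\<close>
    up to the L2 distance, while their own Dirichlet energies are nearly \<open>c\<close>. What the
    parallelogram identity leaves for the difference is hence small.\<close>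
  have par: "(D.N (\<lambda>x. ?u m x - ?u n x))\<^sup>2 \<le> 2 / real (Suc m) + 2 / real (Suc n) + c * (L2.N M (\<lambda>x. ?u m x - ?u n x))\<^sup>2" for m n
  proof -
    have "(L2.N M (\<lambda>x. ?u m x + ?u n x))\<^sup>2 = 4 - (L2.N M (\<lambda>x. ?u m x - ?u n x))\<^sup>2"
      using L2.parallelogram[OF TH(3)[OF uT] TH(3)[OF uT], of m n] by (simp add: TH(4)[OF uT])
    moreover have "c * (L2.N M (\<lambda>x. ?u m x + ?u n x))\<^sup>2 \<le> (D.N (\<lambda>x. ?u m x + ?u n x))\<^sup>2"
      using le_test[OF test_function_lin[OF TH(1)[OF uT] TH(1)[OF uT], of 1 m 1 n]] by simp
    ultimately have "c * (4 - (L2.N M (\<lambda>x. ?u m x - ?u n x))\<^sup>2) \<le> (D.N (\<lambda>x. ?u m x + ?u n x))\<^sup>2"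
      by (simp only:)
    then have "4 * c - c * (L2.N M (\<lambda>x. ?u m x - ?u n x))\<^sup>2 \<le> (D.N (\<lambda>x. ?u m x + ?u n x))\<^sup>2"
      by (simp add: right_diff_distrib)
    moreover have "(D.N (?u k))\<^sup>2 \<le> c + 1 / real (Suc k)" for k
    proof -
      have "1 / real (Suc (s k)) \<le> 1 / real (Suc k)"
        using seq_suble[OF s(1), of k] by (simp add: divide_simps)
      then show ?thesis using \<phi>(2)[of "s k"] by linarith
    qed
    from this[of m] this[of n]
    have "2 * (D.N (?u m))\<^sup>2 + 2 * (D.N (?u n))\<^sup>2 \<le> 4 * c + 2 * (1 / real (Suc m)) + 2 * (1 / real (Suc n))"
      by linarith
    then have "2 * (D.N (?u m))\<^sup>2 + 2 * (D.N (?u n))\<^sup>2 \<le> 4 * c + 2 / real (Suc m) + 2 / real (Suc n)"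
      by simp
    ultimately show ?thesis
      using D.parallelogram[OF TH(2)[OF uT] TH(2)[OF uT], of m n] by linarith
  qed
  have cD: "\<exists>k. \<forall>m\<ge>k. \<forall>n\<ge>k. D.N (\<lambda>x. ?u m x - ?u n x) < e" if e: "0 < e" for e
  proof -
    \<comment> \<open>The cap 1 makes a norm below \<open>d\<close> have its square below
      \<open>d\<close>, and \<open>c * d \<le> e\<^sup>2 / 2\<close>. The two reciprocal terms in
      \<open>par\<close> use the other half, a quarter each.\<close>
    define d where "d = min 1 (e\<^sup>2 / (2 * (c + 1)))"
    have d: "0 < d" "d \<le> 1" "c * d \<le> e\<^sup>2 / 2"
    proof -
      show "0 < d" "d \<le> 1" using e c0 by (auto simp: d_def)
      have "c * d \<le> (c + 1) * (e\<^sup>2 / (2 * (c + 1)))" using c0 \<open>0 < d\<close> by (intro mult_mono) (auto simp: d_def)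
      also have "\<dots> = e\<^sup>2 / 2" using c0 by (simp add: divide_simps)
      finally show "c * d \<le> e\<^sup>2 / 2" .
    qed
    obtain k1 where k1: "\<And>m n. m \<ge> k1 \<Longrightarrow> n \<ge> k1 \<Longrightarrow> L2.N M (\<lambda>x. ?u m x - ?u n x) < d"
      using s(2)[OF d(1)] by blast
    obtain k2 where k2: "1 / real (Suc k2) < e\<^sup>2 / 8"
      using nat_approx_posE[of "e\<^sup>2 / 8"] e by auto
    show ?thesis
    proof (intro exI[of _ "max k1 k2"] allI impI)
      fix m n assume mn: "max k1 k2 \<le> m" "max k1 k2 \<le> n"
      have i: "2 / real (Suc k) < e\<^sup>2 / 4" if "k2 \<le> k" for k
      proof -
        have "2 / real (Suc k) \<le> 2 * (1 / real (Suc k2))" using that by (simp add: divide_simps)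
        then show ?thesis using k2 by linarith
      qed
      have "L2.N M (\<lambda>x. ?u m x - ?u n x) < d" using k1 mn by simp
      moreover have "0 \<le> L2.N M (\<lambda>x. ?u m x - ?u n x)"
        by (rule L2.N_nonneg[OF L2.diff_mem[OF TH(3)[OF uT] TH(3)[OF uT]]])
      ultimately have "(L2.N M (\<lambda>x. ?u m x - ?u n x))\<^sup>2 \<le> d"
        using d(2) mult_mono[of "L2.N M (\<lambda>x. ?u m x - ?u n x)" d "L2.N M (\<lambda>x. ?u m x - ?u n x)" 1]
        by (simp add: power2_eq_square)
      then have "c * (L2.N M (\<lambda>x. ?u m x - ?u n x))\<^sup>2 \<le> e\<^sup>2 / 2"
        using d(3) c0 by (meson mult_left_mono order_trans)
      then have "(D.N (\<lambda>x. ?u m x - ?u n x))\<^sup>2 < e\<^sup>2"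
        using par[of m n] i[of m] i[of n] mn by simp
      then show "D.N (\<lambda>x. ?u m x - ?u n x) < e" using e by (simp add: power2_less_imp_less)
    qed
  qed
  obtain u where u: "u \<in> H10 \<Omega>" "(\<lambda>n. L2.N M (\<lambda>x. ?u n x - u x)) \<longlonglongrightarrow> 0"
    "(\<lambda>n. D.N (\<lambda>x. ?u n x - u x)) \<longlonglongrightarrow> 0"
    using H10_complete[OF test_H10[OF TH(1)[OF uT]] s(2) cD] by blast
  have uH: "u \<in> H1 \<Omega>" using u H10_H1 by auto
  have "(\<lambda>n. L2.N M (?u n)) \<longlonglongrightarrow> L2.N M u"
    using TH(3)[OF uT] H1_L2[OF uH] u(2) by (intro L2.tendsto_N) auto
  then have N1: "L2.N M u = 1"
    using TH(4)[OF uT] by (simp add: LIMSEQ_const_iff)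
  have "(\<lambda>n. D.N (?u n)) \<longlonglongrightarrow> D.N u"
    using TH(2)[OF uT] uH u(3) by (intro D.tendsto_N) auto
  then have 1: "(\<lambda>n. (D.N (?u n))\<^sup>2) \<longlonglongrightarrow> (D.N u)\<^sup>2" by (intro tendsto_intros)
  have "(\<lambda>n. c + inverse (real (Suc n))) \<longlonglongrightarrow> c + 0"
    by (intro tendsto_intros LIMSEQ_inverse_real_of_nat)
  then have "(D.N u)\<^sup>2 \<le> c + 0"
  proof (rule LIMSEQ_le[OF 1], intro exI allI impI)
    fix n
    have "inverse (real (Suc (s n))) \<le> inverse (real (Suc n))"
      using seq_suble[OF s(1), of n] by simp
    then show "(D.N (?u n))\<^sup>2 \<le> c + inverse (real (Suc n))"
      using \<phi>(2)[of "s n"] by (simp add: inverse_eq_divide)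
  qed
  moreover have "c \<le> (D.N u)\<^sup>2" using le[OF u(1)] N1 by simp
  ultimately show ?thesis using u(1) N1 le by (intro exI[of _ c] bexI[of _ u]) auto
qed

text \<open>\<open>LEAST\<close> carries information only once a least eigenvalue is exhibited. It
  is the minimum of the Rayleigh quotient: the minimizer is an eigenfunction, and any other
  eigenvalue is the Rayleigh quotient of its own eigenfunction.\<close>

lemma principal_eigenvalue_le:
  assumes v: "v \<in> H10 \<Omega>"
  shows "principal_eigenvalue \<Omega> * (L2.N M v)\<^sup>2 \<le> (D.N v)\<^sup>2"
proof (cases "L2.N M v = 0")
  case False
  \<comment> \<open>\<open>Rayleigh_minimizer\<close> asks for a test function of nonzero norm; a
    close approximation of \<open>v\<close> is one.\<close>
  obtain \<phi> where \<phi>: "\<And>n::nat. \<phi> n \<in> test_functions \<Omega>" "(\<lambda>n. L2.N M (\<lambda>x. \<phi> n x - v x)) \<longlonglongrightarrow> 0"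
    using H10_approx[OF v] by blast
  have "(\<lambda>n. L2.N M (\<phi> n)) \<longlonglongrightarrow> L2.N M v"
    using \<phi> H1_L2[OF H10_H1[OF v]] test_L2 by (auto intro!: L2.tendsto_N)
  then obtain n where n: "L2.N M (\<phi> n) \<noteq> 0"
    using False LIMSEQ_unique[OF _ tendsto_const[of 0]] by fastforce
  obtain c u where u: "u \<in> H10 \<Omega>" "L2.N M u = 1" "(D.N u)\<^sup>2 = c"
    and le: "\<And>v. v \<in> H10 \<Omega> \<Longrightarrow> c * (L2.N M v)\<^sup>2 \<le> (D.N v)\<^sup>2"
    using Rayleigh_minimizer[OF \<phi>(1) n] by blast
  have uH: "u \<in> H1 \<Omega>" "u \<in> L2 M" using u H10_H1 H1_L2 by auto
  have weak: "dip \<Omega> u w = c * ip M u w" if w: "w \<in> H10 \<Omega>" for w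
  proof -
    have wH: "w \<in> H1 \<Omega>" "w \<in> L2 M" using w H10_H1 H1_L2 by auto
    \<comment> \<open>First variation: the excess of the Dirichlet energy over \<open>c\<close>
      times the squared norm is nonnegative along \<open>u + t * w\<close> and zero at
      \<open>t = 0\<close>.\<close>
    have "dip \<Omega> u w - c * ip M u w = 0"
    proof (rule quadratic_nonneg_imp_linear_zero)
      fix t :: real
      have m: "(\<lambda>x. u x + t * w x) \<in> H10 \<Omega>" using H10_lin[OF u(1) w, of 1 t] by simp
      then have "c * ip M (\<lambda>x. u x + t * w x) (\<lambda>x. u x + t * w x) \<le> dip \<Omega> (\<lambda>x. u x + t * w x) (\<lambda>x. u x + t * w x)"
        using le[OF m] H1_L2[OF H10_H1[OF m]] H10_H1[OF m] by (simp add: L2.N_sq D.N_sq)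
      moreover have "ip M u u = 1" "dip \<Omega> u u = c"
        using u uH by (simp_all flip: L2.N_sq D.N_sq)
      ultimately show "0 \<le> 2 * t * (dip \<Omega> u w - c * ip M u w) + t\<^sup>2 * (dip \<Omega> w w - c * ip M w w)"
        using L2.B_expand[OF uH(2) wH(2), of t] D.B_expand[OF uH(1) wH(1), of t]
        by (simp add: algebra_simps)
    qed
    then show ?thesis by simp
  qed
  have "principal_eigenvalue \<Omega> = c"
    unfolding principal_eigenvalue_def
  proof (rule Least_equality)
    have "\<not> (AE x in M. u x = 0)"
    proof
      assume "AE x in M. u x = 0"
      then have "L2.N M u = L2.N M (\<lambda>x. 0)" using uH(2) by (intro N_AE_cong) (auto intro: L2_measurable)
      then show False using u(2) by (simp add: L2.N_def ip_def)
    qed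
    then show "dirichlet_eigenvalue \<Omega> c"
      unfolding dirichlet_eigenvalue_def
      using u(1) weak integral_grad_inner[OF uH(1) H10_H1] by (intro bexI[of _ u]) (auto simp: ip_def)
    fix \<mu> assume "dirichlet_eigenvalue \<Omega> \<mu>"
    then obtain w where w: "w \<in> H10 \<Omega>" "\<not> (AE x in M. w x = 0)"
      "(\<integral>x. weak_grad \<Omega> w x \<bullet> weak_grad \<Omega> w x \<partial>M) = \<mu> * (\<integral>x. w x * w x \<partial>M)"
      unfolding dirichlet_eigenvalue_def by blast
    have wH: "w \<in> H1 \<Omega>" "w \<in> L2 M" using w H10_H1 H1_L2 by auto
    have "(D.N w)\<^sup>2 = \<mu> * (L2.N M w)\<^sup>2"
      using w(3) wH by (simp add: integral_grad_inner D.N_sq L2.N_sq ip_def)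
    then have "c * (L2.N M w)\<^sup>2 \<le> \<mu> * (L2.N M w)\<^sup>2" using le[OF w(1)] by simp
    moreover have "L2.N M w \<noteq> 0" using N_zero_AE[OF wH(2)] w(2) by blast
    ultimately show "c \<le> \<mu>" by simp
  qed
  then show ?thesis using le[OF v] by simp
qed simp

end

section \<open>The nonlinear term\<close>

text \<open>At the origin the difference quotient is \<open>\<bar>h\<bar> powr r\<close>, which
  tends to zero because \<open>0 < r\<close>.\<close>

lemma abs_powr_mult_has_derivative:
  fixes r y :: real
  assumes "0 < r"
  shows "((\<lambda>y. \<bar>y\<bar> powr r * y) has_real_derivative (r + 1) * \<bar>y\<bar> powr r) (at y)"
proof -
  consider "0 < y" | "y < 0" | "y = 0" by linarith
  then show ?thesis
  proof cases
    case 1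
    have "((\<lambda>y. y powr r * y) has_real_derivative (r + 1) * \<bar>y\<bar> powr r) (at y)"
      using 1 by (auto intro!: derivative_eq_intros simp: powr_diff field_simps)
    then show ?thesis
      by (rule has_field_derivative_transform_within_open[where S = "{0<..}"]) (use 1 in auto)
  next
    case 2
    have "((\<lambda>y. (- y) powr r * y) has_real_derivative (r + 1) * \<bar>y\<bar> powr r) (at y)"
      using 2 by (auto intro!: derivative_eq_intros simp: powr_diff field_simps)
    then show ?thesis
      by (rule has_field_derivative_transform_within_open[where S = "{..<0}"]) (use 2 in auto)
  next
    case 3
    have "((\<lambda>h. \<bar>h\<bar> powr r) \<longlongrightarrow> \<bar>0\<bar> powr r) (at 0)"
      using assms by (intro tendsto_powr' tendsto_intros) auto
    then have "((\<lambda>h. \<bar>h\<bar> powr r * h / h) \<longlongrightarrow> 0) (at 0)"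
      using assms by (auto elim!: Lim_transform_eventually simp: eventually_at_filter)
    then show ?thesis using 3 assms by (simp add: has_field_derivative_iff)
  qed
qed

lemma abs_powr_has_derivative:
  fixes p y :: real
  assumes "1 < p"
  shows "((\<lambda>y. \<bar>y\<bar> powr (p + 1) / (p + 1)) has_real_derivative \<bar>y\<bar> powr (p - 1) * y) (at y)"
proof -
  have "\<bar>y\<bar> powr (p + 1) = \<bar>y\<bar> powr (p - 1) * y * y" for y :: real
  proof -
    have "\<bar>y\<bar> powr (p + 1) = \<bar>y\<bar> powr (p - 1) * \<bar>y\<bar> powr 2"
      by (subst powr_add[symmetric]) (simp add: add.commute)
    then show ?thesis by (simp add: power2_eq_square mult.assoc)
  qed
  moreover have "((\<lambda>y. \<bar>y\<bar> powr (p - 1) * y * y / (p + 1)) has_real_derivative \<bar>y\<bar> powr (p - 1) * y) (at y)"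
  proof -
    have "((\<lambda>y. \<bar>y\<bar> powr (p - 1) * y * y) has_real_derivative p * \<bar>y\<bar> powr (p - 1) * y + 1 * (\<bar>y\<bar> powr (p - 1) * y)) (at y)"
      using DERIV_mult[OF abs_powr_mult_has_derivative[of "p - 1" y] DERIV_ident] assms by simp
    moreover have "p * \<bar>y\<bar> powr (p - 1) * y + 1 * (\<bar>y\<bar> powr (p - 1) * y) = \<bar>y\<bar> powr (p - 1) * y * (p + 1)"
      by (simp add: algebra_simps)
    ultimately show ?thesis
      using DERIV_cdivide[of "\<lambda>y. \<bar>y\<bar> powr (p - 1) * y * y" _ y UNIV "p + 1"] assms by fastforce
  qed
  ultimately show ?thesis by simp
qed

lemma abs_powr_Lipschitz:
  fixes p x y R :: real
  assumes p: "1 < p" and R: "\<bar>x\<bar> \<le> R" "\<bar>y\<bar> \<le> R"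
  shows "\<bar>\<bar>y\<bar> powr (p - 1) * y - \<bar>x\<bar> powr (p - 1) * x\<bar> \<le> p * R powr (p - 1) * \<bar>y - x\<bar>"
proof -
  have "norm (\<bar>y\<bar> powr (p - 1) * y - \<bar>x\<bar> powr (p - 1) * x) \<le> (p * R powr (p - 1)) * norm (y - x)"
  proof (rule field_differentiable_bound[where S = "{-R..R}" and f' = "\<lambda>z. p * \<bar>z\<bar> powr (p - 1)"])
    show "((\<lambda>z. \<bar>z\<bar> powr (p - 1) * z) has_field_derivative p * \<bar>z\<bar> powr (p - 1)) (at z within {-R..R})" for z
      using abs_powr_mult_has_derivative[of "p - 1" z] p by (simp add: has_field_derivative_at_within)
    show "norm (p * \<bar>z\<bar> powr (p - 1)) \<le> p * R powr (p - 1)" if "z \<in> {-R..R}" for z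
    proof -
      have "\<bar>z\<bar> powr (p - 1) \<le> R powr (p - 1)" using that p by (intro powr_mono2) auto
      then show ?thesis using p by (simp add: abs_mult)
    qed
    show "x \<in> {-R..R}" "y \<in> {-R..R}" using R by (simp_all add: abs_le_iff)
  qed simp
  then show ?thesis by simp
qed

text \<open>The derivative is locally Lipschitz, so a first-order expansion has a quadratic
  remainder; the explicit weight makes it integrable over the domain later.\<close>

lemma abs_powr_Taylor:
  fixes p x y :: real
  assumes p: "1 < p"
  shows "\<bar>\<bar>y\<bar> powr (p + 1) / (p + 1) - \<bar>x\<bar> powr (p + 1) / (p + 1) - \<bar>x\<bar> powr (p - 1) * x * (y - x)\<bar>
    \<le> p * (\<bar>x\<bar> + \<bar>y\<bar>) powr (p - 1) * (y - x)\<^sup>2"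
proof -
  define B where "B = p * (\<bar>x\<bar> + \<bar>y\<bar>) powr (p - 1) * \<bar>y - x\<bar>"
  \<comment> \<open>Subtracting the linear part makes the derivative vanish at \<open>x\<close>, so
    on the segment it is bounded by the Lipschitz estimate alone.\<close>
  let ?g = "\<lambda>z. \<bar>z\<bar> powr (p + 1) / (p + 1) - \<bar>x\<bar> powr (p - 1) * x * z"
  have "norm (?g y - ?g x) \<le> B * norm (y - x)"
  proof (rule field_differentiable_bound[where S = "closed_segment x y"
      and f' = "\<lambda>z. \<bar>z\<bar> powr (p - 1) * z - \<bar>x\<bar> powr (p - 1) * x"])
    show "(?g has_field_derivative \<bar>z\<bar> powr (p - 1) * z - \<bar>x\<bar> powr (p - 1) * x) (at z within closed_segment x y)" for z
      by (rule has_field_derivative_at_within[OF DERIV_diff[OF abs_powr_has_derivative[OF p] DERIV_cmult_Id]])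
    show "norm (\<bar>z\<bar> powr (p - 1) * z - \<bar>x\<bar> powr (p - 1) * x) \<le> B" if "z \<in> closed_segment x y" for z
    proof -
      have z: "\<bar>z - x\<bar> \<le> \<bar>y - x\<bar>" "\<bar>z\<bar> \<le> \<bar>x\<bar> + \<bar>y\<bar>"
        using that by (auto simp: closed_segment_eq_real_ivl split: if_splits)
      have "norm (\<bar>z\<bar> powr (p - 1) * z - \<bar>x\<bar> powr (p - 1) * x) \<le> p * (\<bar>x\<bar> + \<bar>y\<bar>) powr (p - 1) * \<bar>z - x\<bar>"
        using abs_powr_Lipschitz[OF p _ z(2), of x] by simp
      also have "\<dots> \<le> B" unfolding B_def using z p by (intro mult_left_mono) auto
      finally show ?thesis .
    qed
  qed auto
  moreover have "?g y - ?g x = \<bar>y\<bar> powr (p + 1) / (p + 1) - \<bar>x\<bar> powr (p + 1) / (p + 1) - \<bar>x\<bar> powr (p - 1) * x * (y - x)"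
    by (simp add: algebra_simps)
  moreover have "B * norm (y - x) = p * (\<bar>x\<bar> + \<bar>y\<bar>) powr (p - 1) * (y - x)\<^sup>2"
    by (simp add: B_def power2_eq_square)
  ultimately show ?thesis by simp
qed

lemma add_powr_le:
  fixes x y r :: real
  assumes "0 \<le> x" "0 \<le> y" "0 < r"
  shows "(x + y) powr r \<le> 2 powr r * (x powr r + y powr r)"
proof -
  have "(x + y) powr r \<le> (2 * max x y) powr r" using assms by (intro powr_mono2) auto
  also have "\<dots> = 2 powr r * max x y powr r" using assms by (simp add: powr_mult)
  also have "max x y powr r \<le> x powr r + y powr r" using assms by (auto simp: max_def)
  finally show ?thesis by simp
qed

section \<open>The potential of the nonlinear term along curves\<close>

context bounded_open
begin

definition Phi :: "real \<Rightarrow> (real^3 \<Rightarrow> real) \<Rightarrow> real" where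
  "Phi p x = (\<integral>z. \<bar>x z\<bar> powr (p + 1) / (p + 1) \<partial>M)"

lemma powr_L2:
  assumes x: "x \<in> H10 \<Omega>" and r: "0 < r" "r \<le> 3"
  shows "(\<lambda>z. \<bar>x z\<bar> powr r) \<in> L2 M"
    "L2.N M (\<lambda>z. \<bar>x z\<bar> powr r) \<le> sqrt embed_const * D.N x powr r"
proof -
  have [measurable]: "x \<in> borel_measurable M" using L2_measurable[OF H1_L2[OF H10_H1[OF x]]] .
  have sq: "(\<bar>x z\<bar> powr r)\<^sup>2 = \<bar>x z\<bar> powr (2 * r)" for z
    by (simp add: power2_eq_square flip: powr_add)
  have i: "integrable M (\<lambda>z. (\<bar>x z\<bar> powr r)\<^sup>2)"
    unfolding sq using Lr_embedding(1)[OF x, of "2 * r"] r by simp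
  then show L: "(\<lambda>z. \<bar>x z\<bar> powr r) \<in> L2 M" by (simp add: L2_def)
  have "(L2.N M (\<lambda>z. \<bar>x z\<bar> powr r))\<^sup>2 \<le> embed_const * D.N x powr (2 * r)"
    unfolding N_sq_integral[OF L] sq using Lr_embedding(2)[OF x, of "2 * r"] r by simp
  also have "\<dots> = (sqrt embed_const * D.N x powr r)\<^sup>2"
  proof -
    have "(D.N x powr r)\<^sup>2 = D.N x powr (2 * r)" by (simp add: power2_eq_square flip: powr_add)
    then show ?thesis using embed_const_pos by (simp add: power_mult_distrib)
  qed
  finally show "L2.N M (\<lambda>z. \<bar>x z\<bar> powr r) \<le> sqrt embed_const * D.N x powr r"
    by (rule power2_le_imp_le) (use embed_const_pos in simp)
qed

text \<open>Its square is that of \<open>\<bar>x z\<bar> powr p\<close>, whose integrability has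
  exponent \<open>2 * p < 6\<close>, inside the Sobolev range.\<close>

lemma nonlinearity_L2:
  assumes x: "x \<in> H10 \<Omega>" and p: "1 < p" "p < 3"
  shows "(\<lambda>z. \<bar>x z\<bar> powr (p - 1) * x z) \<in> L2 M"
proof -
  have [measurable]: "x \<in> borel_measurable M" using L2_measurable[OF H1_L2[OF H10_H1[OF x]]] .
  show ?thesis
  proof (rule L2_bound[OF _ L2_integrable_sq[OF powr_L2(1)[OF x, of p]]])
    have "(\<bar>y\<bar> powr (p - 1) * y)\<^sup>2 = (\<bar>y\<bar> powr p)\<^sup>2" for y :: real
    proof (cases "y = 0")
      case False
      then have "\<bar>y\<bar> powr p = \<bar>y\<bar> powr (p - 1) * \<bar>y\<bar>" by (simp add: powr_diff)
      then show ?thesis by (simp add: power_mult_distrib)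
    qed simp
    then show "AE z in M. (\<bar>x z\<bar> powr (p - 1) * x z)\<^sup>2 \<le> (\<bar>x z\<bar> powr p)\<^sup>2" by simp
  qed (use p in auto)
qed

text \<open>The pointwise remainder is a weight of order \<open>p - 1\<close> times the squared
  increment. Cauchy--Schwarz separates them; the Sobolev embedding then handles the weight in L2 and
  the increment in L4.\<close>

lemma Phi_Taylor:
  assumes x: "x \<in> H10 \<Omega>" and y: "y \<in> H10 \<Omega>" and p: "1 < p" "p < 3"
  shows "\<bar>Phi p y - Phi p x - ip M (\<lambda>z. \<bar>x z\<bar> powr (p - 1) * x z) (\<lambda>z. y z - x z)\<bar>
    \<le> p * 2 powr (p - 1) * embed_const * (D.N x powr (p - 1) + D.N y powr (p - 1)) * (D.N (\<lambda>z. y z - x z))\<^sup>2"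
proof -
  let ?d = "\<lambda>z. y z - x z" and ?f = "\<lambda>z. \<bar>x z\<bar> powr (p - 1) * x z"
  have dH: "?d \<in> H10 \<Omega>" by (rule H10_diff[OF y x])
  have [measurable]: "x \<in> borel_measurable M" "y \<in> borel_measurable M"
    using L2_measurable[OF H1_L2[OF H10_H1]] x y by auto
  have X: "(\<lambda>z. \<bar>x z\<bar> powr (p - 1)) \<in> L2 M"
    "L2.N M (\<lambda>z. \<bar>x z\<bar> powr (p - 1)) \<le> sqrt embed_const * D.N x powr (p - 1)"
    using powr_L2[OF x, of "p - 1"] p by auto
  have Y: "(\<lambda>z. \<bar>y z\<bar> powr (p - 1)) \<in> L2 M"
    "L2.N M (\<lambda>z. \<bar>y z\<bar> powr (p - 1)) \<le> sqrt embed_const * D.N y powr (p - 1)"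
    using powr_L2[OF y, of "p - 1"] p by auto
  have D2: "(\<lambda>z. (?d z)\<^sup>2) \<in> L2 M" "L2.N M (\<lambda>z. (?d z)\<^sup>2) \<le> sqrt embed_const * (D.N ?d)\<^sup>2"
    using powr_L2[OF dH, of 2] D.N_nonneg[OF H10_H1[OF dH]] by auto
  define R where "R z = 2 powr (p - 1) * (\<bar>x z\<bar> powr (p - 1) + \<bar>y z\<bar> powr (p - 1))" for z
  have RL: "R \<in> L2 M" unfolding R_def by (intro L2_scale L2_add X Y)
  have RN: "L2.N M R \<le> 2 powr (p - 1) * (sqrt embed_const * (D.N x powr (p - 1) + D.N y powr (p - 1)))"
  proof -
    have "L2.N M R = 2 powr (p - 1) * L2.N M (\<lambda>z. \<bar>x z\<bar> powr (p - 1) + \<bar>y z\<bar> powr (p - 1))"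
      unfolding R_def by (subst L2.N_scale) (auto intro!: L2_add X Y)
    also have "\<dots> \<le> 2 powr (p - 1) * (sqrt embed_const * (D.N x powr (p - 1) + D.N y powr (p - 1)))"
      using L2.N_triangle[OF X(1) Y(1)] X(2) Y(2) by (intro mult_left_mono) (auto simp: distrib_left)
    finally show ?thesis .
  qed
  have i: "integrable M (\<lambda>z. \<bar>x z\<bar> powr (p + 1) / (p + 1))" "integrable M (\<lambda>z. \<bar>y z\<bar> powr (p + 1) / (p + 1))"
    using Lr_embedding(1)[OF x, of "p + 1"] Lr_embedding(1)[OF y, of "p + 1"] p by auto
  have i2: "integrable M (\<lambda>z. ?f z * ?d z)"
    by (rule L2_integrable_mult[OF nonlinearity_L2[OF x p] H1_L2[OF H10_H1[OF dH]]])
  let ?h = "\<lambda>z. \<bar>y z\<bar> powr (p + 1) / (p + 1) - \<bar>x z\<bar> powr (p + 1) / (p + 1) - ?f z * ?d z"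
  have ih: "integrable M ?h" using i i2 by auto
  have i3: "integrable M (\<lambda>z. R z * (?d z)\<^sup>2)" by (rule L2_integrable_mult[OF RL D2(1)])
  have "\<bar>Phi p y - Phi p x - ip M ?f ?d\<bar> = \<bar>\<integral>z. ?h z \<partial>M\<bar>"
    using i i2 by (simp add: Phi_def ip_def)
  also have "\<dots> \<le> (\<integral>z. \<bar>?h z\<bar> \<partial>M)" by (rule integral_abs_bound)
  also have "\<dots> \<le> (\<integral>z. p * (R z * (?d z)\<^sup>2) \<partial>M)"
  proof (rule integral_mono)
    fix z
    have "\<bar>?h z\<bar> \<le> p * (\<bar>x z\<bar> + \<bar>y z\<bar>) powr (p - 1) * (?d z)\<^sup>2"
      by (rule abs_powr_Taylor[OF p(1)])
    also have "\<dots> \<le> p * R z * (?d z)\<^sup>2"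
      unfolding R_def using p by (intro mult_right_mono mult_left_mono add_powr_le) auto
    finally show "\<bar>?h z\<bar> \<le> p * (R z * (?d z)\<^sup>2)" by (simp add: mult.assoc)
  qed (use ih i3 in auto)
  also have "\<dots> = p * ip M R (\<lambda>z. (?d z)\<^sup>2)" by (simp add: ip_def)
  also have "\<dots> \<le> p * (L2.N M R * L2.N M (\<lambda>z. (?d z)\<^sup>2))"
    using L2.Cauchy_Schwarz[OF RL D2(1)] p by (intro mult_left_mono) auto
  also have "\<dots> \<le> p * (2 powr (p - 1) * (sqrt embed_const * (D.N x powr (p - 1) + D.N y powr (p - 1)))
      * (sqrt embed_const * (D.N ?d)\<^sup>2))"
    using p embed_const_pos L2.N_nonneg[OF D2(1)] by (intro mult_left_mono mult_mono RN D2(2)) auto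
  also have "\<dots> = p * 2 powr (p - 1) * (sqrt embed_const * sqrt embed_const)
      * (D.N x powr (p - 1) + D.N y powr (p - 1)) * (D.N ?d)\<^sup>2"
    by (simp only: ac_simps)
  also have "sqrt embed_const * sqrt embed_const = embed_const" using embed_const_pos by simp
  finally show ?thesis .
qed

text \<open>Divided by \<open>s - t\<close>, the quadratic remainder still carries a factor
  \<open>\<bar>s - t\<bar>\<close> in front of bounded quantities. Convergence of the quotients in
  the H1 norm gives both the L2 limit of the linear term and the Dirichlet bound of the
  remainder.\<close>

lemma Phi_has_derivative:
  assumes uH: "\<And>s. s \<in> I \<Longrightarrow> u s \<in> H10 \<Omega>" and v: "v \<in> H10 \<Omega>" and t: "t \<in> I" and p: "1 < p" "p < 3"
    and lim: "((\<lambda>s. W.N (\<lambda>x. (u s x - u t x) / (s - t) - v x)) \<longlongrightarrow> 0) (at t within I)"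
  shows "((\<lambda>s. Phi p (u s)) has_real_derivative ip M (\<lambda>z. \<bar>u t z\<bar> powr (p - 1) * u t z) v) (at t within I)"
proof -
  define d where "d s = (\<lambda>x. (u s x - u t x) / (s - t))" for s
  define C where "C = p * 2 powr (p - 1) * embed_const"
  let ?f = "\<lambda>z. \<bar>u t z\<bar> powr (p - 1) * u t z"
  have ut: "u t \<in> H10 \<Omega>" using assms by auto
  have fL: "?f \<in> L2 M" by (rule nonlinearity_L2[OF ut p])
  have vH: "v \<in> H1 \<Omega>" using v H10_H1 by auto
  have ev: "\<forall>\<^sub>F s in at t within I. s \<in> I \<and> s \<noteq> t"
    by (auto simp: eventually_at_filter)
  have dH: "\<forall>\<^sub>F s in at t within I. d s \<in> H1 \<Omega>"
    using ev by eventually_elim (simp add: d_def D.quotient_mem[OF H10_H1[OF uH] H10_H1[OF ut]])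
  have W: "((\<lambda>s. W.N (\<lambda>x. d s x - v x)) \<longlongrightarrow> 0) (at t within I)" using lim by (simp add: d_def)
  have LN: "((\<lambda>s. L2.N M (\<lambda>x. d s x - v x)) \<longlongrightarrow> 0) (at t within I)"
    by (rule Lim_null_comparison[OF _ W], use dH in eventually_elim)
      (use vH N_le_W D.diff_mem L2.N_nonneg[OF H1_L2[OF D.diff_mem]] in \<open>auto\<close>)
  have DN: "((\<lambda>s. D.N (\<lambda>x. d s x - v x)) \<longlongrightarrow> 0) (at t within I)"
    by (rule Lim_null_comparison[OF _ W], use dH in eventually_elim)
      (use vH D_le_W D.diff_mem D.N_nonneg[OF D.diff_mem] in \<open>auto\<close>)
  have 1: "((\<lambda>s. ip M ?f (d s)) \<longlongrightarrow> ip M ?f v) (at t within I)"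
    using dH H1_L2 vH LN fL by (intro L2.tendsto_B) (auto elim!: eventually_mono)
  have 2: "((\<lambda>s. D.N (d s)) \<longlongrightarrow> D.N v) (at t within I)"
    by (rule D.tendsto_N[OF dH vH DN])
  have Ddiff: "\<forall>\<^sub>F s in at t within I. D.N (\<lambda>x. u s x - u t x) = \<bar>s - t\<bar> * D.N (d s)"
    using ev dH
  proof eventually_elim
    case (elim s)
    then have "(\<lambda>x. u s x - u t x) = (\<lambda>x. (s - t) * d s x)" by (auto simp: d_def)
    then show ?case using D.N_scale[of "d s" "s - t"] elim by simp
  qed
  have st: "((\<lambda>s. \<bar>s - t\<bar>) \<longlongrightarrow> 0) (at t within I)"
    using tendsto_rabs[OF tendsto_diff[OF tendsto_ident_at tendsto_const], of t t I] by simp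
  have "((\<lambda>s. D.N (\<lambda>x. u s x - u t x)) \<longlongrightarrow> 0) (at t within I)"
    using tendsto_mult[OF st 2] Ddiff by (auto elim!: Lim_transform_eventually[rotated] simp: eq_commute)
  then have 3: "((\<lambda>s. D.N (u s)) \<longlongrightarrow> D.N (u t)) (at t within I)"
    using ev uH ut H10_H1 by (intro D.tendsto_N) (auto elim!: eventually_mono)
  have 4: "((\<lambda>s. D.N (u s) powr (p - 1)) \<longlongrightarrow> D.N (u t) powr (p - 1)) (at t within I)"
    using p D.N_nonneg[OF H10_H1[OF ut]] ev uH
    by (intro tendsto_powr' 3 tendsto_const) (auto elim!: eventually_mono intro!: D.N_nonneg H10_H1)
  have 5: "((\<lambda>s. C * (D.N (u t) powr (p - 1) + D.N (u s) powr (p - 1)) * (\<bar>s - t\<bar> * (D.N (d s))\<^sup>2)) \<longlongrightarrow>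
      C * (D.N (u t) powr (p - 1) + D.N (u t) powr (p - 1)) * (0 * (D.N v)\<^sup>2)) (at t within I)"
    by (intro tendsto_intros 4 2 st)
  have "((\<lambda>s. (Phi p (u s) - Phi p (u t)) / (s - t) - ip M ?f (d s)) \<longlongrightarrow> 0) (at t within I)"
  proof (rule Lim_null_comparison)
    show "((\<lambda>s. C * (D.N (u t) powr (p - 1) + D.N (u s) powr (p - 1)) * (\<bar>s - t\<bar> * (D.N (d s))\<^sup>2)) \<longlongrightarrow> 0) (at t within I)"
      using 5 by simp
    show "\<forall>\<^sub>F s in at t within I. norm ((Phi p (u s) - Phi p (u t)) / (s - t) - ip M ?f (d s))
        \<le> C * (D.N (u t) powr (p - 1) + D.N (u s) powr (p - 1)) * (\<bar>s - t\<bar> * (D.N (d s))\<^sup>2)"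
      using ev dH Ddiff
    proof eventually_elim
      case (elim s)
      define A where "A = D.N (u t) powr (p - 1) + D.N (u s) powr (p - 1)"
      have eq: "(\<lambda>x. u s x - u t x) = (\<lambda>x. (s - t) * d s x)" using elim by (auto simp: d_def)
      have ipd: "ip M ?f (\<lambda>x. u s x - u t x) = (s - t) * ip M ?f (d s)"
        unfolding eq using L2.B_scale_right[OF H1_L2[OF elim(2)] fL] .
      have "\<bar>Phi p (u s) - Phi p (u t) - (s - t) * ip M ?f (d s)\<bar> \<le> C * A * (\<bar>s - t\<bar> * D.N (d s))\<^sup>2"
        using Phi_Taylor[OF ut uH p, of s] elim unfolding ipd C_def A_def by simp
      then have "\<bar>Phi p (u s) - Phi p (u t) - (s - t) * ip M ?f (d s)\<bar> / \<bar>s - t\<bar>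
          \<le> C * A * (\<bar>s - t\<bar> * D.N (d s))\<^sup>2 / \<bar>s - t\<bar>"
        by (rule divide_right_mono) simp
      also have "\<dots> = C * A * (\<bar>s - t\<bar> * (D.N (d s))\<^sup>2)"
        using elim by (simp add: power2_eq_square)
      also have "\<bar>Phi p (u s) - Phi p (u t) - (s - t) * ip M ?f (d s)\<bar> / \<bar>s - t\<bar>
          = norm ((Phi p (u s) - Phi p (u t)) / (s - t) - ip M ?f (d s))"
        using elim by (simp add: diff_divide_distrib flip: abs_divide)
      finally show ?case by (simp add: A_def)
    qed
  qed
  from tendsto_add[OF this 1] show ?thesis
    unfolding has_field_derivative_iff by simp
qed

end

section \<open>Conservation of energy\<close>

lemma time_interval_ge:
  assumes "t \<in> time_interval T" "0 \<le> s" "s \<le> t"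
  shows "s \<in> time_interval T"
  using assms unfolding time_interval_def by (auto intro: le_less_trans[of "ereal s" "ereal t"])

lemma time_interval_extend:
  assumes "t \<in> time_interval T"
  obtains t' where "t < t'" "t' \<in> time_interval T"
proof -
  from assms have "ereal t < T" by (simp add: time_interval_def)
  then obtain t' where "ereal t < ereal t'" "ereal t' < T" using ereal_dense2 by blast
  then show thesis using that[of t'] assms by (auto simp: time_interval_def)
qed

text \<open>Without this, limits within the interval would be vacuous and derivatives of curves not
  unique; it includes the left end point.\<close>

lemma time_interval_nontrivial:
  assumes t: "t \<in> time_interval T"
  shows "at t within time_interval T \<noteq> bot"
proof -
  obtain t' where t': "t < t'" "t' \<in> time_interval T" using time_interval_extend[OF t] .
  have "{t<..<t'} \<subseteq> time_interval T"
    using t t' time_interval_ge[OF t'(2)] by (auto simp: time_interval_def)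
  then have "t islimpt time_interval T" using islimpt_greaterThanLessThan1[OF t'(1)] islimpt_subset by blast
  then show ?thesis using trivial_limit_within by blast
qed

lemma time_interval_at:
  assumes t: "t \<in> time_interval T" "0 < t"
  shows "at t within time_interval T = at t"
proof -
  obtain t' where t': "t < t'" "t' \<in> time_interval T" using time_interval_extend[OF t(1)] .
  have "{0<..<t'} \<subseteq> time_interval T" using time_interval_ge[OF t'(2)] by auto
  moreover have "t \<in> {0<..<t'}" using t t' by auto
  ultimately have "t \<in> interior (time_interval T)" by (meson interiorI open_greaterThanLessThan)
  then show ?thesis by (rule at_within_interior)
qed

context bounded_open
begin

text \<open>Uniqueness of L2 limits. It makes the choice in \<open>time_deriv\<close> immaterial and
  identifies the derivative in \<open>H10\<close> with the one in L2.\<close>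

lemma L2_curve_deriv_AE:
  assumes u: "\<And>s. s \<in> I \<Longrightarrow> u s \<in> L2 M" and t: "t \<in> I" "at t within I \<noteq> bot"
    and v: "has_curve_deriv (Lp 2 \<Omega>) (Lp_norm 2 \<Omega>) I u t v" and w: "has_curve_deriv (Lp 2 \<Omega>) (Lp_norm 2 \<Omega>) I u t w"
  shows "AE x in M. v x = w x"
proof -
  define q where "q s = (\<lambda>x. (u s x - u t x) / (s - t))" for s
  have v': "v \<in> L2 M" "((\<lambda>s. L2.N M (\<lambda>x. q s x - v x)) \<longlongrightarrow> 0) (at t within I)"
    using v by (auto simp: has_curve_deriv_def Lp_2 Lp_norm_2 q_def)
  have w': "w \<in> L2 M" "((\<lambda>s. L2.N M (\<lambda>x. q s x - w x)) \<longlongrightarrow> 0) (at t within I)"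
    using w by (auto simp: has_curve_deriv_def Lp_2 Lp_norm_2 q_def)
  have dL: "(\<lambda>x. v x - w x) \<in> L2 M" by (rule L2.diff_mem[OF v'(1) w'(1)])
  have "\<forall>\<^sub>F s in at t within I. L2.N M (\<lambda>x. v x - w x) \<le> L2.N M (\<lambda>x. q s x - v x) + L2.N M (\<lambda>x. q s x - w x)"
    unfolding eventually_at_filter
  proof (intro always_eventually allI impI)
    fix s assume "s \<noteq> t" "s \<in> I"
    then have qL: "q s \<in> L2 M" unfolding q_def by (intro L2.quotient_mem u t)
    have "L2.N M (\<lambda>x. (v x - q s x) + (q s x - w x)) \<le> L2.N M (\<lambda>x. v x - q s x) + L2.N M (\<lambda>x. q s x - w x)"
      by (rule L2.N_triangle[OF L2.diff_mem[OF v'(1) qL] L2.diff_mem[OF qL w'(1)]])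
    then show "L2.N M (\<lambda>x. v x - w x) \<le> L2.N M (\<lambda>x. q s x - v x) + L2.N M (\<lambda>x. q s x - w x)"
      by (simp add: L2.N_minus[OF v'(1) qL])
  qed
  moreover have "((\<lambda>s. L2.N M (\<lambda>x. q s x - v x) + L2.N M (\<lambda>x. q s x - w x)) \<longlongrightarrow> 0) (at t within I)"
    using tendsto_add[OF v'(2) w'(2)] by simp
  ultimately have "L2.N M (\<lambda>x. v x - w x) \<le> 0"
    by (rule tendsto_lowerbound[OF _ _ t(2), rotated])
  then have "L2.N M (\<lambda>x. v x - w x) = 0" using L2.N_nonneg[OF dL] by simp
  from N_zero_AE[OF dL this] show ?thesis by simp
qed

lemma time_deriv_AE:
  assumes u: "\<And>s. s \<in> time_interval T \<Longrightarrow> u s \<in> L2 M" and t: "t \<in> time_interval T"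
    and w: "has_curve_deriv (Lp 2 \<Omega>) (Lp_norm 2 \<Omega>) (time_interval T) u t w"
  shows "AE x in M. time_deriv \<Omega> T u t x = w x" "time_deriv \<Omega> T u t \<in> L2 M"
proof -
  have "has_curve_deriv (Lp 2 \<Omega>) (Lp_norm 2 \<Omega>) (time_interval T) u t (time_deriv \<Omega> T u t)"
    unfolding time_deriv_def
    using w by (rule someI[of "has_curve_deriv (Lp 2 \<Omega>) (Lp_norm 2 \<Omega>) (time_interval T) u t"])
  then show "AE x in M. time_deriv \<Omega> T u t x = w x" "time_deriv \<Omega> T u t \<in> L2 M"
    using L2_curve_deriv_AE[OF u t time_interval_nontrivial[OF t] _ w]
    by (auto simp: has_curve_deriv_def Lp_2)
qed

text \<open>Squared norms appear as quadratic forms, so that \<open>has_derivative_square\<close>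
  covers every term except \<open>Phi\<close>.\<close>

definition energy :: "real \<Rightarrow> real \<Rightarrow> real \<Rightarrow> real \<Rightarrow> (real^3 \<Rightarrow> real) \<Rightarrow> (real^3 \<Rightarrow> real) \<Rightarrow> real" where
  "energy a b lam p u w = 1 / 2 * ip M w w + a / 4 * (dip \<Omega> u u)\<^sup>2 + b / 2 * dip \<Omega> u u
     - lam / 2 * ip M u u - Phi p u"

lemma H2_partial:
  assumes "f \<in> H2 \<Omega>"
  shows "weak_partial \<Omega> i f \<in> H1 \<Omega>"
proof -
  obtain g where g: "g \<in> H1 \<Omega>" "is_weak_partial \<Omega> i f g" using assms by (auto simp: H2_def)
  have "AE x in M. g x = weak_partial \<Omega> i f x"
    using weak_partial_AE[OF open_dom g(2)] by (simp add: eq_commute)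
  from H1_AE(1)[OF g(1) this] show ?thesis .
qed

text \<open>The equation is tested with the velocity, in the guise of its \<open>H\<^sub>0\<^sup>1\<close> representative \<open>v\<close>.\<close>

lemma energy_derivative_zero:
  assumes u: "u \<in> H10 \<Omega>" "u \<in> H2 \<Omega>" and v: "v \<in> H10 \<Omega>" and w: "w \<in> L2 M" "AE x in M. v x = w x"
    and z: "z \<in> L2 M" and p: "1 < p" "p < 3"
    and pde: "AE x in M. z x - (a * dip \<Omega> u u + b) * weak_laplacian \<Omega> u x
        = lam * u x + \<bar>u x\<bar> powr (p - 1) * u x"
  shows "ip M w z + a * dip \<Omega> u u * dip \<Omega> u v + b * dip \<Omega> u v - lam * ip M u v
    - ip M (\<lambda>x. \<bar>u x\<bar> powr (p - 1) * u x) v = 0"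
proof -
  define c where "c = a * dip \<Omega> u u + b"
  let ?f = "\<lambda>x. \<bar>u x\<bar> powr (p - 1) * u x" and ?L = "weak_laplacian \<Omega> u"
  have uH: "u \<in> H1 \<Omega>" "u \<in> L2 M" and vL: "v \<in> L2 M" using u v H10_H1 H1_L2 by auto
  have fL: "?f \<in> L2 M" by (rule nonlinearity_L2[OF u(1) p])
  have LL: "?L \<in> L2 M" by (rule laplacian_L2[OF H2_partial[OF u(2)]])
  have rhs: "(\<lambda>x. (c * ?L x + lam * u x) + ?f x) \<in> L2 M"
    by (intro L2_add L2_scale LL uH fL)
  have "ip M z v = ip M (\<lambda>x. (c * ?L x + lam * u x) + ?f x) v"
  proof (rule ip_AE_cong)
    show "AE x in M. z x = (c * ?L x + lam * u x) + ?f x"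
      using pde by eventually_elim (simp add: c_def algebra_simps)
  qed (use L2_measurable[OF z] L2_measurable[OF rhs] L2_measurable[OF vL] in auto)
  also have "\<dots> = c * ip M ?L v + lam * ip M u v + ip M ?f v"
    by (simp add: L2.B_add L2.B_scale L2_add L2_scale LL uH fL vL)
  also have "ip M ?L v = - dip \<Omega> u v" by (rule Green[OF uH(1) H2_partial[OF u(2)] v])
  finally have "ip M z v = - c * dip \<Omega> u v + lam * ip M u v + ip M ?f v" by simp
  moreover have "ip M w z = ip M z v"
  proof -
    have "ip M w z = ip M v z"
      by (rule ip_AE_cong) (use L2_measurable[OF z] L2_measurable[OF w(1)] L2_measurable[OF vL] w(2) in \<open>auto simp: eq_commute\<close>)
    then show ?thesis by (simp add: ip_sym)
  qed
  ultimately show ?thesis by (simp add: c_def algebra_simps)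
qed

text \<open>Differentiating the energy termwise produces exactly the expression that
  \<open>energy_derivative_zero\<close> shows to vanish. The remaining work is to match the
  representatives of the velocity and of the acceleration.\<close>

lemma kirchhoff_energy:
  assumes sol: "kirchhoff_solution \<Omega> a b lam p u0 u1 T u" and p: "1 < p" "p < 3"
  shows "\<And>t. t \<in> time_interval T \<Longrightarrow> u t \<in> H10 \<Omega>"
    and "\<And>t. t \<in> time_interval T \<Longrightarrow> time_deriv \<Omega> T u t \<in> L2 M"
    and "\<And>t. t \<in> time_interval T \<Longrightarrow> energy a b lam p (u t) (time_deriv \<Omega> T u t)
      = energy a b lam p (u 0) (time_deriv \<Omega> T u 0)"
    and "continuous_on (time_interval T) (\<lambda>t. D.N (u t))"
proof -
  define I where "I = time_interval T"
  have T: "0 < T" and sp: "u \<in> solution_space \<Omega> T" using sol by (auto simp: kirchhoff_solution_def)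
  have uH: "u t \<in> H10 \<Omega>" "u t \<in> H2 \<Omega>" if "t \<in> I" for t
    using sp that by (auto simp: solution_space_def cont_curve_def I_def)
  show "u t \<in> H10 \<Omega>" if "t \<in> time_interval T" for t using uH(1) that by (simp add: I_def)
  have uH1: "u t \<in> H1 \<Omega>" "u t \<in> L2 M" if "t \<in> I" for t using uH[OF that] H10_H1 H1_L2 by auto
  \<comment> \<open>Three curves are extracted: \<open>v\<close> is the derivative in
    \<open>H10\<close>, admissible for testing; \<open>w\<close> is the derivative in L2, and
    \<open>z\<close> is the derivative of \<open>w\<close>.\<close>
  obtain v where v: "\<And>t. t \<in> I \<Longrightarrow> has_curve_deriv (H10 \<Omega>) (H1_norm \<Omega>) I u t (v t)"
    using sp by (auto simp: solution_space_def I_def)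
  obtain w where w: "\<And>t. t \<in> I \<Longrightarrow> has_curve_deriv (Lp 2 \<Omega>) (Lp_norm 2 \<Omega>) I u t (w t)"
    "Ck_curve (Suc 0) (Lp 2 \<Omega>) (Lp_norm 2 \<Omega>) I w"
    using sp by (auto simp: solution_space_def I_def numeral_2_eq_2)
  obtain z where z: "\<And>t. t \<in> I \<Longrightarrow> has_curve_deriv (Lp 2 \<Omega>) (Lp_norm 2 \<Omega>) I w t (z t)"
    using w(2) by auto
  have vH: "v t \<in> H10 \<Omega>" if "t \<in> I" for t using v[OF that] by (simp add: has_curve_deriv_def)
  have wL: "w t \<in> L2 M" if "t \<in> I" for t using w(1)[OF that] by (simp add: has_curve_deriv_def Lp_2)
  have zL: "z t \<in> L2 M" if "t \<in> I" for t using z[OF that] by (simp add: has_curve_deriv_def Lp_2)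
  have evI: "\<forall>\<^sub>F s in at t within I. s \<in> I" for t by (simp add: eventually_at_filter)
  have qH: "(\<lambda>x. (u s x - u t x) / (s - t) - v t x) \<in> H1 \<Omega>" if "t \<in> I" "s \<in> I" for s t
    using that by (intro D.diff_mem D.quotient_mem uH1 H10_H1[OF vH])
  have limW: "((\<lambda>s. W.N (\<lambda>x. (u s x - u t x) / (s - t) - v t x)) \<longlongrightarrow> 0) (at t within I)" if t: "t \<in> I" for t
  proof (rule Lim_transform_eventually)
    show "((\<lambda>s. H1_norm \<Omega> (\<lambda>x. (u s x - u t x) / (s - t) - v t x)) \<longlongrightarrow> 0) (at t within I)"
      using v[OF t] by (simp add: has_curve_deriv_def)
    show "\<forall>\<^sub>F s in at t within I. H1_norm \<Omega> (\<lambda>x. (u s x - u t x) / (s - t) - v t x)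
        = W.N (\<lambda>x. (u s x - u t x) / (s - t) - v t x)"
      using evI by eventually_elim (rule H1_norm_eq[OF qH[OF t]])
  qed
  have limD: "((\<lambda>s. D.N (\<lambda>x. (u s x - u t x) / (s - t) - v t x)) \<longlongrightarrow> 0) (at t within I)" if t: "t \<in> I" for t
    by (rule Lim_null_comparison[OF _ limW[OF t]], use evI[of t] in eventually_elim)
      (use D_le_W[OF qH[OF t]] D.N_nonneg[OF qH[OF t]] in auto)
  have limN: "((\<lambda>s. L2.N M (\<lambda>x. (u s x - u t x) / (s - t) - v t x)) \<longlongrightarrow> 0) (at t within I)" if t: "t \<in> I" for t
    by (rule Lim_null_comparison[OF _ limW[OF t]], use evI[of t] in eventually_elim)
      (use N_le_W[OF qH[OF t]] L2.N_nonneg[OF H1_L2[OF qH[OF t]]] in auto)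
  have vL2: "has_curve_deriv (Lp 2 \<Omega>) (Lp_norm 2 \<Omega>) I u t (v t)" if t: "t \<in> I" for t
    using limN[OF t] H1_L2[OF H10_H1[OF vH[OF t]]] by (simp add: has_curve_deriv_def Lp_2 Lp_norm_2)
  have vw: "AE x in M. v t x = w t x" if t: "t \<in> I" for t
    by (rule L2_curve_deriv_AE[of I u, OF uH1(2) t _ vL2[OF t] w(1)[OF t]])
      (use time_interval_nontrivial t in \<open>auto simp: I_def\<close>)
  have td: "AE x in M. time_deriv \<Omega> T u t x = w t x" "time_deriv \<Omega> T u t \<in> L2 M" if "t \<in> I" for t
    using time_deriv_AE[of T u t "w t"] uH1(2) w(1) that by (auto simp: I_def)
  show "time_deriv \<Omega> T u t \<in> L2 M" if "t \<in> time_interval T" for t using td(2) that by (simp add: I_def)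
  \<comment> \<open>Replacing \<open>w\<close> by the chosen velocity alters each time slice on a
    null set only, which no L2 norm of a difference quotient detects.\<close>
  have z': "has_curve_deriv (Lp 2 \<Omega>) (Lp_norm 2 \<Omega>) I (time_deriv \<Omega> T u) t (z t)" if t: "t \<in> I" for t
    unfolding has_curve_deriv_def
  proof
    show "z t \<in> Lp 2 \<Omega>" using zL[OF t] by (simp add: Lp_2)
    show "((\<lambda>s. Lp_norm 2 \<Omega> (\<lambda>x. (time_deriv \<Omega> T u s x - time_deriv \<Omega> T u t x) / (s - t) - z t x)) \<longlongrightarrow> 0) (at t within I)"
    proof (rule Lim_transform_eventually)
      show "((\<lambda>s. Lp_norm 2 \<Omega> (\<lambda>x. (w s x - w t x) / (s - t) - z t x)) \<longlongrightarrow> 0) (at t within I)"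
        using z[OF t] by (simp add: has_curve_deriv_def)
      show "\<forall>\<^sub>F s in at t within I. Lp_norm 2 \<Omega> (\<lambda>x. (w s x - w t x) / (s - t) - z t x)
          = Lp_norm 2 \<Omega> (\<lambda>x. (time_deriv \<Omega> T u s x - time_deriv \<Omega> T u t x) / (s - t) - z t x)"
        using evI
      proof eventually_elim
        case (elim s)
        show ?case
          unfolding Lp_norm_2
        proof (rule N_AE_cong)
          show "AE x in M. (w s x - w t x) / (s - t) - z t x
              = (time_deriv \<Omega> T u s x - time_deriv \<Omega> T u t x) / (s - t) - z t x"
            using td(1)[OF t] td(1)[OF elim] by eventually_elim simp
        qed (use t elim in \<open>auto intro!: L2_measurable L2.diff_mem L2.quotient_mem wL td(2) zL\<close>)
      qed
    qed
  qed
  have tdd: "AE x in M. time_deriv \<Omega> T (time_deriv \<Omega> T u) t x = z t x" if "t \<in> I" for t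
    using time_deriv_AE(1)[of T "time_deriv \<Omega> T u" t "z t"] td(2) z' that by (auto simp: I_def)
  have pde: "AE x in M. z t x - (a * dip \<Omega> (u t) (u t) + b) * weak_laplacian \<Omega> (u t) x
        = lam * u t x + \<bar>u t x\<bar> powr (p - 1) * u t x" if t: "t \<in> I" "0 < t" for t
  proof -
    have "AE x in M. time_deriv \<Omega> T (time_deriv \<Omega> T u) t x
        - (a * dip \<Omega> (u t) (u t) + b) * weak_laplacian \<Omega> (u t) x = lam * u t x + \<bar>u t x\<bar> powr (p - 1) * u t x"
      using sol[unfolded kirchhoff_solution_def, THEN conjunct2, THEN conjunct2, THEN conjunct1, rule_format, of t] t
      by (simp only: I_def[symmetric] Lp_norm_grad(2)[OF uH1(1)[OF t(1)]])
    then show ?thesis using tdd[OF t(1)] by eventually_elim simp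
  qed
  have der_w: "((\<lambda>s. ip M (w s) (w s)) has_real_derivative 2 * ip M (w t) (z t)) (at t within I)" if t: "t \<in> I" for t
    using z[OF t] by (intro L2.has_derivative_square wL zL t) (auto simp: has_curve_deriv_def Lp_norm_2)
  have der_D: "((\<lambda>s. dip \<Omega> (u s) (u s)) has_real_derivative 2 * dip \<Omega> (u t) (v t)) (at t within I)" if t: "t \<in> I" for t
    by (intro D.has_derivative_square uH1(1) H10_H1[OF vH] t limD)
  have der_N: "((\<lambda>s. ip M (u s) (u s)) has_real_derivative 2 * ip M (u t) (v t)) (at t within I)" if t: "t \<in> I" for t
    by (intro L2.has_derivative_square uH1(2) H1_L2[OF H10_H1[OF vH]] t limN)
  have der_P: "((\<lambda>s. Phi p (u s)) has_real_derivative ip M (\<lambda>x. \<bar>u t x\<bar> powr (p - 1) * u t x) (v t)) (at t within I)"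
    if t: "t \<in> I" for t
    by (rule Phi_has_derivative[OF uH(1) vH[OF t] t p limW[OF t]])
  define E where "E t = energy a b lam p (u t) (w t)" for t
  define E' where "E' t = ip M (w t) (z t) + a * dip \<Omega> (u t) (u t) * dip \<Omega> (u t) (v t) + b * dip \<Omega> (u t) (v t)
      - lam * ip M (u t) (v t) - ip M (\<lambda>x. \<bar>u t x\<bar> powr (p - 1) * u t x) (v t)" for t
  \<comment> \<open>Valid at the initial time as well, one-sidedly; there only the resulting
    continuity is used.\<close>
  have der_E: "(E has_real_derivative E' t) (at t within I)" if t: "t \<in> I" for t
    unfolding E_def energy_def
    by (rule derivative_eq_intros der_w[OF t] der_D[OF t] der_N[OF t] der_P[OF t] refl)+ (simp add: E'_def)
  have E'0: "E' t = 0" if t: "t \<in> I" "0 < t" for t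
    unfolding E'_def by (rule energy_derivative_zero[OF uH[OF t(1)] vH[OF t(1)] wL[OF t(1)] vw[OF t(1)] zL[OF t(1)] p pde[OF t]])
  have 0: "0 \<in> I" using T by (simp add: I_def time_interval_def zero_ereal_def)
  have E0: "E t = E 0" if t: "t \<in> I" for t
  proof (cases "t = 0")
    case False
    then have tp: "0 < t" using t by (simp add: I_def time_interval_def)
    have sub: "{0..t} \<subseteq> I" using time_interval_ge t by (auto simp: I_def)
    \<comment> \<open>The equation is given for positive times only; continuity at 0 connects the
      constant to the initial energy.\<close>
    show ?thesis
    proof (rule DERIV_isconst2[OF tp])
      have "continuous_on I E" by (rule DERIV_continuous_on) (rule der_E)
      then show "continuous_on {0..t} E" using sub continuous_on_subset by blast
      show "DERIV E x :> 0" if "0 < x" "x < t" for x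
        using der_E[of x] E'0[of x] sub that time_interval_at[of x T] by (auto simp: I_def subset_eq)
    qed (use tp in auto)
  qed simp
  have E_td: "energy a b lam p (u t) (time_deriv \<Omega> T u t) = E t" if t: "t \<in> I" for t
  proof -
    have "ip M (time_deriv \<Omega> T u t) (time_deriv \<Omega> T u t) = ip M (w t) (w t)"
      using L2_measurable[OF td(2)[OF t]] L2_measurable[OF wL[OF t]] td(1)[OF t] by (intro ip_AE_cong)
    then show ?thesis by (simp only: E_def energy_def)
  qed
  show "energy a b lam p (u t) (time_deriv \<Omega> T u t) = energy a b lam p (u 0) (time_deriv \<Omega> T u 0)"
    if "t \<in> time_interval T" for t
  proof -
    have t: "t \<in> I" using that by (simp add: I_def)
    show ?thesis unfolding E_td[OF t] E_td[OF 0] by (rule E0[OF t])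
  qed
  have "continuous_on I (\<lambda>t. dip \<Omega> (u t) (u t))" by (rule DERIV_continuous_on) (rule der_D)
  then show "continuous_on (time_interval T) (\<lambda>t. D.N (u t))"
    unfolding D.N_def I_def by (intro continuous_intros)
qed

section \<open>The a priori bound\<close>

lemma Phi_bound:
  assumes u: "u \<in> H10 \<Omega>" and p: "1 < p" "p < 3"
  shows "Phi p u \<le> embed_const * D.N u powr (p + 1)" "0 \<le> Phi p u"
proof -
  have e: "Phi p u = (\<integral>z. \<bar>u z\<bar> powr (p + 1) \<partial>M) / (p + 1)" by (simp add: Phi_def)
  have 1: "0 \<le> (\<integral>z. \<bar>u z\<bar> powr (p + 1) \<partial>M)" by simp
  then show "0 \<le> Phi p u" using p by (simp add: e)
  have "Phi p u \<le> (\<integral>z. \<bar>u z\<bar> powr (p + 1) \<partial>M)"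
    unfolding e using p 1 mult_left_mono[of 1 "p + 1" "\<integral>z. \<bar>u z\<bar> powr (p + 1) \<partial>M"] by (simp add: divide_le_eq)
  also have "\<dots> \<le> embed_const * D.N u powr (p + 1)" using Lr_embedding(2)[OF u, of "p + 1"] p by simp
  finally show "Phi p u \<le> embed_const * D.N u powr (p + 1)" .
qed

end

text \<open>For \<open>d > 1\<close> each term on the right is at most a multiple of
  \<open>d powr (p + 1)\<close>: the constant contributes \<open>\<bar>E\<bar>\<close> and the other
  two terms \<open>C\<close> each. Division leaves the positive power \<open>3 - p\<close> of
  \<open>d\<close>.\<close>

lemma quartic_bound:
  fixes a d E C p :: real
  assumes a: "0 < a" and C: "0 \<le> C" and p: "1 < p" "p < 3" and d: "0 \<le> d"
    and le: "a / 4 * d ^ 4 \<le> E + C * d\<^sup>2 + C * d powr (p + 1)"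
  shows "d \<le> max 1 ((4 * (\<bar>E\<bar> + 2 * C) / a) powr (1 / (3 - p)))"
proof (cases "d \<le> 1")
  case False
  define K where "K = \<bar>E\<bar> + 2 * C"
  have "1 \<le> d powr (p + 1)" using False p by (intro ge_one_powr_ge_zero) auto
  then have "E \<le> \<bar>E\<bar> * d powr (p + 1)" using mult_left_mono[of 1 "d powr (p + 1)" "\<bar>E\<bar>"] by simp
  moreover have "d\<^sup>2 \<le> d powr (p + 1)"
    using False p powr_mono[of 2 "p + 1" d] by simp
  then have "C * d\<^sup>2 \<le> C * d powr (p + 1)" using C by (rule mult_left_mono)
  ultimately have "a / 4 * d ^ 4 \<le> K * d powr (p + 1)"
    using le by (simp add: K_def distrib_right)
  moreover have "d ^ 4 = d powr (3 - p) * d powr (p + 1)"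
    using False by (simp flip: powr_add)
  ultimately have "(a / 4 * d powr (3 - p)) * d powr (p + 1) \<le> K * d powr (p + 1)" by simp
  then have "a / 4 * d powr (3 - p) \<le> K" using False by (simp add: mult_le_cancel_right)
  then have "d powr (3 - p) \<le> 4 * K / a" using a by (simp add: field_simps)
  then have "(d powr (3 - p)) powr (1 / (3 - p)) \<le> (4 * K / a) powr (1 / (3 - p))"
    using p by (intro powr_mono2) auto
  then have "d \<le> (4 * K / a) powr (1 / (3 - p))" using p d by (simp add: powr_powr)
  then show ?thesis by (simp add: K_def)
qed simp

context bounded_open
begin

lemma kirchhoff_bounded:
  assumes a: "0 < a" and b: "0 < b" and p: "1 < p" "p < 3"
    and sol: "kirchhoff_solution \<Omega> a b lam p u0 u1 T u"
  shows "\<exists>K1>0. \<forall>t\<in>time_interval T. Lp_norm 2 \<Omega> (time_deriv \<Omega> T u t) + Lp_norm 2 \<Omega> (weak_grad \<Omega> (u t)) \<le> K1"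
proof -
  note K = kirchhoff_energy[OF sol p]
  define E where "E = energy a b lam p (u 0) (time_deriv \<Omega> T u 0)"
  \<comment> \<open>One constant that absorbs the term with \<open>lam\<close>, through the Poincare
    inequality, and \<open>Phi\<close>; the summand 1 is for the latter.\<close>
  define C where "C = (\<bar>lam\<bar> + 1) * embed_const"
  have C0: "0 \<le> C" using embed_const_pos by (simp add: C_def)
  define R where "R = max 1 ((4 * (\<bar>E\<bar> + 2 * C) / a) powr (1 / (3 - p)))"
  \<comment> \<open>Once the gradient is bounded by \<open>R\<close>, the energy identity bounds the
    velocity by this number.\<close>
  define Q where "Q = sqrt (2 * (\<bar>E\<bar> + C * R\<^sup>2 + C * R powr (p + 1)))"
  have R1: "1 \<le> R" by (simp add: R_def)
  have "L2.N M (time_deriv \<Omega> T u t) \<le> Q" "D.N (u t) \<le> R" if t: "t \<in> time_interval T" for t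
  proof -
    let ?d = "D.N (u t)" and ?w = "time_deriv \<Omega> T u t"
    have uH: "u t \<in> H1 \<Omega>" "u t \<in> L2 M" using K(1)[OF t] H10_H1 H1_L2 by auto
    have d0: "0 \<le> ?d" by (rule D.N_nonneg[OF uH(1)])
    have dd: "(dip \<Omega> (u t) (u t))\<^sup>2 = ?d ^ 4" by (simp add: D.N_sq[OF uH(1), symmetric] flip: power_mult)
    have "lam / 2 * ip M (u t) (u t) \<le> (\<bar>lam\<bar> + 1) * (embed_const * ?d\<^sup>2)"
    proof (rule mult_mono)
      show "ip M (u t) (u t) \<le> embed_const * ?d\<^sup>2" using Poincare[OF K(1)[OF t]] by (simp add: L2.N_sq[OF uH(2)])
    qed (auto simp: ip_pos)
    moreover have "Phi p (u t) \<le> C * ?d powr (p + 1)"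
    proof -
      have "embed_const * ?d powr (p + 1) \<le> C * ?d powr (p + 1)"
        unfolding C_def using embed_const_pos by (intro mult_right_mono) auto
      then show ?thesis using Phi_bound(1)[OF K(1)[OF t] p] by linarith
    qed
    moreover have "1 / 2 * (L2.N M ?w)\<^sup>2 + a / 4 * ?d ^ 4 + b / 2 * ?d\<^sup>2 - lam / 2 * ip M (u t) (u t) - Phi p (u t) = E"
      using K(3)[OF t] by (simp add: E_def energy_def dd L2.N_sq[OF K(2)[OF t]] D.N_sq[OF uH(1)])
    moreover have "0 \<le> b / 2 * ?d\<^sup>2" using b by simp
    ultimately have le: "1 / 2 * (L2.N M ?w)\<^sup>2 + a / 4 * ?d ^ 4 \<le> E + C * ?d\<^sup>2 + C * ?d powr (p + 1)"
      by (simp add: C_def mult.assoc)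
    have "0 \<le> 1 / 2 * (L2.N M ?w)\<^sup>2" by simp
    then have "a / 4 * ?d ^ 4 \<le> E + C * ?d\<^sup>2 + C * ?d powr (p + 1)" using le by linarith
    from quartic_bound[OF a C0 p d0 this] show dR: "?d \<le> R" by (simp add: R_def)
    have "C * ?d\<^sup>2 \<le> C * R\<^sup>2" using dR d0 C0 by (intro mult_left_mono power_mono) auto
    moreover have "C * ?d powr (p + 1) \<le> C * R powr (p + 1)"
      using dR d0 C0 p by (intro mult_left_mono powr_mono2) auto
    moreover have "0 \<le> a / 4 * ?d ^ 4" using a by simp
    ultimately have "(L2.N M ?w)\<^sup>2 \<le> 2 * (\<bar>E\<bar> + C * R\<^sup>2 + C * R powr (p + 1))"
      using le abs_ge_self[of E] by (simp only: distrib_left)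
    then have "sqrt ((L2.N M ?w)\<^sup>2) \<le> Q" unfolding Q_def by (rule real_sqrt_le_mono)
    then show "L2.N M ?w \<le> Q" using L2.N_nonneg[OF K(2)[OF t]] by simp
  qed
  then have "Lp_norm 2 \<Omega> (time_deriv \<Omega> T u t) + Lp_norm 2 \<Omega> (weak_grad \<Omega> (u t)) \<le> Q + R"
    if "t \<in> time_interval T" for t
    using that Lp_norm_grad(1)[OF H10_H1[OF K(1)[OF that]]] by (simp add: Lp_norm_2 add_mono)
  moreover have "0 < Q + R" using R1 C0 by (simp add: Q_def add_nonneg_pos)
  ultimately show ?thesis by blast
qed

section \<open>The lower bound for nonpositive energy\<close>

lemma sobolev_const_le:
  assumes u: "u \<in> H10 \<Omega>"
  shows "sobolev_const q \<Omega> * (Lp_norm q \<Omega> u)\<^sup>2 \<le> (D.N u)\<^sup>2"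
    and "D.N u \<noteq> 0 \<Longrightarrow> 0 \<le> sobolev_const q \<Omega>"
proof -
  let ?S = "{(Lp_norm 2 \<Omega> (weak_grad \<Omega> u))\<^sup>2 / (Lp_norm q \<Omega> u)\<^sup>2 | u.
      u \<in> H10 \<Omega> \<and> \<not> (AE x in M. u x = 0)}"
  have nn: "0 \<le> x" if "x \<in> ?S" for x using that by auto
  have uH: "u \<in> H1 \<Omega>" using u H10_H1 by auto
  have mem: "(D.N u)\<^sup>2 / (Lp_norm q \<Omega> u)\<^sup>2 \<in> ?S" if "\<not> (AE x in M. u x = 0)"
    unfolding mem_Collect_eq by (rule exI[of _ u]) (use that u Lp_norm_grad(1)[OF uH] in simp)
  show "sobolev_const q \<Omega> * (Lp_norm q \<Omega> u)\<^sup>2 \<le> (D.N u)\<^sup>2"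
  proof (cases "Lp_norm q \<Omega> u = 0")
    case False
    have "\<not> (AE x in M. u x = 0)"
    proof
      assume "AE x in M. u x = 0"
      then have "(\<integral>x. norm (u x) powr q \<partial>M) = 0" by (intro integral_eq_zero_AE) auto
      then show False using False by (simp add: Lp_norm_def)
    qed
    then have "sobolev_const q \<Omega> \<le> (D.N u)\<^sup>2 / (Lp_norm q \<Omega> u)\<^sup>2"
      unfolding sobolev_const_def by (intro cInf_lower mem bdd_belowI[of _ 0] nn)
    then show ?thesis using False by (simp add: pos_le_divide_eq)
  qed simp
  \<comment> \<open>\<open>Inf\<close> of the empty set would be unspecified, so nonnegativity needs
    an admissible function; a nonzero Dirichlet norm shows that \<open>u\<close> is one.\<close>
  assume D: "D.N u \<noteq> 0"
  have "\<not> (AE x in M. u x = 0)"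
  proof
    assume *: "AE x in M. u x = 0"
    have "dip \<Omega> (\<lambda>x. 0) (\<lambda>x. 0) = dip \<Omega> u u" by (rule dip_AE[OF uH * uH *])
    moreover have "dip \<Omega> (\<lambda>x. 0) (\<lambda>x. 0) = 0" using D.B_scale[OF H1_zero H1_zero, of 0] by simp
    ultimately show False using D by (simp add: D.N_def)
  qed
  then show "0 \<le> sobolev_const q \<Omega>"
    unfolding sobolev_const_def using mem nn by (intro cInf_greatest) blast+
qed

lemma Lp_norm_powr:
  assumes "0 < q"
  shows "Lp_norm q \<Omega> u powr q = (\<integral>x. \<bar>u x\<bar> powr q \<partial>M)"
  using assms by (simp add: Lp_norm_def powr_powr)

text \<open>Without the nonnegative kinetic and quartic terms the energy inequality says that half
  of \<open>b_zero\<close> times the squared Dirichlet norm is at most \<open>Phi p u\<close>. The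
  Sobolev constant bounds the latter by the power \<open>p + 1\<close> of the same norm, and
  cancelling the square leaves the power \<open>p - 1\<close> whose root is the threshold.\<close>

lemma nonpositive_energy_dichotomy:
  assumes a: "0 < a" and b: "0 < b" and p: "1 < p" "p < 3" and lam: "lam < b * principal_eigenvalue \<Omega>"
    and u: "u \<in> H10 \<Omega>" and w: "w \<in> L2 M" and E: "energy a b lam p u w \<le> 0" and d: "D.N u \<noteq> 0"
  shows "((p + 1) / 2 * b_zero \<Omega> b lam * sobolev_const (p + 1) \<Omega> powr ((p + 1) / 2)) powr (1 / (p - 1)) \<le> D.N u"
proof -
  define q where "q = p + 1"
  define S where "S = sobolev_const q \<Omega>"
  define B where "B = b_zero \<Omega> b lam"
  define d where "d = D.N u"
  define L where "L = Lp_norm q \<Omega> u"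
  have uH: "u \<in> H1 \<Omega>" "u \<in> L2 M" using u H10_H1 H1_L2 by auto
  have dp: "0 < d" using D.N_nonneg[OF uH(1)] \<open>D.N u \<noteq> 0\<close> by (simp add: d_def)
  have S0: "0 \<le> S" unfolding S_def by (rule sobolev_const_le(2)[OF u \<open>D.N u \<noteq> 0\<close>])
  have L0: "0 \<le> L" by (simp add: L_def Lp_norm_def)
  have SL: "S * L\<^sup>2 \<le> d\<^sup>2" unfolding S_def L_def d_def by (rule sobolev_const_le(1)[OF u])
  have Phi: "Phi p u = L powr q / q"
    using p Lp_norm_powr[of q u] by (simp add: Phi_def L_def q_def)
  \<comment> \<open>For \<open>0 \<le> lam\<close> the assumption on \<open>lam\<close> itself makes
    the principal eigenvalue positive, so that the quotient in \<open>b_zero\<close> has its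
    intended meaning.\<close>
  have B0: "0 \<le> B"
  proof (cases "0 \<le> lam")
    case True
    then have "0 < b * principal_eigenvalue \<Omega>" using lam by linarith
    then have "0 < principal_eigenvalue \<Omega>" using b by (simp add: zero_less_mult_iff)
    then show ?thesis using lam True by (simp add: B_def b_zero_def field_simps)
  qed (use b in \<open>simp add: B_def b_zero_def\<close>)
  have Bd: "B * d\<^sup>2 \<le> b * d\<^sup>2 - lam * (L2.N M u)\<^sup>2"
  proof (cases "0 \<le> lam")
    case True
    then have "0 < b * principal_eigenvalue \<Omega>" using lam by linarith
    then have pe: "0 < principal_eigenvalue \<Omega>" using b by (simp add: zero_less_mult_iff)
    have "lam / principal_eigenvalue \<Omega> * (principal_eigenvalue \<Omega> * (L2.N M u)\<^sup>2) \<le> lam / principal_eigenvalue \<Omega> * d\<^sup>2"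
      unfolding d_def using True pe by (intro mult_left_mono principal_eigenvalue_le[OF u]) auto
    then show ?thesis using True pe by (simp add: B_def b_zero_def left_diff_distrib)
  next
    case False
    then have "lam * (L2.N M u)\<^sup>2 \<le> 0" by (intro mult_nonpos_nonneg) auto
    then show ?thesis using False by (simp add: B_def b_zero_def)
  qed
  have "b / 2 * d\<^sup>2 - lam / 2 * (L2.N M u)\<^sup>2 \<le> Phi p u"
  proof -
    have "0 \<le> 1 / 2 * ip M w w" "0 \<le> a / 4 * (dip \<Omega> u u)\<^sup>2" using a by (auto simp: ip_pos)
    then show ?thesis
      using E by (simp add: energy_def d_def D.N_sq[OF uH(1)] L2.N_sq[OF uH(2)])
  qed
  then have main: "q / 2 * B * d\<^sup>2 \<le> L powr q"
  proof -
    assume *: "b / 2 * d\<^sup>2 - lam / 2 * (L2.N M u)\<^sup>2 \<le> Phi p u"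
    have "B / 2 * d\<^sup>2 \<le> L powr q / q" using * Bd unfolding Phi by (simp add: field_simps)
    then show ?thesis using p by (simp add: q_def field_simps)
  qed
  \<comment> \<open>The Sobolev inequality is kept in multiplied form, which avoids a division by
    \<open>S\<close>.\<close>
  have "S powr (q / 2) * L powr q = (S * L\<^sup>2) powr (q / 2)"
  proof -
    have "(L\<^sup>2) powr (q / 2) = L powr q"
      using L0 by (cases "L = 0") (simp_all add: powr_powr flip: powr_numeral)
    then show ?thesis using S0 by (simp add: powr_mult)
  qed
  also have "\<dots> \<le> (d\<^sup>2) powr (q / 2)" using SL S0 p by (intro powr_mono2) (auto simp: q_def)
  also have "\<dots> = d powr q" using dp by (simp add: powr_powr flip: powr_numeral)
  finally have SLd: "S powr (q / 2) * L powr q \<le> d powr q" .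
  define Kc where "Kc = q / 2 * B * S powr (q / 2)"
  have "Kc * d\<^sup>2 = S powr (q / 2) * (q / 2 * B * d\<^sup>2)" by (simp add: Kc_def)
  also have "\<dots> \<le> S powr (q / 2) * L powr q" by (intro mult_left_mono main) simp
  also have "\<dots> \<le> d powr q" by (rule SLd)
  also have "\<dots> = d powr (p - 1) * d\<^sup>2"
  proof -
    have "d powr q = d powr (p - 1) * d powr 2" by (subst powr_add[symmetric]) (simp add: q_def add.commute)
    then show ?thesis using dp by simp
  qed
  finally have "Kc \<le> d powr (p - 1)" using dp by (simp add: mult_le_cancel_right)
  moreover have "0 \<le> Kc" using B0 p by (simp add: Kc_def q_def)
  ultimately have "Kc powr (1 / (p - 1)) \<le> (d powr (p - 1)) powr (1 / (p - 1))"
    using p by (intro powr_mono2) auto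
  also have "\<dots> = d" using p dp by (simp add: powr_powr)
  finally show ?thesis by (simp add: Kc_def B_def S_def d_def q_def)
qed

text \<open>The data agree with the curve at time 0 only almost everywhere, and none of the terms of
  the energy sees a null set.\<close>

lemma initial_energy_eq:
  assumes p: "1 < p" and u: "u \<in> H1 \<Omega>" and w: "w \<in> L2 M"
    and u0: "AE x in M. u x = u0 x" and u1: "AE x in M. w x = u1 x"
  shows "initial_energy \<Omega> a b lam p u0 u1 = energy a b lam p u w"
    "Lp_norm 2 \<Omega> (weak_grad \<Omega> u0) = D.N u"
proof -
  have m: "u \<in> borel_measurable M" "u0 \<in> borel_measurable M" "w \<in> borel_measurable M" "u1 \<in> borel_measurable M"
    using measurable_AE u0 u1 L2_measurable[OF H1_L2[OF u]] L2_measurable[OF w] by blast+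
  have u0H: "u0 \<in> H1 \<Omega>" by (rule H1_AE(1)[OF u u0])
  have d: "dip \<Omega> u0 u0 = dip \<Omega> u u" by (rule dip_AE[OF u u0 u u0])
  show g: "Lp_norm 2 \<Omega> (weak_grad \<Omega> u0) = D.N u"
    using Lp_norm_grad(1)[OF u0H] d by (simp add: D.N_def)
  have N: "Lp_norm 2 \<Omega> u0 = L2.N M u" "Lp_norm 2 \<Omega> u1 = L2.N M w"
    unfolding Lp_norm_2 using m u0 u1 by (auto intro!: N_AE_cong simp: eq_commute)
  have "Lp_norm (p + 1) \<Omega> u0 powr (p + 1) = (\<integral>x. \<bar>u0 x\<bar> powr (p + 1) \<partial>M)"
    using p by (intro Lp_norm_powr) auto
  also have "\<dots> = (\<integral>x. \<bar>u x\<bar> powr (p + 1) \<partial>M)"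
    using m u0 by (intro integral_cong_AE) auto
  finally have "1 / (p + 1) * Lp_norm (p + 1) \<Omega> u0 powr (p + 1) = Phi p u"
    by (simp add: Phi_def)
  moreover have "D.N u ^ 4 = (dip \<Omega> u u)\<^sup>2" by (simp add: D.N_sq[OF u, symmetric] flip: power_mult)
  ultimately show "initial_energy \<Omega> a b lam p u0 u1 = energy a b lam p u w"
    unfolding initial_energy_def potential_energy_def energy_def g N
    by (simp add: D.N_sq[OF u] L2.N_sq[OF H1_L2[OF u]] L2.N_sq[OF w])
qed

lemma kirchhoff_lower_bound:
  assumes a: "0 < a" and b: "0 < b" and p: "1 < p" "p < 3"
    and sol: "kirchhoff_solution \<Omega> a b lam p u0 u1 T u"
    and lam: "lam < b * principal_eigenvalue \<Omega>" and E: "initial_energy \<Omega> a b lam p u0 u1 \<le> 0"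
    and pos: "0 < Lp_norm 2 \<Omega> (weak_grad \<Omega> u0)" and t: "t \<in> time_interval T"
  shows "((p + 1) / 2 * b_zero \<Omega> b lam * sobolev_const (p + 1) \<Omega> powr ((p + 1) / 2)) powr (1 / (p - 1))
    \<le> Lp_norm 2 \<Omega> (weak_grad \<Omega> (u t))"
proof -
  define R where "R = ((p + 1) / 2 * b_zero \<Omega> b lam * sobolev_const (p + 1) \<Omega> powr ((p + 1) / 2)) powr (1 / (p - 1))"
  note K = kirchhoff_energy[OF sol p]
  have 0: "0 \<in> time_interval T"
    using sol by (simp add: kirchhoff_solution_def time_interval_def zero_ereal_def)
  have ini: "AE x in M. u 0 x = u0 x" "AE x in M. time_deriv \<Omega> T u 0 x = u1 x"
    using sol by (auto simp: kirchhoff_solution_def)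
  note I = initial_energy_eq[OF p(1) H10_H1[OF K(1)[OF 0]] K(2)[OF 0] ini]
  have dich: "R \<le> D.N (u s)" if s: "s \<in> time_interval T" "D.N (u s) \<noteq> 0" for s
    unfolding R_def
    by (rule nonpositive_energy_dichotomy[OF a b p lam K(1)[OF s(1)] K(2)[OF s(1)] _ s(2)])
      (use K(3)[OF s(1)] E I(1) in simp)
  have d0: "0 < D.N (u 0)" using pos I(2) by simp
  have "R \<le> D.N (u t)"
  proof (rule ccontr)
    assume n: "\<not> R \<le> D.N (u t)"
    then have z: "D.N (u t) = 0" using dich[OF t] by blast
    then have Rp: "0 < R" using n by simp
    have t0: "0 \<le> t" using t by (simp add: time_interval_def)
    have "continuous_on {0..t} (\<lambda>s. D.N (u s))"
      by (rule continuous_on_subset[OF K(4)]) (use time_interval_ge[OF t] in auto)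
    \<comment> \<open>The value \<open>R / 2\<close> lies in the forbidden gap between 0 and
      \<open>R\<close>, while the norm would fall from at least \<open>R\<close> to 0 and so has to
      cross it.\<close>
    moreover have "D.N (u t) \<le> R / 2" "R / 2 \<le> D.N (u 0)"
      using z Rp dich[OF 0] d0 by auto
    ultimately obtain s where s: "0 \<le> s" "s \<le> t" "D.N (u s) = R / 2"
      using IVT2'[of "\<lambda>s. D.N (u s)" t "R / 2" 0] t0 by blast
    then have "R \<le> R / 2" using dich[OF time_interval_ge[OF t s(1,2)]] Rp by simp
    then show False using Rp by simp
  qed
  then show ?thesis
    unfolding R_def Lp_norm_grad(1)[OF H10_H1[OF K(1)[OF t]]] .
qed

end

theorem theorem2p2:
  fixes \<Omega> :: "(real^3) set" and p b lam :: real
  assumes "open \<Omega>" and "bounded \<Omega>" and "smooth_boundary \<Omega>"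
    and "1 < p" and "p < 3" and "0 < b"
  shows "(\<forall>(a::real) u0 u1 u T.
            0 < a \<and> u0 \<in> H2 \<Omega> \<inter> H10 \<Omega> \<and> u1 \<in> H10 \<Omega> \<and>
            T = max_existence_time \<Omega> a b lam p u0 u1 \<and>
            kirchhoff_solution \<Omega> a b lam p u0 u1 T u
            \<longrightarrow> (\<exists>K1>0. \<forall>t\<in>time_interval T.
                   Lp_norm 2 \<Omega> (time_deriv \<Omega> T u t) + Lp_norm 2 \<Omega> (weak_grad \<Omega> (u t)) \<le> K1)) \<and>
         (\<exists>a0>0. \<forall>(a::real) u0 u1 u T.
            0 < a \<and> a < a0 \<and> u0 \<in> H2 \<Omega> \<inter> H10 \<Omega> \<and> u1 \<in> H10 \<Omega> \<and>
            T = max_existence_time \<Omega> a b lam p u0 u1 \<and>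
            kirchhoff_solution \<Omega> a b lam p u0 u1 T u \<and>
            lam < b * principal_eigenvalue \<Omega> \<and>
            initial_energy \<Omega> a b lam p u0 u1 \<le> 0 \<and>
            0 < Lp_norm 2 \<Omega> (weak_grad \<Omega> u0)
            \<longrightarrow> (\<forall>t\<in>time_interval T.
                   ((p + 1) / 2 * b_zero \<Omega> b lam * sobolev_const (p + 1) \<Omega> powr ((p + 1) / 2))
                     powr (1 / (p - 1))
                   \<le> Lp_norm 2 \<Omega> (weak_grad \<Omega> (u t))))"
proof -
  interpret bounded_open \<Omega> by unfold_locales (use assms in auto)
  show ?thesis
  proof (intro conjI allI impI, goal_cases)
    case (1 a u0 u1 u T)
    then show ?case using kirchhoff_bounded[OF _ \<open>0 < b\<close> \<open>1 < p\<close> \<open>p < 3\<close>] by blast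
  next
    case 2
    show ?case
      using kirchhoff_lower_bound[OF _ \<open>0 < b\<close> \<open>1 < p\<close> \<open>p < 3\<close>]
      by (intro exI[of _ 1]) (simp, blast)
  qed
qed

end
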